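(* Let $L=S(1,n)$ with $n\ge3$, so that $\mathrm{Der}\,L=L\rtimes\mathfrak{a}$ with $\mathfrak{a}=\mathbb{C}E+\mathbb{C}\,\xi_1\cdots\xi_n\frac{\partial}{\partial x}$. (i) All maximal among open $E$-invariant subalgebras of $L$ are, up to conjugation, the graded subalgebras of type $(1|1,\dots,1,0,\dots,0)$ with $k$ zeros, for some $k=0,\dots,n$. (ii) If $\mathfrak{a}_0=\mathbb{C}\,\xi_1\cdots\xi_n\frac{\partial}{\partial x}$ or $\mathfrak{a}_0=\mathfrak{a}$, then all maximal among open $\mathfrak{a}_0$-invariant subalgebras of $L$ are, up to conjugation, the graded subalgebras of type $(1|1,\dots,1,0,\dots,0)$ with $k$ zeros, for some $k=0,\dots,n-1$.
   Context: The ground field is $\mathbb{C}$. $\Lambda(1,n)=\Lambda(n)[[x]]$ with $\Lambda(n)$ the Grassmann algebra in odd indeterminates $\xi_1,\dots,\xi_n$, with the formal topology; $W(1,n)$ is the linearly compact Lie superalgebra of its continuous derivations $X=P\frac{\partial}{\partial x}+\sum_jQ_j\frac{\partial}{\partial\xi_j}$; $\mathrm{div}(X)=\frac{\partial P}{\partial x}+\sum_j(-1)^{p(Q_j)}\frac{\partial Q_j}{\partial\xi_j}$. $S'(1,n)=\{X\in W(1,n)\mid\mathrm{div}(X)=0\}$, $S(1,n)=[S'(1,n),S'(1,n)]$; one has $S'(1,n)=S(1,n)+\mathbb{C}\xi_1\cdots\xi_n\frac{\partial}{\partial x}$. $E=x\frac{\partial}{\partial x}+\sum_i\xi_i\frac{\partial}{\partial\xi_i}$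 is the Euler operator; $\mathfrak a$ acts on $L$ by commutators inside $W(1,n)$. "Maximal among open $\mathfrak{a}_0$-invariant subalgebras" means a maximal element of the set of proper open subalgebras of $L$ that are invariant under $\mathfrak{a}_0$. The grading of type $(a|b_1,\dots,b_n)$ is given by $a=\deg x=-\deg\frac{\partial}{\partial x}$, $b_j=\deg\xi_j=-\deg\frac{\partial}{\partial\xi_j}$; the graded subalgebra of this type is $\prod_{j\ge0}L_j$. "Conjugation" means conjugation by the group $G$ of inner automorphisms of $\mathrm{Der}\,L$, generated by $\exp(\mathrm{ad}\,a)$ for exponentiable even $a\in\mathrm{Der}\,L$ (those for which $\exp(t\,\mathrm{ad}\,a)$ converges for all $t\in\mathbb{C}$ to a continuous automorphism). *)

theory Defs
  imports
    "HOL-Analysis.Analysis"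
    "HOL-Computational_Algebra.Formal_Power_Series"
    "HOL-Library.Function_Algebras"
    "HOL-Algebra.Bij"
    "HOL-Algebra.Generated_Groups"
begin

section \<open>The superalgebra of formal functions in one even and n odd variables\<close>

text \<open>
  An element of \<open>\<Lambda>(n)[[x]]\<close> is the family of its coefficients: \<open>f A\<close> is the power series in \<open>x\<close>
  in front of the monomial \<open>\<xi>\<^sub>A\<close>, the product of the \<open>\<xi>\<^sub>j\<close>, \<open>j \<in> A\<close>, in increasing order of \<open>j\<close>.
  The odd indeterminates are numbered from 1 to \<open>n\<close>.

  The type carries the library topology: the product of the \<open>x\<close>-adic topologies on power series.
  As only finitely many of the sets \<open>A\<close> matter, this is the formal topology, in which the
  sets \<open>x\<^sup>N \<Lambda>(n)[[x]]\<close> are a basis of neighbourhoods of 0.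
\<close>

type_synonym sfun = "nat set \<Rightarrow> complex fps"

definition Lam :: "nat \<Rightarrow> sfun set" where
  "Lam n = {f. \<forall>A. \<not> A \<subseteq> {1..n} \<longrightarrow> f A = 0}"

definition shuffle_sign :: "nat set \<Rightarrow> nat set \<Rightarrow> complex fps" where
  "shuffle_sign A B = (-1) ^ card {(a, b). a \<in> A \<and> b \<in> B \<and> b < a}"

definition sfun_mult :: "sfun \<Rightarrow> sfun \<Rightarrow> sfun" where
  "sfun_mult f g = (\<lambda>A. \<Sum>B\<in>Pow A. shuffle_sign B (A - B) * f B * g (A - B))"

definition d_x :: "sfun \<Rightarrow> sfun" where
  "d_x f = (\<lambda>A. fps_deriv (f A))"

text \<open>The left derivation \<open>\<partial>/\<partial>\<xi>\<^sub>j\<close>.\<close>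

definition d_xi :: "nat \<Rightarrow> sfun \<Rightarrow> sfun" where
  "d_xi j f = (\<lambda>A. if j \<in> A then 0 else (-1) ^ card {i \<in> A. i < j} * f (insert j A))"

section \<open>The Lie superalgebra W(1,n)\<close>

text \<open>
  The continuous derivation \<open>P \<partial>/\<partial>x + \<Sum>\<^sub>j Q\<^sub>j \<partial>/\<partial>\<xi>\<^sub>j\<close> is the family \<open>X\<close> of its coefficients:
  \<open>X 0 = P\<close> and \<open>X j = Q\<^sub>j\<close> for \<open>1 \<le> j \<le> n\<close>. The topology is again the one of the type.
\<close>

type_synonym vfield = "nat \<Rightarrow> sfun"

definition W :: "nat \<Rightarrow> vfield set" where
  "W n = {X. (\<forall>i\<le>n. X i \<in> Lam n) \<and> (\<forall>i>n. X i = 0)}"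

definition vf_scale :: "complex \<Rightarrow> vfield \<Rightarrow> vfield" where
  "vf_scale c X = (\<lambda>i A. fps_const c * X i A)"

global_interpretation vf: vector_space vf_scale
  by standard (auto simp: vf_scale_def fun_eq_iff algebra_simps
      simp flip: fps_const_add fps_const_mult)

text \<open>
  The term \<open>f \<xi>\<^sub>A \<partial>/\<partial>x\<close> has the parity of \<open>card A\<close>, the term \<open>f \<xi>\<^sub>A \<partial>/\<partial>\<xi>\<^sub>j\<close> that of \<open>card A + 1\<close>.
\<close>

definition vf_even :: "vfield \<Rightarrow> vfield" where
  "vf_even X = (\<lambda>i A. if even (card A + (if i = 0 then 0 else 1)) then X i A else 0)"

definition vf_odd :: "vfield \<Rightarrow> vfield" where
  "vf_odd X = X - vf_even X"

definition vf_act :: "nat \<Rightarrow> vfield \<Rightarrow> sfun \<Rightarrow> sfun" where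
  "vf_act n X f = sfun_mult (X 0) (d_x f) + (\<Sum>j=1..n. sfun_mult (X j) (d_xi j f))"

text \<open>
  A derivation is determined by its values on \<open>x, \<xi>\<^sub>1, \<dots>, \<xi>\<^sub>n\<close>, which are its coefficients. The
  supercommutator is \<open>X Y - (-1)\<^bsup>p(X)p(Y)\<^esup> Y X\<close> for homogeneous \<open>X, Y\<close>, hence
  \<open>X Y - Y X + 2 Y\<^sub>1 X\<^sub>1\<close> in general, where \<open>X\<^sub>1, Y\<^sub>1\<close> are the odd parts.
\<close>

definition vf_bracket :: "nat \<Rightarrow> vfield \<Rightarrow> vfield \<Rightarrow> vfield" where
  "vf_bracket n X Y =
     (\<lambda>i A. vf_act n X (Y i) A - vf_act n Y (X i) A + 2 * vf_act n (vf_odd Y) (vf_odd X i) A)"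

definition vf_monom :: "nat \<Rightarrow> nat set \<Rightarrow> nat \<Rightarrow> vfield" where
  "vf_monom m A i = (\<lambda>i' A'. if i' = i \<and> A' = A then fps_X ^ m else 0)"

section \<open>The Lie superalgebra S(1,n)\<close>

definition sfun_invol :: "sfun \<Rightarrow> sfun" where
  "sfun_invol f = (\<lambda>A. (-1) ^ card A * f A)"

definition vf_div :: "nat \<Rightarrow> vfield \<Rightarrow> sfun" where
  "vf_div n X = d_x (X 0) + (\<Sum>j=1..n. d_xi j (sfun_invol (X j)))"

definition S' :: "nat \<Rightarrow> vfield set" where
  "S' n = {X \<in> W n. vf_div n X = 0}"

definition S :: "nat \<Rightarrow> vfield set" where
  "S n = vf.span {vf_bracket n X Y | X Y. X \<in> S' n \<and> Y \<in> S' n}"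

definition euler :: "nat \<Rightarrow> vfield" where
  "euler n = vf_monom 1 {} 0 + (\<Sum>j=1..n. vf_monom 0 {j} j)"

text \<open>\<open>\<xi>\<^sub>1 \<dots> \<xi>\<^sub>n \<partial>/\<partial>x\<close>\<close>

definition top_vf :: "nat \<Rightarrow> vfield" where
  "top_vf n = vf_monom 0 {1..n} 0"

section \<open>Maximal open invariant subalgebras\<close>

text \<open>Subspaces of a superspace are, as usual, required to be graded by parity.\<close>

definition subalgebra_of :: "nat \<Rightarrow> vfield set \<Rightarrow> vfield set \<Rightarrow> bool" where
  "subalgebra_of n L K \<longleftrightarrow> K \<subseteq> L \<and> vf.subspace K \<and> (\<forall>X\<in>K. vf_even X \<in> K)
     \<and> (\<forall>X\<in>K. \<forall>Y\<in>K. vf_bracket n X Y \<in> K)"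

definition open_inv_subalgebras :: "nat \<Rightarrow> vfield set \<Rightarrow> vfield set \<Rightarrow> vfield set set" where
  "open_inv_subalgebras n L \<aa> = {K. subalgebra_of n L K \<and> K \<noteq> L \<and> openin (top_of_set L) K
     \<and> (\<forall>Z\<in>\<aa>. \<forall>X\<in>K. vf_bracket n Z X \<in> K)}"

definition maximal_open_inv :: "nat \<Rightarrow> vfield set \<Rightarrow> vfield set \<Rightarrow> vfield set \<Rightarrow> bool" where
  "maximal_open_inv n L \<aa> K \<longleftrightarrow> K \<in> open_inv_subalgebras n L \<aa>
     \<and> (\<forall>K'\<in>open_inv_subalgebras n L \<aa>. K \<subseteq> K' \<longrightarrow> K' = K)"

section \<open>Gradings\<close>

text \<open>Degree of \<open>x\<^sup>m \<xi>\<^sub>A \<partial>\<^sub>i\<close> in the grading of type \<open>(a | b\<^sub>1, \<dots>, b\<^sub>n)\<close>.\<close>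

definition vf_deg :: "int \<Rightarrow> (nat \<Rightarrow> int) \<Rightarrow> nat \<Rightarrow> nat set \<Rightarrow> nat \<Rightarrow> int" where
  "vf_deg a b m A i = a * int m + (\<Sum>j\<in>A. b j) - (if i = 0 then a else b i)"

definition vf_comp :: "int \<Rightarrow> (nat \<Rightarrow> int) \<Rightarrow> int \<Rightarrow> vfield \<Rightarrow> vfield" where
  "vf_comp a b d X = (\<lambda>i A. Abs_fps (\<lambda>m. if vf_deg a b m A i = d then fps_nth (X i A) m else 0))"

text \<open>
  The product of the \<open>L\<^sub>d\<close>, \<open>d \<ge> 0\<close>: an element is the formal sum of its homogeneous components,
  which lie in \<open>L\<close>, and there are none of negative degree.
\<close>

definition graded_subalgebra ::
    "nat \<Rightarrow> vfield set \<Rightarrow> int \<Rightarrow> (nat \<Rightarrow> int) \<Rightarrow> vfield set" where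
  "graded_subalgebra n L a b =
     {X \<in> W n. (\<forall>d\<ge>0. vf_comp a b d X \<in> L) \<and> (\<forall>d<0. vf_comp a b d X = 0)}"

text \<open>\<open>1, \<dots>, 1, 0, \<dots>, 0\<close> with \<open>k\<close> zeros\<close>

definition ones_zeros :: "nat \<Rightarrow> nat \<Rightarrow> nat \<Rightarrow> int" where
  "ones_zeros n k = (\<lambda>j. if j \<le> n - k then 1 else 0)"

section \<open>Derivations of L and conjugation\<close>

text \<open>
  Linear operators on \<open>L \<subseteq> W n\<close> are extended by 0 outside \<open>L\<close>. The topology on operators is
  the one of the function type: pointwise convergence, with respect to the formal topology on
  vector fields.
\<close>

type_synonym vf_op = "vfield \<Rightarrow> vfield"

definition op_scale :: "complex \<Rightarrow> vf_op \<Rightarrow> vf_op" where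
  "op_scale c D = (\<lambda>X. vf_scale c (D X))"

definition op_even :: "vfield set \<Rightarrow> vf_op \<Rightarrow> vf_op" where
  "op_even L D = (\<lambda>X. if X \<in> L then vf_even (D (vf_even X)) + vf_odd (D (vf_odd X)) else 0)"

definition op_odd :: "vfield set \<Rightarrow> vf_op \<Rightarrow> vf_op" where
  "op_odd L D = (\<lambda>X. if X \<in> L then vf_odd (D (vf_even X)) + vf_even (D (vf_odd X)) else 0)"

text \<open>The supercommutator \<open>D D' - D' D + 2 D'\<^sub>1 D\<^sub>1\<close>, see the bracket of vector fields.\<close>

definition op_bracket :: "vfield set \<Rightarrow> vf_op \<Rightarrow> vf_op \<Rightarrow> vf_op" where
  "op_bracket L D D' =
     (\<lambda>X. D (D' X) - D' (D X) + vf_scale 2 (op_odd L D' (op_odd L D X)))"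

definition linear_op_on :: "vfield set \<Rightarrow> vf_op \<Rightarrow> bool" where
  "linear_op_on L D \<longleftrightarrow> (\<forall>X\<in>L. D X \<in> L) \<and> (\<forall>X. X \<notin> L \<longrightarrow> D X = 0)
     \<and> (\<forall>X\<in>L. \<forall>Y\<in>L. D (X + Y) = D X + D Y) \<and> (\<forall>c. \<forall>X\<in>L. D (vf_scale c X) = vf_scale c (D X))"

text \<open>
  Continuous superderivations. For an odd derivation the sign \<open>(-1)\<^bsup>p(X)\<^esup>\<close> in front of
  \<open>[X, D Y]\<close> amounts to replacing \<open>X\<close> by \<open>X\<^sub>0 - X\<^sub>1\<close>.
\<close>

definition Der :: "nat \<Rightarrow> vfield set \<Rightarrow> vf_op set" where
  "Der n L = {D. linear_op_on L D \<and> continuous_on L D \<and>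
     (\<forall>X\<in>L. \<forall>Y\<in>L.
        op_even L D (vf_bracket n X Y) =
          vf_bracket n (op_even L D X) Y + vf_bracket n X (op_even L D Y) \<and>
        op_odd L D (vf_bracket n X Y) =
          vf_bracket n (op_odd L D X) Y + vf_bracket n (vf_even X - vf_odd X) (op_odd L D Y))}"

definition ad_op :: "nat \<Rightarrow> vfield set \<Rightarrow> vfield \<Rightarrow> vf_op" where
  "ad_op n L X = (\<lambda>Y. if Y \<in> L then vf_bracket n X Y else 0)"

definition continuous_aut :: "nat \<Rightarrow> vfield set \<Rightarrow> (vf_op \<Rightarrow> vf_op) \<Rightarrow> bool" where
  "continuous_aut n L \<phi> \<longleftrightarrow> \<phi> \<in> Bij (Der n L) \<and> continuous_on (Der n L) \<phi>
     \<and> (\<forall>D\<in>Der n L. \<forall>D'\<in>Der n L. \<phi> (D + D') = \<phi> D + \<phi> D')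
     \<and> (\<forall>c. \<forall>D\<in>Der n L. \<phi> (op_scale c D) = op_scale c (\<phi> D))
     \<and> (\<forall>D\<in>Der n L. \<phi> (op_even L D) = op_even L (\<phi> D))
     \<and> (\<forall>D\<in>Der n L. \<forall>D'\<in>Der n L. \<phi> (op_bracket L D D') = op_bracket L (\<phi> D) (\<phi> D'))"

text \<open>
  The exponential series is summed coefficientwise, with the usual topology of the complex
  numbers on each coefficient of each value \<open>D Y\<close>; that is, in every finite-dimensional quotient
  by a neighbourhood \<open>x\<^sup>N W(1,n)\<close>. (With the discrete topology on the scalars, semisimple
  elements such as \<open>\<xi>\<^sub>1 \<partial>/\<partial>\<xi>\<^sub>1 - \<xi>\<^sub>2 \<partial>/\<partial>\<xi>\<^sub>2\<close> could not be exponentiated.)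
\<close>

definition exp_ad_term ::
    "vfield set \<Rightarrow> vf_op \<Rightarrow> complex \<Rightarrow> vf_op \<Rightarrow> vfield \<Rightarrow> nat \<Rightarrow> nat set \<Rightarrow> nat \<Rightarrow> nat \<Rightarrow> complex" where
  "exp_ad_term L a t D Y i A m k =
     t ^ k / fact k * fps_nth ((op_bracket L a ^^ k) D Y i A) m"

definition exp_ad :: "nat \<Rightarrow> vfield set \<Rightarrow> vf_op \<Rightarrow> complex \<Rightarrow> vf_op \<Rightarrow> vf_op" where
  "exp_ad n L a t =
     (\<lambda>D\<in>Der n L. \<lambda>Y i A. Abs_fps (\<lambda>m. \<Sum>k. exp_ad_term L a t D Y i A m k))"

definition exponentiable :: "nat \<Rightarrow> vfield set \<Rightarrow> vf_op \<Rightarrow> bool" where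
  "exponentiable n L a \<longleftrightarrow> a \<in> Der n L \<and> op_odd L a = 0 \<and>
     (\<forall>t. (\<forall>D\<in>Der n L. \<forall>Y\<in>L. \<forall>i A m. summable (exp_ad_term L a t D Y i A m))
          \<and> continuous_aut n L (exp_ad n L a t))"

definition inner_auts :: "nat \<Rightarrow> vfield set \<Rightarrow> (vf_op \<Rightarrow> vf_op) set" where
  "inner_auts n L = generate (BijGroup (Der n L)) {exp_ad n L a 1 | a. exponentiable n L a}"

text \<open>Subsets of \<open>L\<close> are moved by automorphisms of \<open>Der L\<close> via \<open>ad : L \<rightarrow> Der L\<close>.\<close>

definition conjugate_in :: "nat \<Rightarrow> vfield set \<Rightarrow> vfield set \<Rightarrow> vfield set \<Rightarrow> bool" where
  "conjugate_in n L K K' \<longleftrightarrow>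
     K \<subseteq> L \<and> K' \<subseteq> L \<and> (\<exists>g\<in>inner_auts n L. ad_op n L ` K' = g ` ad_op n L ` K)"

end

theory Submission
  imports Defs
begin

text \<open>
  Let \<open>K\<close> be a proper open invariant subalgebra. No element of \<open>K\<close> has leading term \<open>\<partial>/\<partial>x\<close>: as
  \<open>ad \<partial>/\<partial>x\<close> is onto, such an element would allow one to enlarge the neighbourhood of 0 contained in \<open>K\<close>
  until it is all of \<open>L\<close>. Linear changes of the odd variables make the leading terms occurring in \<open>K\<close>
  equal to \<open>\<partial>/\<partial>\<xi>\<^sub>j\<close> with \<open>j > n - k\<close>. It remains to show that, after conjugation, the terms
  \<open>\<xi>\<^sub>A \<partial>\<^sub>i\<close> with \<open>A \<subseteq> {n - k<..n}\<close>, \<open>i \<le> n - k\<close> do not occur in \<open>K\<close>, so that \<open>K\<close> lies in the graded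
  subalgebra with \<open>k\<close> zeros. This is done by induction on the size of \<open>A\<close>. If \<open>K\<close> contains elements
  \<open>Y\<^sub>j\<close> agreeing with \<open>\<partial>/\<partial>\<xi>\<^sub>j\<close> up to terms of the next order, then brackets with the \<open>Y\<^sub>j\<close> lower the
  size of \<open>A\<close>, and the induction hypothesis applies. If \<open>K\<close> is invariant under \<open>E\<close>, such \<open>Y\<^sub>j\<close> are obtained
  by a linear polynomial in \<open>ad E\<close> that removes the terms of lowest order. Otherwise the brackets of the \<open>Y\<^sub>j\<close> with each other show that the terms of
  lowest order form a closed form in the odd variables. A Poincare lemma provides a primitive \<open>Z\<close>, and
  \<open>exp(ad Z)\<close> removes these terms; \<open>Z\<close> commutes with \<open>\<xi>\<^sub>1 \<dots> \<xi>\<^sub>n \<partial>/\<partial>x\<close> for reasons of degree, so the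
  invariance of \<open>K\<close> is not lost. Finally, \<open>k = n\<close> is impossible when \<open>\<xi>\<^sub>1 \<dots> \<xi>\<^sub>n \<partial>/\<partial>x\<close> acts on \<open>K\<close>, since
  bracketing with it and then with the \<open>Y\<^sub>j\<close> leads to \<open>\<partial>/\<partial>x\<close>.
\<close>

section \<open>Sign rules and super Leibniz rules in the Grassmann algebra\<close>

section \<open>The Grassmann algebra over power series\<close>

text \<open>Absence of terms \<xi>_A \<partial>_i of small size is not preserved by brackets,
  because \<partial>/\<partial>\<xi>_j itself lowers the size of A. The cure is to subtract the
  leads: what remains has non-negative degree in a grading that gives weight e to x and the first n
  - k odd variables and weight 1 to the last k, and non-negative degree is closed under brackets.
  The induction on size passes through these gradings, one e at a time.

  Conjugation has to be realised by exponentials on Der L, where convergence is part of the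
  definition. Only fields Z are used that have positive degree in a grading counting some of the odd
  variables and giving x degree 0. Such degrees are bounded, so every series is finite; the same
  bound makes Z commute with the top field.

  An inclusion of a moved K in a graded subalgebra is enough: the graded subalgebra is itself open
  and invariant, so maximality of K turns the inclusion into an equality. That the graded
  subalgebras are themselves maximal follows from the same induction, with constant fields in the
  role of the Y_j.\<close>

lemma finite_inversions: "finite A \<Longrightarrow> finite {(a, b). a \<in> A \<and> b \<in> B \<and> b < (a::nat)}"
  by (rule finite_subset[of _ "A \<times> {..Max A}"]) (auto intro: less_imp_le order.trans[OF _ Max_ge])

lemma shuffle_sign_Un_left:
  assumes "finite A" "finite B" "A \<inter> B = {}"
  shows "shuffle_sign (A \<union> B) C = shuffle_sign A C * shuffle_sign B C"
proof -
  have "{(a, b). a \<in> A \<union> B \<and> b \<in> C \<and> b < a} =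
    {(a, b). a \<in> A \<and> b \<in> C \<and> b < a} \<union> {(a, b). a \<in> B \<and> b \<in> C \<and> b < a}" by auto
  moreover have "card ({(a, b). a \<in> A \<and> b \<in> C \<and> b < a} \<union> {(a, b). a \<in> B \<and> b \<in> C \<and> b < a}) =
    card {(a, b). a \<in> A \<and> b \<in> C \<and> b < a} + card {(a, b). a \<in> B \<and> b \<in> C \<and> b < a}"
    using assms by (intro card_Un_disjoint finite_inversions) auto
  ultimately show ?thesis by (simp add: shuffle_sign_def power_add)
qed

lemma shuffle_sign_Un_right:
  assumes "finite A" "B \<inter> C = {}"
  shows "shuffle_sign A (B \<union> C) = shuffle_sign A B * shuffle_sign A C"
proof -
  have "{(a, b). a \<in> A \<and> b \<in> B \<union> C \<and> b < a} =
    {(a, b). a \<in> A \<and> b \<in> B \<and> b < a} \<union> {(a, b). a \<in> A \<and> b \<in> C \<and> b < a}" by auto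
  moreover have "card ({(a, b). a \<in> A \<and> b \<in> B \<and> b < a} \<union> {(a, b). a \<in> A \<and> b \<in> C \<and> b < a}) =
    card {(a, b). a \<in> A \<and> b \<in> B \<and> b < a} + card {(a, b). a \<in> A \<and> b \<in> C \<and> b < a}"
    using assms by (intro card_Un_disjoint finite_inversions) auto
  ultimately show ?thesis by (simp add: shuffle_sign_def power_add)
qed

text \<open>Each pair in A \<times> B is an inversion for exactly one of the two orders, so the two
  inversion counts add up to \<open>card A * card B\<close>.\<close>

lemma shuffle_sign_flip:
  assumes "finite A" "finite B" "A \<inter> B = {}"
  shows "shuffle_sign A B * shuffle_sign B A = (-1) ^ (card A * card B)"
proof -
  have eq: "card {(a, b). a \<in> B \<and> b \<in> A \<and> b < a} = card {(a, b). a \<in> A \<and> b \<in> B \<and> a < b}"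
    by (rule bij_betw_same_card[of prod.swap]) (auto simp: bij_betw_def inj_on_def image_iff)
  have fin: "finite {(a, b). a \<in> A \<and> b \<in> B \<and> a < b}"
    by (rule finite_subset[of _ "A \<times> B"]) (use assms in auto)
  have "A \<times> B = {(a, b). a \<in> A \<and> b \<in> B \<and> b < a} \<union> {(a, b). a \<in> A \<and> b \<in> B \<and> a < b}"
    using assms(3) by (auto simp: not_less_iff_gr_or_eq)
  moreover have "{(a, b). a \<in> A \<and> b \<in> B \<and> b < a} \<inter> {(a, b). a \<in> A \<and> b \<in> B \<and> a < b} = {}"
    by auto
  ultimately have "card (A \<times> B) =
      card {(a, b). a \<in> A \<and> b \<in> B \<and> b < a} + card {(a, b). a \<in> A \<and> b \<in> B \<and> a < b}"
    using card_Un_disjoint[OF finite_inversions[OF assms(1)] fin] by simp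
  then show ?thesis
    by (simp add: shuffle_sign_def eq power_add [symmetric] card_cartesian_product)
qed

lemma shuffle_sign_square: "shuffle_sign A B * shuffle_sign A B = 1"
  by (simp add: shuffle_sign_def flip: power_add)

lemma shuffle_sign_square': "shuffle_sign A B * (shuffle_sign A B * x) = x"
  by (simp add: shuffle_sign_square flip: mult.assoc)

lemma shuffle_sign_mult_eqD: "shuffle_sign A B * x = y \<Longrightarrow> x = y * shuffle_sign A B"
  by (auto simp: shuffle_sign_square' mult.commute[of _ "shuffle_sign A B"])

lemma shuffle_sign_empty [simp]: "shuffle_sign {} A = 1" "shuffle_sign A {} = 1"
  by (simp_all add: shuffle_sign_def)

text \<open>Makes the sign of an odd derivation a shuffle sign, so that one sign calculus serves
  products and derivations.\<close>

lemma d_xi_sign: "(-1) ^ card {i \<in> A. i < j} = shuffle_sign {j} A"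
proof -
  have "card {i \<in> A. i < j} = card {(a, b). a \<in> {j} \<and> b \<in> A \<and> b < a}"
    by (rule bij_betw_same_card[of "Pair j"]) (auto simp: bij_betw_def inj_on_def)
  then show ?thesis by (simp add: shuffle_sign_def)
qed

lemma d_xi_apply: "d_xi j f A = (if j \<in> A then 0 else shuffle_sign {j} A * f (insert j A))"
  by (simp add: d_xi_def d_xi_sign)

text \<open>The sum over the infinite set \<open>Pow A\<close> defaults to 0. Hence the case
  distinctions on finiteness of A below.\<close>

lemma sfun_mult_infinite: "infinite A \<Longrightarrow> sfun_mult f g A = 0"
  by (simp add: sfun_mult_def)

text \<open>Both sides run over the partitions of A into three parts C, D, E. In either bracketing
  the sign is the product of the three pairwise shuffle signs.\<close>

lemma sfun_mult_assoc: "sfun_mult (sfun_mult f g) h = sfun_mult f (sfun_mult g h)"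
proof
  fix A
  show "sfun_mult (sfun_mult f g) h A = sfun_mult f (sfun_mult g h) A"
  proof (cases "finite A")
    case True
    have key: "shuffle_sign C (A - C) * f C * (shuffle_sign D (A - C - D) * g D * h (A - C - D)) =
        shuffle_sign B (A - B) * (shuffle_sign C D * f C * g D) * h (A - B)"
      if "B = C \<union> D" "C \<inter> D = {}" "B \<subseteq> A" for B C D
    proof -
      define E where "E = A - B"
      have fin: "finite C" "finite D" "finite E"
        using True that by (auto simp: E_def intro: finite_subset)
      have disj: "C \<inter> D = {}" "C \<inter> E = {}" "D \<inter> E = {}" using that by (auto simp: E_def)
      have eqs: "A - C = D \<union> E" "D \<union> E - D = E" "A - (C \<union> D) = E"
        using that by (auto simp: E_def)
      show ?thesis
        unfolding eqs that(1)
        by (simp only: shuffle_sign_Un_left shuffle_sign_Un_right fin disj mult_ac)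
    qed
    have "sfun_mult (sfun_mult f g) h A =
      (\<Sum>(B, C)\<in>Sigma (Pow A) Pow.
         shuffle_sign B (A - B) * (shuffle_sign C (B - C) * f C * g (B - C)) * h (A - B))"
      using True by (subst sum.Sigma [symmetric])
        (auto simp: sfun_mult_def sum_distrib_left sum_distrib_right intro: finite_subset)
    also have "\<dots> = (\<Sum>(C, D)\<in>Sigma (Pow A) (\<lambda>C. Pow (A - C)).
         shuffle_sign C (A - C) * f C * (shuffle_sign D (A - C - D) * g D * h (A - C - D)))"
      by (rule sum.reindex_bij_witness[of _ "\<lambda>(C, D). (C \<union> D, C)" "\<lambda>(B, C). (C, B - C)"])
        (auto intro!: key)
    also have "\<dots> = sfun_mult f (sfun_mult g h) A"
      using True by (subst sum.Sigma [symmetric])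
        (auto simp: sfun_mult_def sum_distrib_left sum_distrib_right intro: finite_subset)
    finally show ?thesis .
  qed (simp add: sfun_mult_infinite)
qed

definition sc :: "complex \<Rightarrow> sfun \<Rightarrow> sfun" where
  "sc c f = (\<lambda>A. fps_const c * f A)"

lemma sfun_mult_add_left: "sfun_mult (f + g) h = sfun_mult f h + sfun_mult g h"
  and sfun_mult_add_right: "sfun_mult h (f + g) = sfun_mult h f + sfun_mult h g"
  and sfun_mult_diff_left: "sfun_mult (f - g) h = sfun_mult f h - sfun_mult g h"
  and sfun_mult_diff_right: "sfun_mult h (f - g) = sfun_mult h f - sfun_mult h g"
  by (simp_all add: sfun_mult_def fun_eq_iff algebra_simps sum.distrib sum_subtractf)

lemma sfun_mult_sc_left: "sfun_mult (sc c f) g = sc c (sfun_mult f g)"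
  and sfun_mult_sc_right: "sfun_mult f (sc c g) = sc c (sfun_mult f g)"
  by (simp_all add: sfun_mult_def sc_def fun_eq_iff sum_distrib_left algebra_simps)

lemma sfun_mult_zero [simp]: "sfun_mult 0 f = 0" "sfun_mult f 0 = 0"
  by (simp_all add: sfun_mult_def fun_eq_iff)

lemma sfun_mult_sum_left: "sfun_mult (\<Sum>i\<in>I. f i) g = (\<Sum>i\<in>I. sfun_mult (f i) g)"
  using sum_comp_morphism[of "\<lambda>f. sfun_mult f g" f I] by (simp add: o_def sfun_mult_add_left)

lemma sfun_mult_sum_right: "sfun_mult g (\<Sum>i\<in>I. f i) = (\<Sum>i\<in>I. sfun_mult g (f i))"
  using sum_comp_morphism[of "sfun_mult g" f I] by (simp add: o_def sfun_mult_add_right)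

lemma sc_sc [simp]: "sc c (sc d f) = sc (c * d) f"
  by (simp add: sc_def fun_eq_iff flip: mult.assoc)

lemma sc_one [simp]: "sc 1 f = f" and sc_zero [simp]: "sc 0 f = 0" "sc c 0 = 0"
  by (simp_all add: sc_def fun_eq_iff)

lemma sc_minus_one: "sc (- 1) f = - f"
  by (simp add: sc_def fun_eq_iff flip: fps_const_neg)

lemma sc_add: "sc c (f + g) = sc c f + sc c g"
  and sc_diff: "sc c (f - g) = sc c f - sc c g"
  by (simp_all add: sc_def fun_eq_iff algebra_simps)

lemma sc_sum: "sc c (\<Sum>i\<in>I. f i) = (\<Sum>i\<in>I. sc c (f i))"
  using sum_comp_morphism[of "sc c" f I] by (simp add: o_def sc_add)

text \<open>Index 0 stands for x, so that sums over \<open>{..n}\<close> treat x and the \<xi>_j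
  alike and the difference is confined to the parity \<open>par\<close>.\<close>

definition pd :: "nat \<Rightarrow> sfun \<Rightarrow> sfun" where
  "pd i = (if i = 0 then d_x else d_xi i)"

definition par :: "nat \<Rightarrow> nat" where
  "par i = (if i = 0 then 0 else 1)"

text \<open>Only p modulo 2 matters; a natural number is convenient as an exponent of -1. On
  infinite sets \<open>card\<close> is 0 and carries no parity, so these are left
  unconstrained.\<close>

definition hom_fun :: "nat \<Rightarrow> sfun \<Rightarrow> bool" where
  "hom_fun p f \<longleftrightarrow> (\<forall>A. finite A \<longrightarrow> f A \<noteq> 0 \<longrightarrow> even (card A + p))"

lemma hom_funD: "hom_fun p f \<Longrightarrow> finite A \<Longrightarrow> f A \<noteq> 0 \<Longrightarrow> even (card A + p)"
  by (simp add: hom_fun_def)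

lemma pd_add: "pd i (f + g) = pd i f + pd i g"
  and pd_diff: "pd i (f - g) = pd i f - pd i g"
  and pd_sc: "pd i (sc c f) = sc c (pd i f)"
  by (auto simp: pd_def d_x_def d_xi_def sc_def fun_eq_iff algebra_simps)

lemma pd_zero [simp]: "pd i 0 = 0"
  by (auto simp: pd_def d_x_def d_xi_def fun_eq_iff)

lemma pd_sum: "pd i (\<Sum>k\<in>I. f k) = (\<Sum>k\<in>I. pd i (f k))"
  using sum_comp_morphism[of "pd i" f I] by (simp add: o_def pd_add)

text \<open>Reindexing by complements exchanges the factors. The shuffle signs then differ by (-1)
  to the power \<open>card B * card (A - B)\<close>, which homogeneity makes independent of
  B.\<close>

lemma sfun_mult_supercomm:
  assumes "hom_fun p f" "hom_fun q g"
  shows "sfun_mult f g = sc ((-1) ^ (p * q)) (sfun_mult g f)"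
proof
  fix A
  show "sfun_mult f g A = sc ((-1) ^ (p * q)) (sfun_mult g f) A"
  proof (cases "finite A")
    case True
    have "sfun_mult f g A = (\<Sum>B\<in>Pow A. shuffle_sign (A - B) B * f (A - B) * g B)"
      unfolding sfun_mult_def
      by (rule sum.reindex_bij_witness[of _ "\<lambda>B. A - B" "\<lambda>B. A - B"]) (auto simp: double_diff)
    also have "\<dots> = (\<Sum>B\<in>Pow A. (-1) ^ (p * q) * (shuffle_sign B (A - B) * g B * f (A - B)))"
    proof (rule sum.cong [OF refl])
      fix B assume B: "B \<in> Pow A"
      show "shuffle_sign (A - B) B * f (A - B) * g B =
        (-1) ^ (p * q) * (shuffle_sign B (A - B) * g B * f (A - B))"
      proof (cases "g B = 0 \<or> f (A - B) = 0")
        case False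
        then have ev: "even (card B + q)" "even (card (A - B) + p)"
          using hom_funD[OF assms(1), of "A - B"] hom_funD[OF assms(2), of B] B True False
          by (auto dest: finite_subset)
        have "shuffle_sign B (A - B) * shuffle_sign (A - B) B = (-1) ^ (card B * card (A - B))"
          using True B by (intro shuffle_sign_flip) (auto intro: finite_subset)
        also have "\<dots> = (-1) ^ (p * q)"
          using ev by (auto simp: minus_one_power_iff)
        finally have "shuffle_sign (A - B) B = (-1) ^ (p * q) * shuffle_sign B (A - B)"
          by (rule shuffle_sign_mult_eqD)
        then show ?thesis by (simp add: mult_ac)
      qed auto
    qed
    also have "\<dots> = sc ((-1) ^ (p * q)) (sfun_mult g f) A"
      by (cases "even (p * q)") (simp_all add: sc_def sfun_mult_def sum_distrib_left flip: fps_const_neg)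
    finally show ?thesis .
  qed (simp add: sfun_mult_infinite sc_def)
qed

lemma d_x_mult: "d_x (sfun_mult f g) = sfun_mult (d_x f) g + sfun_mult f (d_x g)"
proof -
  have 0: "fps_deriv (shuffle_sign A B) = 0" for A B
    by (cases "even (card {(a, b). a \<in> A \<and> b \<in> B \<and> b < a})") (simp_all add: shuffle_sign_def)
  show ?thesis
    by (simp add: fun_eq_iff d_x_def sfun_mult_def fps_deriv_sum 0 algebra_simps del: fps_deriv_eq_0_iff flip: sum.distrib)
qed

text \<open>Sort the summands by whether j lies in the first factor. If j is in A, the left side is
  0 and on the right the summands at B and \<open>insert j B\<close> cancel; otherwise the two
  halves of the left side are the two terms on the right.\<close>

lemma d_xi_mult:
  assumes "hom_fun p f"
  shows "d_xi j (sfun_mult f g) = sfun_mult (d_xi j f) g + sc ((-1) ^ p) (sfun_mult f (d_xi j g))"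
proof
  fix A
  show "d_xi j (sfun_mult f g) A =
    (sfun_mult (d_xi j f) g + sc ((-1) ^ p) (sfun_mult f (d_xi j g))) A"
  proof (cases "finite A")
    case fin: True
    show ?thesis
    proof (cases "j \<in> A")
      case True
      have ins: "Pow A = insert j ` Pow (A - {j}) \<union> Pow (A - {j})"
        using Pow_insert[of j "A - {j}"] True by (simp add: insert_absorb Un_commute)
      have inj: "inj_on (insert j) (Pow (A - {j}))" by (auto simp: inj_on_def)
      have split: "(\<Sum>B\<in>Pow A. F B) = (\<Sum>B\<in>Pow (A - {j}). F (insert j B)) + (\<Sum>B\<in>Pow (A - {j}). F B)"
        for F :: "nat set \<Rightarrow> complex fps"
        unfolding ins using fin by (subst sum.union_disjoint) (auto simp: sum.reindex[OF inj])
      have "sfun_mult (d_xi j f) g A =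
        (\<Sum>B\<in>Pow (A - {j}). shuffle_sign B (A - B) * (shuffle_sign {j} B * f (insert j B)) * g (A - B))"
        unfolding sfun_mult_def split
        by (rule trans[OF arg_cong2[of _ _ _ _ "(+)", OF sum.neutral sum.cong[OF refl]] add_0_left])
          (auto simp: d_xi_apply)
      moreover have "sfun_mult f (d_xi j g) A =
        (\<Sum>B\<in>Pow (A - {j}). shuffle_sign (insert j B) (A - insert j B) * f (insert j B)
           * (shuffle_sign {j} (A - insert j B) * g (A - B)))"
      proof -
        have 1: "insert j (A - insert j B) = A - B" "j \<in> A - B" if "B \<in> Pow (A - {j})" for B
          using True that by auto
        have 2: "d_xi j g (A - B) = 0" "d_xi j g (A - insert j B) = shuffle_sign {j} (A - insert j B) * g (A - B)"
          if "B \<in> Pow (A - {j})" for B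
          using 1[OF that] by (simp_all add: d_xi_apply)
        show ?thesis
          unfolding sfun_mult_def split
          by (rule trans[OF arg_cong2[of _ _ _ _ "(+)", OF sum.cong[OF refl] sum.neutral] add_0_right])
            (use 2 in auto)
      qed
      moreover have "shuffle_sign B (A - B) * (shuffle_sign {j} B * f (insert j B)) * g (A - B) +
         fps_const ((-1) ^ p) * (shuffle_sign (insert j B) (A - insert j B) * f (insert j B)
           * (shuffle_sign {j} (A - insert j B) * g (A - B))) = 0" if B: "B \<subseteq> A - {j}" for B
      proof (cases "f (insert j B) = 0")
        case False
        define E where "E = A - insert j B"
        have "A - B = {j} \<union> E" using B True unfolding E_def by blast
        then have e: "A - B = {j} \<union> E" "insert j B = {j} \<union> B" "A - insert j B = E"
          by (simp_all add: E_def)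
        have f1: "finite B" "finite E" using fin B by (auto simp: E_def intro: finite_subset)
        have d: "{j} \<inter> E = {}" "{j} \<inter> B = {}" "j \<notin> B" using B by (auto simp: E_def)
        have "shuffle_sign {j} B * shuffle_sign B {j} = (-1) ^ card B"
          using shuffle_sign_flip[of "{j}" B] f1 d by simp
        from arg_cong[OF this, of "\<lambda>s. s * x" for x]
        have s1: "shuffle_sign B {j} * (shuffle_sign {j} B * x) = (-1) ^ card B * x" for x
          by (simp only: mult_ac)
        have pc: "even (card B) \<longleftrightarrow> odd p"
          using hom_funD[OF assms, of "insert j B"] False f1 d by simp
        have "shuffle_sign B (A - B) * (shuffle_sign {j} B * f (insert j B)) * g (A - B) +
         fps_const ((-1) ^ p) * (shuffle_sign (insert j B) (A - insert j B) * f (insert j B)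
           * (shuffle_sign {j} (A - insert j B) * g (A - B)))
          = shuffle_sign B {j} * (shuffle_sign {j} B * (shuffle_sign B E * f (insert j B) * g (A - B))) +
         fps_const ((-1) ^ p) * (shuffle_sign {j} E * (shuffle_sign {j} E * 
            (shuffle_sign B E * f (insert j B) * g (A - B))))"
          unfolding e(3) by (simp only: e(1,2) shuffle_sign_Un_left shuffle_sign_Un_right f1 d finite.intros mult_ac)
        also have "\<dots> = 0"
          unfolding s1 shuffle_sign_square' using pc by (cases "even p") (auto simp flip: fps_const_neg)
        finally show ?thesis .
      qed auto
      ultimately have "sfun_mult (d_xi j f) g A + fps_const ((-1) ^ p) * sfun_mult f (d_xi j g) A = 0"
        by (simp only: sum_distrib_left sum.distrib [symmetric]) (intro sum.neutral ballI; simp)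
      then show ?thesis using True by (simp add: sc_def d_xi_apply)
    next
      case False
      have inj: "inj_on (insert j) (Pow A)" using False by (auto simp: inj_on_def)
      have split: "(\<Sum>B\<in>Pow (insert j A). F B) = (\<Sum>B\<in>Pow A. F (insert j B)) + (\<Sum>B\<in>Pow A. F B)"
        for F :: "nat set \<Rightarrow> complex fps"
        unfolding Pow_insert using fin False
        by (subst sum.union_disjoint) (auto simp: sum.reindex[OF inj])
      have fA: "shuffle_sign {j} A * (shuffle_sign (insert j B) (insert j A - insert j B)
          * f (insert j B) * g (insert j A - insert j B))
          = shuffle_sign B (A - B) * d_xi j f B * g (A - B)" if B: "B \<subseteq> A" for B
      proof -
        define E where "E = A - B"
        have e: "A = B \<union> E" "insert j A - insert j B = E" "insert j B = {j} \<union> B" "A - B = E"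
          using B False unfolding E_def by blast+
        have f1: "finite B" "finite E" using fin B by (auto simp: E_def intro: finite_subset)
        have d: "{j} \<inter> B = {}" "B \<inter> E = {}" "j \<notin> B" using B False by (auto simp: E_def)
        have sA: "shuffle_sign {j} A = shuffle_sign {j} B * shuffle_sign {j} E"
          unfolding e(1) using d f1 by (intro shuffle_sign_Un_right) auto
        have sB: "shuffle_sign (insert j B) E = shuffle_sign {j} E * shuffle_sign B E"
          unfolding e(3) using d f1 by (intro shuffle_sign_Un_left) auto
        have "shuffle_sign {j} A * (shuffle_sign (insert j B) (insert j A - insert j B)
          * f (insert j B) * g (insert j A - insert j B)) =
          shuffle_sign {j} E * (shuffle_sign {j} E * (shuffle_sign {j} B * shuffle_sign B E
          * f (insert j B) * g E))"
          unfolding e(2) sA sB by (simp only: mult_ac)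
        also have "\<dots> = shuffle_sign {j} B * shuffle_sign B E * f (insert j B) * g E"
          by (rule shuffle_sign_square')
        also have "shuffle_sign {j} B * shuffle_sign B E * f (insert j B) * g E =
          shuffle_sign B (A - B) * d_xi j f B * g (A - B)"
          using d by (simp add: d_xi_apply e(4))
        finally show ?thesis .
      qed
      have gA: "shuffle_sign {j} A * (shuffle_sign B (insert j A - B) * f B * g (insert j A - B))
          = fps_const ((-1) ^ p) * (shuffle_sign B (A - B) * f B * d_xi j g (A - B))" if B: "B \<subseteq> A" for B
      proof (cases "f B = 0")
        case f0: False
        define E where "E = A - B"
        have e: "A = B \<union> E" "insert j A - B = {j} \<union> E" "A - B = E"
          using B False by (auto simp: E_def)
        have f1: "finite B" "finite E" using fin B by (auto simp: E_def intro: finite_subset)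
        have d: "{j} \<inter> B = {}" "B \<inter> E = {}" "j \<notin> E" "{j} \<inter> E = {}" using B False by (auto simp: E_def)
        have "shuffle_sign {j} B * shuffle_sign B {j} = (-1) ^ card B"
          using shuffle_sign_flip[of "{j}" B] f1 d by simp
        from arg_cong[OF this, of "\<lambda>s. s * x" for x]
        have s1: "shuffle_sign B {j} * (shuffle_sign {j} B * x) = (-1) ^ card B * x" for x
          by (simp only: mult_ac)
        have pc: "even (card B) \<longleftrightarrow> even p"
          using hom_funD[OF assms f1(1) f0] by simp
        have sA: "shuffle_sign {j} A = shuffle_sign {j} B * shuffle_sign {j} E"
          unfolding e(1) using d f1 by (intro shuffle_sign_Un_right) auto
        have sB: "shuffle_sign B ({j} \<union> E) = shuffle_sign B {j} * shuffle_sign B E"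
          using d f1 by (intro shuffle_sign_Un_right) auto
        have "shuffle_sign {j} A * (shuffle_sign B (insert j A - B) * f B * g (insert j A - B)) =
          shuffle_sign B {j} * (shuffle_sign {j} B * (shuffle_sign {j} E * shuffle_sign B E * f B * g ({j} \<union> E)))"
          unfolding e(2) sA sB by (simp only: mult_ac)
        also have "\<dots> = fps_const ((-1) ^ p) * (shuffle_sign B E * f B * d_xi j g E)"
        proof -
          have 1: "d_xi j g E = shuffle_sign {j} E * g ({j} \<union> E)" using d by (simp add: d_xi_apply)
          have 2: "(-1) ^ card B = fps_const ((-1 :: complex) ^ p)"
            using pc by (cases "even p") (auto simp flip: fps_const_neg)
          show ?thesis unfolding s1 1 2 by (simp only: mult_ac)
        qed
        finally show ?thesis by (simp add: e(3))
      qed auto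
      have "d_xi j (sfun_mult f g) A = shuffle_sign {j} A * sfun_mult f g (insert j A)"
        using False by (simp add: d_xi_apply)
      also have "\<dots> = (\<Sum>B\<in>Pow A. shuffle_sign {j} A * (shuffle_sign (insert j B) (insert j A - insert j B)
          * f (insert j B) * g (insert j A - insert j B))) +
          (\<Sum>B\<in>Pow A. shuffle_sign {j} A * (shuffle_sign B (insert j A - B) * f B * g (insert j A - B)))"
        unfolding sfun_mult_def split by (simp only: distrib_left sum_distrib_left)
      also have "\<dots> = (\<Sum>B\<in>Pow A. shuffle_sign B (A - B) * d_xi j f B * g (A - B)) +
        (\<Sum>B\<in>Pow A. fps_const ((-1) ^ p) * (shuffle_sign B (A - B) * f B * d_xi j g (A - B)))"
        by (intro arg_cong2[of _ _ _ _ "(+)"] sum.cong refl; erule PowD [THEN fA] PowD [THEN gA])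
      finally show ?thesis
        by (simp add: sc_def sfun_mult_def sum_distrib_left)
    qed
  next
    case False
    then show ?thesis by (simp add: d_xi_apply sc_def sfun_mult_infinite)
  qed
qed

lemma pd_mult:
  assumes "hom_fun p f"
  shows "pd i (sfun_mult f g) = sfun_mult (pd i f) g + sc ((-1) ^ (par i * p)) (sfun_mult f (pd i g))"
  using d_xi_mult[OF assms] by (auto simp: pd_def par_def d_x_mult)

lemma d_xi_anticommute: "d_xi i (d_xi j f) = - d_xi j (d_xi i f)"
proof
  fix A
  show "d_xi i (d_xi j f) A = (- d_xi j (d_xi i f)) A"
  proof (cases "i \<in> A \<or> j \<in> A \<or> i = j")
    case False
    have s: "shuffle_sign {j} (insert i A) = shuffle_sign {j} {i} * shuffle_sign {j} A"
      "shuffle_sign {i} (insert j A) = shuffle_sign {i} {j} * shuffle_sign {i} A"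
      using shuffle_sign_Un_right[of "{j}" "{i}" A] shuffle_sign_Un_right[of "{i}" "{j}" A] False by auto
    have "shuffle_sign {j} {i} * shuffle_sign {i} {j} = - 1"
      using shuffle_sign_flip[of "{j}" "{i}"] False by simp
    then have "shuffle_sign {j} {i} = - shuffle_sign {i} {j}"
      using shuffle_sign_mult_eqD[of "{i}" "{j}" "shuffle_sign {j} {i}" "-1"] by (simp add: mult.commute)
    then show ?thesis using False by (auto simp: d_xi_apply s insert_commute)
  qed (auto simp: d_xi_apply)
qed

lemma pd_commute: "pd i (pd j f) = sc ((-1) ^ (par i * par j)) (pd j (pd i f))"
proof -
  have "d_xi j (d_x f) = d_x (d_xi j f)" for j
    by (auto simp: fun_eq_iff d_xi_apply d_x_def shuffle_sign_def minus_one_power_iff)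
  then show ?thesis
    by (auto simp: pd_def par_def sc_minus_one d_xi_anticommute[of i j])
qed

lemma hom_fun_pd:
  assumes "hom_fun p f"
  shows "hom_fun (p + par i) (pd i f)"
  unfolding hom_fun_def
proof safe
  fix A assume A: "finite A" "pd i f A \<noteq> 0"
  show "even (card A + (p + par i))"
  proof (cases "i = 0")
    case True
    then have "f A \<noteq> 0" using A by (auto simp: pd_def d_x_def simp del: fps_deriv_eq_0_iff)
    then show ?thesis using hom_funD[OF assms A(1)] True by (simp add: par_def)
  next
    case False
    then have "i \<notin> A" "f (insert i A) \<noteq> 0" using A by (auto simp: pd_def d_xi_apply split: if_splits)
    then have "even (card (insert i A) + p)" using hom_funD[OF assms, of "insert i A"] A by simp
    then show ?thesis using \<open>i \<notin> A\<close> A False by (simp add: par_def)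
  qed
qed

section \<open>The supercommutator of first order operators and its Jacobi identities\<close>

section \<open>The bracket\<close>

lemma sign_cong: "even (a + b) \<Longrightarrow> (-1 :: complex) ^ a = (-1) ^ b"
  by (auto simp: minus_one_power_iff)

lemma atMost_eq_insert_0: "{..n} = insert 0 {1..n::nat}"
  by auto

lemma vf_act_eq_sum: "vf_act n X f = (\<Sum>i\<le>n. sfun_mult (X i) (pd i f))"
proof -
  have "(\<Sum>j=1..n. sfun_mult (X j) (pd j f)) = (\<Sum>j=1..n. sfun_mult (X j) (d_xi j f))"
    by (intro sum.cong) (auto simp: pd_def)
  then show ?thesis
    by (simp add: vf_act_def atMost_eq_insert_0) (simp add: pd_def)
qed

lemma vf_div_eq_sum: "vf_div n X = (\<Sum>i\<le>n. pd i (if i = 0 then X i else sfun_invol (X i)))"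
proof -
  have "(\<Sum>j=1..n. pd j (if j = 0 then X j else sfun_invol (X j))) = (\<Sum>j=1..n. d_xi j (sfun_invol (X j)))"
    by (intro sum.cong) (auto simp: pd_def)
  then show ?thesis
    by (simp add: vf_div_def atMost_eq_insert_0) (simp add: pd_def)
qed

lemma vf_scale_eq_sc: "vf_scale c X i = sc c (X i)"
  by (simp add: vf_scale_def sc_def)

lemma vf_act_add_left: "vf_act n (X + Y) f = vf_act n X f + vf_act n Y f"
  and vf_act_diff_left: "vf_act n (X - Y) f = vf_act n X f - vf_act n Y f"
  and vf_act_scale_left: "vf_act n (vf_scale c X) f = sc c (vf_act n X f)"
  and vf_act_add_right: "vf_act n X (f + g) = vf_act n X f + vf_act n X g"
  and vf_act_diff_right: "vf_act n X (f - g) = vf_act n X f - vf_act n X g"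
  and vf_act_sc_right: "vf_act n X (sc c f) = sc c (vf_act n X f)"
  by (simp_all add: vf_act_eq_sum sfun_mult_add_left sfun_mult_diff_left sfun_mult_sc_left
      sfun_mult_add_right sfun_mult_diff_right sfun_mult_sc_right pd_add pd_diff pd_sc
      vf_scale_eq_sc sum.distrib sum_subtractf sc_sum)

lemma vf_act_zero [simp]: "vf_act n 0 f = 0" "vf_act n X 0 = 0"
  by (simp_all add: vf_act_eq_sum)

lemma vf_act_minus: "vf_act n X (- f) = - vf_act n X f" "vf_act n (- X) f = - vf_act n X f"
  using vf_act_diff_right[of n X 0 f] vf_act_diff_left[of n 0 X f] by simp_all

lemmas vf_act_linear = vf_act_add_left vf_act_diff_left vf_act_scale_left
  vf_act_add_right vf_act_diff_right vf_act_sc_right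

lemma sum_apply: "(\<Sum>i\<in>I. f i) A = (\<Sum>i\<in>I. f i A)" for f :: "'i \<Rightarrow> 'a \<Rightarrow> 'b::comm_monoid_add"
  using sum_comp_morphism[of "\<lambda>f. f A" f I] by (simp add: o_def)

lemma vf_act_infinite: "infinite A \<Longrightarrow> vf_act n X f A = 0"
  by (simp add: vf_act_eq_sum sum_apply sfun_mult_infinite)

definition vhom :: "nat \<Rightarrow> vfield \<Rightarrow> bool" where
  "vhom p X \<longleftrightarrow> (\<forall>i. hom_fun (p + par i) (X i))"

lemma vhomD: "vhom p X \<Longrightarrow> hom_fun (p + par i) (X i)"
  by (simp add: vhom_def)

text \<open>Splits X Y into a first order and a second order part. The latter is supersymmetric in X
  and Y by \<open>second_order_symmetric\<close>, so it drops out of the supercommutator.\<close>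

lemma vf_act_compose:
  assumes "vhom q Y"
  shows "vf_act n X (vf_act n Y f) = vf_act n (\<lambda>j. vf_act n X (Y j)) f +
    (\<Sum>i\<le>n. \<Sum>j\<le>n. sc ((-1) ^ (par i * (q + par j)))
        (sfun_mult (sfun_mult (X i) (Y j)) (pd i (pd j f))))"
proof -
  have "vf_act n X (vf_act n Y f) =
    (\<Sum>i\<le>n. \<Sum>j\<le>n. sfun_mult (sfun_mult (X i) (pd i (Y j))) (pd j f)) +
    (\<Sum>i\<le>n. \<Sum>j\<le>n. sc ((-1) ^ (par i * (q + par j)))
        (sfun_mult (sfun_mult (X i) (Y j)) (pd i (pd j f))))"
    by (simp add: vf_act_eq_sum pd_sum pd_mult[OF vhomD[OF assms]] sfun_mult_sum_right
        sfun_mult_add_right sfun_mult_sc_right sfun_mult_assoc sum.distrib)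
  also have "(\<Sum>i\<le>n. \<Sum>j\<le>n. sfun_mult (sfun_mult (X i) (pd i (Y j))) (pd j f)) =
    vf_act n (\<lambda>j. vf_act n X (Y j)) f"
    by (subst sum.swap) (simp add: vf_act_eq_sum sfun_mult_sum_left)
  finally show ?thesis .
qed

lemma second_order_symmetric:
  assumes "vhom p X" "vhom q Y"
  shows "(\<Sum>i\<le>n. \<Sum>j\<le>n. sc ((-1) ^ (par i * (q + par j)))
        (sfun_mult (sfun_mult (X i) (Y j)) (pd i (pd j f)))) =
    sc ((-1) ^ (p * q)) (\<Sum>i\<le>n. \<Sum>j\<le>n. sc ((-1) ^ (par i * (p + par j)))
        (sfun_mult (sfun_mult (Y i) (X j)) (pd i (pd j f))))"
proof -
  have "sc ((-1) ^ (par i * (q + par j))) (sfun_mult (sfun_mult (X i) (Y j)) (pd i (pd j f))) =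
    sc ((-1) ^ (p * q)) (sc ((-1) ^ (par j * (p + par i)))
      (sfun_mult (sfun_mult (Y j) (X i)) (pd j (pd i f))))" for i j
  proof -
    have "(-1 :: complex) ^ (par i * (q + par j)) * ((-1) ^ ((p + par i) * (q + par j)) * (-1) ^ (par i * par j)) =
      (-1) ^ (p * q) * (-1) ^ (par j * (p + par i))"
      unfolding power_add [symmetric] by (rule sign_cong) (auto simp: par_def)
    then show ?thesis
      by (subst sfun_mult_supercomm[OF vhomD[OF assms(1)] vhomD[OF assms(2)]], subst pd_commute)
        (simp only: sfun_mult_sc_left sfun_mult_sc_right sc_sc mult_ac)
  qed
  then show ?thesis
    by (subst (2) sum.swap) (simp add: sc_sum)
qed

lemma vf_act_hom_bracket:
  assumes "vhom p X" "vhom q Y"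
  shows "vf_act n (\<lambda>j. vf_act n X (Y j) - sc ((-1) ^ (p * q)) (vf_act n Y (X j))) f =
    vf_act n X (vf_act n Y f) - sc ((-1) ^ (p * q)) (vf_act n Y (vf_act n X f))"
proof -
  have "vf_act n (\<lambda>j. vf_act n X (Y j) - sc ((-1) ^ (p * q)) (vf_act n Y (X j))) f =
    vf_act n ((\<lambda>j. vf_act n X (Y j)) - vf_scale ((-1) ^ (p * q)) (\<lambda>j. vf_act n Y (X j))) f"
    by (rule arg_cong[of _ _ "\<lambda>X. vf_act n X f"]) (simp add: fun_eq_iff vf_scale_eq_sc)
  then show ?thesis
    using vf_act_compose[OF assms(2), where n = n and X = X and f = f]
      vf_act_compose[OF assms(1), where n = n and X = Y and f = f]
      second_order_symmetric[OF assms, where n = n and f = f]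
    by (simp add: vf_act_linear sc_add sc_diff algebra_simps)
qed

lemma vf_even_add: "vf_even (X + Y) = vf_even X + vf_even Y"
  and vf_even_diff: "vf_even (X - Y) = vf_even X - vf_even Y"
  and vf_even_scale: "vf_even (vf_scale c X) = vf_scale c (vf_even X)"
  and vf_even_zero [simp]: "vf_even 0 = 0"
  and vf_even_even [simp]: "vf_even (vf_even X) = vf_even X"
  by (auto simp: vf_even_def vf_scale_def fun_eq_iff)

lemma vf_odd_add: "vf_odd (X + Y) = vf_odd X + vf_odd Y"
  and vf_odd_diff: "vf_odd (X - Y) = vf_odd X - vf_odd Y"
  and vf_odd_scale: "vf_odd (vf_scale c X) = vf_scale c (vf_odd X)"
  and vf_odd_zero [simp]: "vf_odd 0 = 0"
  and vf_odd_odd [simp]: "vf_odd (vf_odd X) = vf_odd X"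
  and vf_odd_even [simp]: "vf_odd (vf_even X) = 0"
  and vf_even_odd [simp]: "vf_even (vf_odd X) = 0"
  by (simp_all add: vf_odd_def vf_even_add vf_even_diff vf_even_scale vf.scale_right_diff_distrib)

lemma even_plus_odd: "vf_even X + vf_odd X = X"
  by (simp add: vf_odd_def)

lemma vhom_even: "vhom 0 (vf_even X)" and vhom_odd: "vhom 1 (vf_odd X)"
  by (auto simp: vhom_def hom_fun_def vf_even_def vf_odd_def par_def)

lemma vf_bracket_apply: "vf_bracket n X Y i =
    vf_act n X (Y i) - vf_act n Y (X i) + sc 2 (vf_act n (vf_odd Y) (vf_odd X i))"
  by (simp add: vf_bracket_def sc_def fun_eq_iff numeral_fps_const)

lemma vf_bracket_add_left: "vf_bracket n (X + X') Y = vf_bracket n X Y + vf_bracket n X' Y"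
  and vf_bracket_diff_left: "vf_bracket n (X - X') Y = vf_bracket n X Y - vf_bracket n X' Y"
  and vf_bracket_scale_left: "vf_bracket n (vf_scale c X) Y = vf_scale c (vf_bracket n X Y)"
  and vf_bracket_add_right: "vf_bracket n X (Y + Y') = vf_bracket n X Y + vf_bracket n X Y'"
  and vf_bracket_diff_right: "vf_bracket n X (Y - Y') = vf_bracket n X Y - vf_bracket n X Y'"
  and vf_bracket_scale_right: "vf_bracket n X (vf_scale c Y) = vf_scale c (vf_bracket n X Y)"
  by (rule ext, simp add: vf_bracket_apply vf_act_linear vf_odd_add vf_odd_diff vf_odd_scale sc_add sc_diff
      vf_scale_eq_sc mult.commute algebra_simps)+

lemma vf_bracket_zero [simp]: "vf_bracket n 0 Y = 0" "vf_bracket n X 0 = 0"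
  by (simp_all add: vf_bracket_apply fun_eq_iff)

lemmas vf_bracket_linear = vf_bracket_add_left vf_bracket_diff_left vf_bracket_scale_left
  vf_bracket_add_right vf_bracket_diff_right vf_bracket_scale_right

lemma vf_bracket_even_left: "vf_bracket n (vf_even X) Y i = vf_act n (vf_even X) (Y i) - vf_act n Y (vf_even X i)"
  by (simp add: vf_bracket_apply)

lemma vf_bracket_even_right: "vf_bracket n X (vf_even Y) i = vf_act n X (vf_even Y i) - vf_act n (vf_even Y) (X i)"
  by (simp add: vf_bracket_apply)

lemma sc_two: "sc 2 f = f + f"
  by (simp add: sc_def fun_eq_iff numeral_fps_const [symmetric])

lemma vf_bracket_odd: "vf_bracket n (vf_odd X) (vf_odd Y) i =
    vf_act n (vf_odd X) (vf_odd Y i) + vf_act n (vf_odd Y) (vf_odd X i)"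
proof -
  show ?thesis by (simp add: vf_bracket_apply sc_two)
qed

text \<open>The bracket is defined by its coefficients, that is, by its values on the coordinates;
  this extends the commutator formula to all functions. Splitting into parities reduces it to four
  homogeneous cases. The Jacobi identities rest on it.\<close>

lemma vf_act_bracket: "vf_act n (vf_bracket n X Y) f =
    vf_act n X (vf_act n Y f) - vf_act n Y (vf_act n X f) + sc 2 (vf_act n (vf_odd Y) (vf_act n (vf_odd X) f))"
proof -
  define X0 X1 Y0 Y1 where d: "X0 = vf_even X" "X1 = vf_odd X" "Y0 = vf_even Y" "Y1 = vf_odd Y"
  have h: "vhom 0 X0" "vhom 1 X1" "vhom 0 Y0" "vhom 1 Y1"
    by (simp_all only: d vhom_even vhom_odd)
  have s: "X = X0 + X1" "Y = Y0 + Y1" by (simp_all add: d even_plus_odd)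
  have e: "vf_bracket n X0 Y0 = (\<lambda>i. vf_act n X0 (Y0 i) - sc ((-1) ^ (0 * 0)) (vf_act n Y0 (X0 i)))"
    "vf_bracket n X0 Y1 = (\<lambda>i. vf_act n X0 (Y1 i) - sc ((-1) ^ (0 * 1)) (vf_act n Y1 (X0 i)))"
    "vf_bracket n X1 Y0 = (\<lambda>i. vf_act n X1 (Y0 i) - sc ((-1) ^ (1 * 0)) (vf_act n Y0 (X1 i)))"
    "vf_bracket n X1 Y1 = (\<lambda>i. vf_act n X1 (Y1 i) - sc ((-1) ^ (1 * 1)) (vf_act n Y1 (X1 i)))"
    by (simp_all only: d) (rule ext, simp add: vf_bracket_even_left vf_bracket_even_right vf_bracket_odd sc_minus_one)+
  have "vf_act n (vf_bracket n X Y) f = vf_act n (vf_bracket n X0 Y0) f + vf_act n (vf_bracket n X0 Y1) f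
     + vf_act n (vf_bracket n X1 Y0) f + vf_act n (vf_bracket n X1 Y1) f"
    by (simp add: s vf_bracket_linear vf_act_linear algebra_simps)
  also have "\<dots> = vf_act n X (vf_act n Y f) - vf_act n Y (vf_act n X f) + sc 2 (vf_act n Y1 (vf_act n X1 f))"
    unfolding e vf_act_hom_bracket[OF h(1) h(3)] vf_act_hom_bracket[OF h(1) h(4)]
      vf_act_hom_bracket[OF h(2) h(3)] vf_act_hom_bracket[OF h(2) h(4)]
    by (simp add: s vf_act_linear sc_minus_one sc_two algebra_simps)
  finally show ?thesis by (simp add: d)
qed

subsection \<open>Parity of the bracket\<close>

lemma hom_fun_cong: "even (p + q) \<Longrightarrow> hom_fun p f \<Longrightarrow> hom_fun q f"
  unfolding hom_fun_def by (metis even_add)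

lemma hom_fun_add: "hom_fun p f \<Longrightarrow> hom_fun p g \<Longrightarrow> hom_fun p (f + g)"
  unfolding hom_fun_def by (metis add_0 plus_fun_apply)

lemma hom_fun_diff: "hom_fun p f \<Longrightarrow> hom_fun p g \<Longrightarrow> hom_fun p (f - g)"
  unfolding hom_fun_def by (metis diff_0_right diff_self minus_apply)

lemma hom_fun_sc: "hom_fun p f \<Longrightarrow> hom_fun p (sc c f)"
  unfolding hom_fun_def sc_def by (metis mult_zero_right)

lemma hom_fun_zero [simp]: "hom_fun p 0"
  by (simp add: hom_fun_def)

lemma hom_fun_sum: "(\<And>i. i \<in> I \<Longrightarrow> hom_fun p (f i)) \<Longrightarrow> hom_fun p (\<Sum>i\<in>I. f i)"
  unfolding hom_fun_def sum_apply by (meson sum.not_neutral_contains_not_neutral)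

lemma hom_fun_mult:
  assumes "hom_fun p f" "hom_fun q g"
  shows "hom_fun (p + q) (sfun_mult f g)"
  unfolding hom_fun_def
proof safe
  fix A :: "nat set" assume A: "finite A" "sfun_mult f g A \<noteq> 0"
  then obtain B where B: "B \<subseteq> A" "f B \<noteq> 0" "g (A - B) \<noteq> 0"
    unfolding sfun_mult_def by (metis (no_types, lifting) PowD mult_zero_left mult_zero_right
        sum.not_neutral_contains_not_neutral)
  have fB: "finite B" using A B finite_subset by blast
  have "even (card B + p)" by (rule hom_funD[OF assms(1) fB B(2)])
  moreover have "even (card (A - B) + q)" by (rule hom_funD[OF assms(2) _ B(3)]) (use A in simp)
  moreover have "card A = card B + card (A - B)"
    using card_Un_disjoint[OF fB, of "A - B"] A B by (simp add: Un_absorb1)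
  ultimately show "even (card A + (p + q))" by auto
qed

lemma hom_fun_act:
  assumes "vhom p X" "hom_fun q f"
  shows "hom_fun (p + q) (vf_act n X f)"
  unfolding vf_act_eq_sum
proof (rule hom_fun_sum)
  fix i
  have "hom_fun (p + par i + (q + par i)) (sfun_mult (X i) (pd i f))"
    by (intro hom_fun_mult vhomD assms hom_fun_pd)
  then show "hom_fun (p + q) (sfun_mult (X i) (pd i f))"
    by (rule hom_fun_cong [rotated]) auto
qed

text \<open>Homogeneity in the sense of \<open>vhom\<close> ignores coefficients at infinite sets,
  so it determines the parity components only of fields without such coefficients.\<close>

definition vfin :: "vfield \<Rightarrow> bool" where
  "vfin X \<longleftrightarrow> (\<forall>i A. infinite A \<longrightarrow> X i A = 0)"

lemma vfin_bracket [simp]: "vfin (vf_bracket n X Y)"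
  by (simp add: vfin_def vf_bracket_apply vf_act_infinite sc_def)

lemma vhom_vfin:
  assumes "vhom p X" "vfin X"
  shows "vf_even X = (if even p then X else 0)" "vf_odd X = (if even p then 0 else X)"
proof -
  have "X i A = 0" if "odd (card A + (p + par i))" for i A
    using assms that by (cases "finite A") (auto simp: vhom_def hom_fun_def vfin_def)
  then show "vf_even X = (if even p then X else 0)"
    by (auto simp: vf_even_def fun_eq_iff par_def split: if_splits)
  then show "vf_odd X = (if even p then 0 else X)"
    by (simp add: vf_odd_def)
qed

lemma vhom_bracket:
  "vhom 0 (vf_bracket n (vf_even X) (vf_even Y))" "vhom 1 (vf_bracket n (vf_even X) (vf_odd Y))"
  "vhom 1 (vf_bracket n (vf_odd X) (vf_even Y))" "vhom 0 (vf_bracket n (vf_odd X) (vf_odd Y))"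
proof -
  have *: "hom_fun (r + par i) (vf_act n X (Y i))" if "vhom p X" "vhom q Y" "even (p + q + r)" for p q r X Y i
    by (rule hom_fun_cong[OF _ hom_fun_act[OF that(1) vhomD[OF that(2)]]]) (use that(3) in presburger)
  show "vhom 0 (vf_bracket n (vf_even X) (vf_even Y))"
    unfolding vhom_def vf_bracket_even_left
    by (intro allI hom_fun_diff *[OF vhom_even vhom_even]) auto
  show "vhom 1 (vf_bracket n (vf_even X) (vf_odd Y))"
    unfolding vhom_def vf_bracket_even_left
    by (intro allI hom_fun_diff *[OF vhom_even vhom_odd] *[OF vhom_odd vhom_even]) auto
  show "vhom 1 (vf_bracket n (vf_odd X) (vf_even Y))"
    unfolding vhom_def vf_bracket_even_right
    by (intro allI hom_fun_diff *[OF vhom_even vhom_odd] *[OF vhom_odd vhom_even]) auto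
  show "vhom 0 (vf_bracket n (vf_odd X) (vf_odd Y))"
    unfolding vhom_def vf_bracket_odd
    by (intro allI hom_fun_add *[OF vhom_odd vhom_odd]) auto
qed

lemma vf_even_bracket: "vf_even (vf_bracket n X Y) =
    vf_bracket n (vf_even X) (vf_even Y) + vf_bracket n (vf_odd X) (vf_odd Y)"
  and vf_odd_bracket: "vf_odd (vf_bracket n X Y) =
    vf_bracket n (vf_even X) (vf_odd Y) + vf_bracket n (vf_odd X) (vf_even Y)"
proof -
  have "vf_bracket n X Y = vf_bracket n (vf_even X) (vf_even Y) + vf_bracket n (vf_even X) (vf_odd Y)
    + vf_bracket n (vf_odd X) (vf_even Y) + vf_bracket n (vf_odd X) (vf_odd Y)"
    by (subst even_plus_odd[of X, symmetric], subst even_plus_odd[of Y, symmetric])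
      (simp only: vf_bracket_linear ac_simps)
  then show "vf_even (vf_bracket n X Y) =
    vf_bracket n (vf_even X) (vf_even Y) + vf_bracket n (vf_odd X) (vf_odd Y)"
    "vf_odd (vf_bracket n X Y) =
    vf_bracket n (vf_even X) (vf_odd Y) + vf_bracket n (vf_odd X) (vf_even Y)"
    by (simp_all add: vf_even_add vf_odd_add vhom_vfin[OF vhom_bracket(1)] vhom_vfin[OF vhom_bracket(2)]
      vhom_vfin[OF vhom_bracket(3)] vhom_vfin[OF vhom_bracket(4)])
qed

lemma times_two_linear:
  fixes X :: vfield and f :: sfun
  shows "vf_act n X (2 * f) = 2 * vf_act n X f" "vf_act n X (f * 2) = 2 * vf_act n X f"
    "vf_act n (2 * X) f = 2 * vf_act n X f" "vf_act n (X * 2) f = 2 * vf_act n X f"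
    "vf_odd (2 * X) = 2 * vf_odd X" "vf_odd (X * 2) = 2 * vf_odd X"
  by (simp_all only: mult_2 mult_2_right vf_act_linear vf_odd_add)

text \<open>For even X no sign depends on Y or Z, so neither has to be homogeneous.\<close>

lemma jacobi_even:
  assumes "vf_odd X = 0"
  shows "vf_bracket n X (vf_bracket n Y Z) =
    vf_bracket n (vf_bracket n X Y) Z + vf_bracket n Y (vf_bracket n X Z)"
proof
  fix i
  have "vf_even X = X" using even_plus_odd[of X] assms by simp
  then have o: "vf_odd (vf_bracket n X V) = vf_bracket n X (vf_odd V)" for V
    by (simp add: vf_odd_bracket assms)
  show "vf_bracket n X (vf_bracket n Y Z) i =
    (vf_bracket n (vf_bracket n X Y) Z + vf_bracket n Y (vf_bracket n X Z)) i"
    by (simp add: vf_bracket_apply[of n _ "vf_bracket n _ _"] vf_bracket_apply[of n "vf_bracket n _ _"] o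
       vf_act_bracket assms)
      (simp add: vf_bracket_apply assms vf_act_linear sc_two times_two_linear vf_act_minus algebra_simps)
qed

text \<open>The sign (-1)^p(Y) of the odd Leibniz rule is absorbed by passing from Y to its even
  part minus its odd part, which again allows arbitrary Y and Z.\<close>

lemma jacobi_odd:
  assumes "vf_even X = 0"
  shows "vf_bracket n X (vf_bracket n Y Z) =
    vf_bracket n (vf_bracket n X Y) Z + vf_bracket n (vf_even Y - vf_odd Y) (vf_bracket n X Z)"
proof
  fix i
  define Y1 Z1 where Y1: "Y1 = vf_odd Y" and Z1: "Z1 = vf_odd Z"
  have X: "vf_odd X = X" using even_plus_odd[of X] assms by simp
  have ev: "vf_even Y = Y - Y1" "vf_even Z = Z - Z1" by (simp_all add: vf_odd_def Y1 Z1)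
  have o: "vf_odd (vf_bracket n X Y) = vf_bracket n X (Y - Y1)"
    "vf_odd (vf_bracket n X Z) = vf_bracket n X (Z - Z1)" 
    "vf_odd (vf_bracket n Y Z) = vf_bracket n (Y - Y1) Z1 + vf_bracket n Y1 (Z - Z1)"
    by (simp_all add: vf_odd_bracket assms X ev flip: Y1 Z1)
  have YZ: "vf_odd Y1 = Y1" "vf_odd Z1 = Z1" by (simp_all add: Y1 Z1)
  show "vf_bracket n X (vf_bracket n Y Z) i =
    (vf_bracket n (vf_bracket n X Y) Z + vf_bracket n (vf_even Y - vf_odd Y) (vf_bracket n X Z)) i"
    unfolding ev Y1[symmetric]
    by (simp add: vf_bracket_apply[of n _ "vf_bracket n _ _"] vf_bracket_apply[of n "vf_bracket n _ _"] o
       vf_act_bracket assms X vf_odd_diff YZ flip: Y1 Z1)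
      (simp add: vf_bracket_apply X vf_odd_diff YZ vf_act_linear sc_two times_two_linear vf_act_minus algebra_simps vf_act_bracket flip: Y1 Z1)
qed

section \<open>Divergence as a cocycle, and the top coefficient of a bracket\<close>

section \<open>The algebras W(1,n) and S(1,n)\<close>

lemma Lam_add: "f \<in> Lam n \<Longrightarrow> g \<in> Lam n \<Longrightarrow> f + g \<in> Lam n"
  and Lam_diff: "f \<in> Lam n \<Longrightarrow> g \<in> Lam n \<Longrightarrow> f - g \<in> Lam n"
  and Lam_sc: "f \<in> Lam n \<Longrightarrow> sc c f \<in> Lam n"
  and Lam_zero [simp]: "0 \<in> Lam n"
  by (simp_all add: Lam_def sc_def)

lemma LamD: "f \<in> Lam n \<Longrightarrow> \<not> A \<subseteq> {1..n} \<Longrightarrow> f A = 0"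
  by (simp add: Lam_def)

lemma Lam_sum: "(\<And>i. i \<in> I \<Longrightarrow> f i \<in> Lam n) \<Longrightarrow> (\<Sum>i\<in>I. f i) \<in> Lam n"
  by (simp add: Lam_def sum_apply)

lemma Lam_mult:
  assumes "f \<in> Lam n" "g \<in> Lam n"
  shows "sfun_mult f g \<in> Lam n"
proof -
  have "sfun_mult f g A = 0" if A: "\<not> A \<subseteq> {1..n}" for A
    unfolding sfun_mult_def
  proof (rule sum.neutral, rule ballI)
    fix B assume "B \<in> Pow A"
    then have "\<not> B \<subseteq> {1..n} \<or> \<not> A - B \<subseteq> {1..n}" using A by blast
    then show "shuffle_sign B (A - B) * f B * g (A - B) = 0"
      using LamD[OF assms(1), of B] LamD[OF assms(2), of "A - B"] by auto
  qed
  then show ?thesis by (simp add: Lam_def)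
qed

lemma Lam_pd: "f \<in> Lam n \<Longrightarrow> pd i f \<in> Lam n"
  by (auto simp: Lam_def pd_def d_x_def d_xi_def)

lemma Lam_infinite: "f \<in> Lam n \<Longrightarrow> infinite A \<Longrightarrow> f A = 0"
  using finite_subset[of A "{1..n}"] by (intro LamD[of f n]) auto

lemma W_component: "X \<in> W n \<Longrightarrow> X i \<in> Lam n"
  by (cases "i \<le> n") (auto simp: W_def)

lemma W_nonzero: "X \<in> W n \<Longrightarrow> X i A \<noteq> 0 \<Longrightarrow> i \<le> n \<and> A \<subseteq> {1..n} \<and> finite A"
  using W_component[of X n i] by (auto simp: W_def Lam_def not_le intro: finite_subset)

lemma W_subspace: "vf.subspace (W n)"
  by (rule vf.subspaceI) (auto simp: W_def vf_scale_eq_sc intro: Lam_add Lam_sc)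

lemma W_even: "X \<in> W n \<Longrightarrow> vf_even X \<in> W n"
  by (auto simp: W_def Lam_def vf_even_def fun_eq_iff)

lemma W_odd: "X \<in> W n \<Longrightarrow> vf_odd X \<in> W n"
  unfolding vf_odd_def by (intro vf.subspace_diff W_subspace W_even)

lemma Lam_act:
  assumes "X \<in> W n" "f \<in> Lam n"
  shows "vf_act n X f \<in> Lam n"
  unfolding vf_act_eq_sum
  by (rule Lam_sum, rule Lam_mult, rule W_component, rule assms(1), rule Lam_pd, rule assms(2))

lemma W_bracket:
  assumes "X \<in> W n" "Y \<in> W n"
  shows "vf_bracket n X Y \<in> W n"
proof -
  have "vf_bracket n X Y i = 0" if "i > n" for i
    using that assms W_odd[OF assms(1)] by (simp add: vf_bracket_apply W_def)
  moreover have "vf_bracket n X Y i \<in> Lam n" for i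
    unfolding vf_bracket_apply
    by (intro Lam_add Lam_diff Lam_sc Lam_act[OF assms(1) W_component[OF assms(2)]]
        Lam_act[OF assms(2) W_component[OF assms(1)]]
        Lam_act[OF W_odd[OF assms(2)] W_component[OF W_odd[OF assms(1)]]])
  ultimately show ?thesis by (simp add: W_def)
qed

subsection \<open>Divergence\<close>

lemma sfun_invol_add: "sfun_invol (f + g) = sfun_invol f + sfun_invol g"
  and sfun_invol_sc: "sfun_invol (sc c f) = sc c (sfun_invol f)"
  by (simp_all add: sfun_invol_def sc_def fun_eq_iff algebra_simps)

lemma vf_div_add: "vf_div n (X + Y) = vf_div n X + vf_div n Y"
  unfolding vf_div_eq_sum sum.distrib [symmetric]
  by (intro sum.cong refl) (simp add: sfun_invol_add pd_add)

lemma vf_div_scale: "vf_div n (vf_scale c X) = sc c (vf_div n X)"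
  unfolding vf_div_eq_sum sc_sum
  by (intro sum.cong refl) (simp add: sfun_invol_sc pd_sc vf_scale_eq_sc)

lemma vf_div_zero [simp]: "vf_div n 0 = 0"
  using vf_div_scale[of n 0 0] by simp

text \<open>In a homogeneous field the parity of each coefficient is fixed, so the involution inside
  the divergence becomes a constant sign.\<close>

lemma vf_div_hom:
  assumes "vhom p X" "X \<in> W n"
  shows "vf_div n X = (\<Sum>i\<le>n. sc ((-1) ^ (par i * (p + 1))) (pd i (X i)))"
  unfolding vf_div_eq_sum
proof (rule sum.cong [OF refl])
  fix i
  have "sfun_invol (X i) = sc ((-1) ^ (p + 1)) (X i)" if "i \<noteq> 0"
  proof
    fix A
    show "sfun_invol (X i) A = sc ((-1) ^ (p + 1)) (X i) A"
    proof (cases "X i A = 0")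
      case False
      then have "even (card A + (p + par i))"
        using hom_funD[OF vhomD[OF assms(1)]] W_nonzero[OF assms(2)] by blast
      then have "even (card A + (p + 1))" using that by (simp add: par_def)
      then show ?thesis
        by (cases "even (card A)") (auto simp: sfun_invol_def sc_def simp flip: fps_const_neg)
    qed (simp add: sfun_invol_def sc_def)
  qed
  then show "pd i (if i = 0 then X i else sfun_invol (X i)) = sc ((-1) ^ (par i * (p + 1))) (pd i (X i))"
    by (auto simp: par_def pd_sc)
qed

lemma pd_act:
  assumes "vhom p X"
  shows "pd i (vf_act n X g) =
    vf_act n (\<lambda>k. pd i (X k)) g + sc ((-1) ^ (par i * p)) (vf_act n X (pd i g))"
proof -
  have "sc ((-1) ^ (par i * (p + par k))) (sfun_mult (X k) (pd i (pd k g))) =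
    sc ((-1) ^ (par i * p)) (sfun_mult (X k) (pd k (pd i g)))" for k
  proof -
    have "(-1::complex) ^ (par i * (p + par k)) * (-1) ^ (par i * par k) = (-1) ^ (par i * p)"
      unfolding power_add [symmetric] by (rule sign_cong) auto
    then show ?thesis by (subst pd_commute) (simp only: sfun_mult_sc_right sc_sc)
  qed
  then show ?thesis
    by (simp add: vf_act_eq_sum pd_sum pd_mult[OF vhomD[OF assms]] sum.distrib sc_sum)
qed

lemma vf_act_sum_right: "vf_act n X (\<Sum>i\<in>I. f i) = (\<Sum>i\<in>I. vf_act n X (f i))"
  using sum_comp_morphism[of "vf_act n X" f I] by (simp add: o_def vf_act_add_right)

text \<open>This is the supertrace of the product of the two Jacobian matrices; its cyclicity comes
  from supercommuting the entries and swapping the two sums.\<close>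

lemma first_order_symmetric:
  assumes "vhom p X" "vhom q Y"
  shows "(\<Sum>i\<le>n. sc ((-1) ^ (par i * (p + q + 1))) (vf_act n (\<lambda>k. pd i (X k)) (Y i))) =
    sc ((-1) ^ (p * q)) (\<Sum>i\<le>n. sc ((-1) ^ (par i * (p + q + 1))) (vf_act n (\<lambda>k. pd i (Y k)) (X i)))"
proof -
  have "sc ((-1) ^ (par i * (p + q + 1))) (sfun_mult (pd i (X k)) (pd k (Y i))) =
    sc ((-1) ^ (p * q)) (sc ((-1) ^ (par k * (p + q + 1))) (sfun_mult (pd k (Y i)) (pd i (X k))))" for i k
  proof -
    have "(-1 :: complex) ^ (par i * (p + q + 1)) * (-1) ^ ((p + par k + par i) * (q + par i + par k)) =
      (-1) ^ (p * q) * (-1) ^ (par k * (p + q + 1))"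
      unfolding power_add [symmetric] by (rule sign_cong) (auto simp: par_def)
    then show ?thesis
      by (subst sfun_mult_supercomm[OF hom_fun_pd[OF vhomD[OF assms(1)]] hom_fun_pd[OF vhomD[OF assms(2)]]])
        (simp only: sc_sc)
  qed
  then show ?thesis
    by (simp only: vf_act_eq_sum sc_sum) (subst (2) sum.swap, simp)
qed

text \<open>The divergence is a cocycle: the products of first derivatives cancel by
  \<open>first_order_symmetric\<close>, and derivatives of the divergences remain.\<close>

lemma div_hom_bracket:
  assumes "vhom p X" "vhom q Y" "X \<in> W n" "Y \<in> W n"
    and B: "B = (\<lambda>i. vf_act n X (Y i) - sc ((-1) ^ (p * q)) (vf_act n Y (X i)))"
  shows "vf_div n B = vf_act n X (vf_div n Y) - sc ((-1) ^ (p * q)) (vf_act n Y (vf_div n X))"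
proof -
  have hB: "vhom (p + q) B"
    unfolding vhom_def B
  proof (intro allI hom_fun_diff hom_fun_sc)
    fix i
    show "hom_fun (p + q + par i) (vf_act n X (Y i))"
      using hom_fun_act[OF assms(1) vhomD[OF assms(2)]] by (simp add: add.assoc)
    show "hom_fun (p + q + par i) (vf_act n Y (X i))"
      using hom_fun_act[OF assms(2) vhomD[OF assms(1)]] by (simp add: ac_simps)
  qed
  have "B i \<in> Lam n" for i
    unfolding B by (intro Lam_diff Lam_sc Lam_act[OF assms(3) W_component[OF assms(4)]]
      Lam_act[OF assms(4) W_component[OF assms(3)]])
  then have WB: "B \<in> W n"
    using assms(3,4) by (auto simp: W_def B)
  have s: "sc ((-1) ^ (par i * (p + q + 1))) (sc ((-1) ^ (par i * p)) f) = sc ((-1) ^ (par i * (q + 1))) f"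
    "sc ((-1) ^ (par i * (p + q + 1))) (sc ((-1) ^ (par i * q)) f) = sc ((-1) ^ (par i * (p + 1))) f" for i f
    by (simp_all only: sc_sc power_add [symmetric], simp_all only: par_def)
      (auto intro!: arg_cong[of _ _ "\<lambda>c. sc c f"] sign_cong)
  have c: "sc c (sc d f) = sc d (sc c f)" for c d f by (simp add: mult.commute)
  have "vf_div n B = (\<Sum>i\<le>n. sc ((-1) ^ (par i * (p + q + 1)))
     (pd i (vf_act n X (Y i)) - sc ((-1) ^ (p * q)) (pd i (vf_act n Y (X i)))))"
    unfolding vf_div_hom[OF hB WB] by (simp only: B pd_diff pd_sc)
  also have "\<dots> = (\<Sum>i\<le>n. sc ((-1) ^ (par i * (p + q + 1))) (vf_act n (\<lambda>k. pd i (X k)) (Y i)))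
     + (\<Sum>i\<le>n. sc ((-1) ^ (par i * (q + 1))) (vf_act n X (pd i (Y i))))
     - sc ((-1) ^ (p * q)) (\<Sum>i\<le>n. sc ((-1) ^ (par i * (p + q + 1))) (vf_act n (\<lambda>k. pd i (Y k)) (X i)))
     - sc ((-1) ^ (p * q)) (\<Sum>i\<le>n. sc ((-1) ^ (par i * (p + 1))) (vf_act n Y (pd i (X i))))"
    unfolding pd_act[OF assms(1)] pd_act[OF assms(2)] sc_diff sc_add s c[of "(-1) ^ (par _ * (p + q + 1))" "(-1) ^ (p * q)"]
      sum_subtractf sum.distrib sc_sum
    by (simp only: algebra_simps)
  also have "\<dots> = vf_act n X (vf_div n Y) - sc ((-1) ^ (p * q)) (vf_act n Y (vf_div n X))"
    unfolding first_order_symmetric[OF assms(1,2)]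
    by (simp only: vf_div_hom[OF assms(1,3)] vf_div_hom[OF assms(2,4)] vf_act_sum_right vf_act_sc_right)
      (simp add: algebra_simps)
  finally show ?thesis .
qed

text \<open>For divergence-free X, the function X g is a sum of derivatives of the products X_i g. A
  derivative in \<xi>_j has no \<xi>_1...\<xi>_n coefficient, so only the derivative in x
  contributes.\<close>

lemma act_div_free_top:
  assumes "vhom p X" "X \<in> W n" "vf_div n X = 0"
  shows "vf_act n X g {1..n} = d_x (sfun_mult (X 0) g) {1..n}"
proof -
  have "sc ((-1) ^ (par i * (p + 1))) (pd i (sfun_mult (X i) g)) =
    sfun_mult (sc ((-1) ^ (par i * (p + 1))) (pd i (X i))) g + sfun_mult (X i) (pd i g)" for i
  proof -
    have "(-1::complex) ^ (par i * (p + 1)) * (-1) ^ (par i * (p + par i)) = (-1) ^ (0::nat)"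
      unfolding power_add [symmetric] by (rule sign_cong) (auto simp: par_def)
    then show ?thesis
      unfolding pd_mult[OF vhomD[OF assms(1)]] by (simp only: sc_add sc_sc sfun_mult_sc_left power_0 sc_one)
  qed
  then have "vf_act n X g = (\<Sum>i\<le>n. sc ((-1) ^ (par i * (p + 1))) (pd i (sfun_mult (X i) g)))
    - sfun_mult (vf_div n X) g"
    by (simp add: vf_act_eq_sum vf_div_hom[OF assms(1,2)] sum.distrib sfun_mult_sum_left)
  then have "vf_act n X g {1..n} = (\<Sum>i\<le>n. sc ((-1) ^ (par i * (p + 1))) (pd i (sfun_mult (X i) g)) {1..n})"
    by (simp add: assms(3) sum_apply)
  also have "\<dots> = (\<Sum>i\<le>n. if i = 0 then d_x (sfun_mult (X 0) g) {1..n} else 0)"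
    by (intro sum.cong refl) (auto simp: pd_def par_def sc_def d_xi_def)
  finally show ?thesis by simp
qed

text \<open>The top coefficient of the bracket is the x-derivative of that of X_0 Y_0 minus its
  supercommuted copy, hence 0. This is why brackets never reach the top field.\<close>

lemma S'_hom_bracket:
  assumes "vhom p X" "vhom q Y" "X \<in> S' n" "Y \<in> S' n"
    and B: "B = (\<lambda>i. vf_act n X (Y i) - sc ((-1) ^ (p * q)) (vf_act n Y (X i)))"
  shows "vf_div n B = 0" "B 0 {1..n} = 0"
proof -
  have XY: "X \<in> W n" "Y \<in> W n" "vf_div n X = 0" "vf_div n Y = 0" using assms by (auto simp: S'_def)
  show "vf_div n B = 0"
    using div_hom_bracket[OF assms(1,2) XY(1,2) B] XY by simp
  have "sfun_mult (X 0) (Y 0) = sc ((-1) ^ (p * q)) (sfun_mult (Y 0) (X 0))"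
    using sfun_mult_supercomm[OF vhomD[OF assms(1), of 0] vhomD[OF assms(2), of 0]] by (simp add: par_def)
  moreover have "d_x (sc c f) = sc c (d_x f)" for c f using pd_sc[of 0] by (simp add: pd_def)
  ultimately show "B 0 {1..n} = 0"
    using act_div_free_top[OF assms(1) XY(1,3), of "Y 0"] act_div_free_top[OF assms(2) XY(2,4), of "X 0"]
    by (simp add: B sc_def)
qed

lemma vf_div_Lam: "X \<in> W n \<Longrightarrow> vf_div n X \<in> Lam n"
proof -
  assume "X \<in> W n"
  moreover have "f \<in> Lam n \<Longrightarrow> sfun_invol f \<in> Lam n" for f by (simp add: Lam_def sfun_invol_def)
  ultimately show ?thesis
    unfolding vf_div_eq_sum by (intro Lam_sum Lam_pd) (auto intro: W_component)
qed

text \<open>The divergences of the two parity components have opposite parities and add up to 0, so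
  each of them vanishes.\<close>

lemma S'_even: "X \<in> S' n \<Longrightarrow> vf_even X \<in> S' n"
proof -
  assume X: "X \<in> S' n"
  have W: "vf_even X \<in> W n" "vf_odd X \<in> W n" using X by (auto simp: S'_def W_even W_odd)
  have "vf_div n (vf_even X) + vf_div n (vf_odd X) = 0"
    using X by (simp add: S'_def even_plus_odd flip: vf_div_add)
  then have s: "vf_div n (vf_odd X) A = - vf_div n (vf_even X) A" for A
    by (metis add_eq_0_iff fun_Compl_def uminus_apply)
  have h: "hom_fun p (vf_div n Y)" if "vhom p Y" "Y \<in> W n" for p Y
    unfolding vf_div_hom[OF that]
    by (intro hom_fun_sum hom_fun_sc hom_fun_cong[OF _ hom_fun_pd[OF vhomD[OF that(1)]]]) auto
  have "vf_div n (vf_even X) A = 0" for A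
  proof (cases "finite A")
    case True
    then show ?thesis
      using hom_funD[OF h[OF vhom_even W(1)], of A] hom_funD[OF h[OF vhom_odd W(2)], of A] s[of A]
      by fastforce
  next
    case False then show ?thesis using Lam_infinite[OF vf_div_Lam[OF W(1)]] by simp
  qed
  then show ?thesis using W by (simp add: S'_def fun_eq_iff)
qed

lemma S'_subspace: "vf.subspace (S' n)"
  by (rule vf.subspaceI)
    (auto simp: S'_def vf_div_add vf_div_scale vf.subspace_0[OF W_subspace]
      intro: vf.subspace_add[OF W_subspace] vf.subspace_scale[OF W_subspace])

lemma S'_odd: "X \<in> S' n \<Longrightarrow> vf_odd X \<in> S' n"
  unfolding vf_odd_def by (intro vf.subspace_diff S'_subspace S'_even)

text \<open>
  Vanishing divergence makes the \<open>\<xi>\<^sub>1 \<dots> \<xi>\<^sub>n\<close>-coefficient of \<open>X 0\<close> constant, so only the multiples of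
  \<open>top_vf n\<close> are excluded.
\<close>

definition S0 :: "nat \<Rightarrow> vfield set" where
  "S0 n = {X \<in> S' n. X 0 {1..n} = 0}"

lemma S0_subspace: "vf.subspace (S0 n)"
  using S'_subspace[of n] unfolding vf.subspace_def by (auto simp: S0_def vf_scale_def)

lemma S'_bracket_S0:
  assumes "X \<in> S' n" "Y \<in> S' n"
  shows "vf_bracket n X Y \<in> S0 n"
proof -
  define X0 X1 Y0 Y1 where d: "X0 = vf_even X" "X1 = vf_odd X" "Y0 = vf_even Y" "Y1 = vf_odd Y"
  have h: "vhom 0 X0" "vhom 1 X1" "vhom 0 Y0" "vhom 1 Y1"
    by (simp_all only: d vhom_even vhom_odd)
  have m: "X0 \<in> S' n" "X1 \<in> S' n" "Y0 \<in> S' n" "Y1 \<in> S' n"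
    by (simp_all add: d S'_even S'_odd assms)
  have s: "X = X0 + X1" "Y = Y0 + Y1" by (simp_all add: d even_plus_odd)
  have e: "vf_bracket n X0 Y0 = (\<lambda>i. vf_act n X0 (Y0 i) - sc ((-1) ^ (0 * 0)) (vf_act n Y0 (X0 i)))"
    "vf_bracket n X0 Y1 = (\<lambda>i. vf_act n X0 (Y1 i) - sc ((-1) ^ (0 * 1)) (vf_act n Y1 (X0 i)))"
    "vf_bracket n X1 Y0 = (\<lambda>i. vf_act n X1 (Y0 i) - sc ((-1) ^ (1 * 0)) (vf_act n Y0 (X1 i)))"
    "vf_bracket n X1 Y1 = (\<lambda>i. vf_act n X1 (Y1 i) - sc ((-1) ^ (1 * 1)) (vf_act n Y1 (X1 i)))"
    by (simp_all only: d) (rule ext, simp add: vf_bracket_even_left vf_bracket_even_right vf_bracket_odd sc_minus_one)+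
  have "vf_bracket n X0 Y0 \<in> S0 n" "vf_bracket n X0 Y1 \<in> S0 n" "vf_bracket n X1 Y0 \<in> S0 n" "vf_bracket n X1 Y1 \<in> S0 n"
    using S'_hom_bracket[OF h(1) h(3) m(1) m(3) e(1)] S'_hom_bracket[OF h(1) h(4) m(1) m(4) e(2)]
      S'_hom_bracket[OF h(2) h(3) m(2) m(3) e(3)] S'_hom_bracket[OF h(2) h(4) m(2) m(4) e(4)] m
    by (simp_all add: S0_def S'_def W_bracket)
  then show ?thesis
    by (simp add: s vf_bracket_linear vf.subspace_add[OF S0_subspace])
qed

subsection \<open>Constant vector fields\<close>

definition const_vf :: "nat \<Rightarrow> vfield" where
  "const_vf i = vf_monom 0 {} i"

definition sfun_one :: sfun where
  "sfun_one = (\<lambda>A. if A = {} then 1 else 0)"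

lemma sfun_mult_one_left: "f \<in> Lam n \<Longrightarrow> sfun_mult sfun_one f = f"
proof
  fix A assume f: "f \<in> Lam n"
  show "sfun_mult sfun_one f A = f A"
  proof (cases "finite A")
    case True
    have "sfun_mult sfun_one f A = (\<Sum>B\<in>{{}}. shuffle_sign B (A - B) * sfun_one B * f (A - B))"
      unfolding sfun_mult_def using True
      by (intro sum.mono_neutral_right) (auto simp: sfun_one_def)
    then show ?thesis by (simp add: sfun_one_def)
  qed (use Lam_infinite[OF f] in \<open>simp add: sfun_mult_infinite\<close>)
qed

lemma sfun_mult_one_right: "f \<in> Lam n \<Longrightarrow> sfun_mult f sfun_one = f"
proof
  fix A assume f: "f \<in> Lam n"
  show "sfun_mult f sfun_one A = f A"
  proof (cases "finite A")
    case True
    have "sfun_mult f sfun_one A = (\<Sum>B\<in>{A}. shuffle_sign B (A - B) * f B * sfun_one (A - B))"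
      unfolding sfun_mult_def using True
      by (intro sum.mono_neutral_right) (auto simp: sfun_one_def)
    then show ?thesis by (simp add: sfun_one_def)
  qed (use Lam_infinite[OF f] in \<open>simp add: sfun_mult_infinite\<close>)
qed

lemma const_vf_apply: "const_vf i k = (if k = i then sfun_one else 0)"
  by (auto simp: const_vf_def vf_monom_def sfun_one_def fun_eq_iff)

lemma pd_sfun_one: "pd i sfun_one = 0"
  by (auto simp: pd_def d_x_def d_xi_def sfun_one_def fun_eq_iff)

lemma act_const_vf: "i \<le> n \<Longrightarrow> f \<in> Lam n \<Longrightarrow> vf_act n (const_vf i) f = pd i f"
proof -
  assume i: "i \<le> n" "f \<in> Lam n"
  have "vf_act n (const_vf i) f = (\<Sum>k\<le>n. if k = i then pd i f else 0)"
    unfolding vf_act_eq_sum using i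
    by (intro sum.cong refl) (auto simp: const_vf_apply sfun_mult_one_left[OF Lam_pd[OF i(2)]])
  then show ?thesis using i by simp
qed

lemma vf_odd_const: "vf_odd (const_vf i) = (if i = 0 then 0 else const_vf i)"
  by (auto simp: vf_odd_def vf_even_def const_vf_def vf_monom_def fun_eq_iff)

lemma bracket_const_vf:
  assumes "i \<le> n" "Y \<in> W n"
  shows "vf_bracket n (const_vf i) Y = (\<lambda>k. pd i (Y k))"
proof
  fix k
  have 0: "vf_act n Z (const_vf i k) = 0" for Z
    by (simp add: vf_act_eq_sum const_vf_apply pd_sfun_one)
  show "vf_bracket n (const_vf i) Y k = pd i (Y k)"
    using assms by (simp add: vf_bracket_apply 0 vf_odd_const act_const_vf W_component)
qed

lemma const_vf_W: "i \<le> n \<Longrightarrow> const_vf i \<in> W n"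
  by (auto simp: W_def Lam_def const_vf_def vf_monom_def fun_eq_iff)

section \<open>Degree filtrations compatible with the bracket\<close>

section \<open>Filtrations by degree\<close>

definition wt :: "int \<Rightarrow> (nat \<Rightarrow> int) \<Rightarrow> nat \<Rightarrow> int" where
  "wt a b i = (if i = 0 then a else b i)"

definition FF :: "nat \<Rightarrow> int \<Rightarrow> (nat \<Rightarrow> int) \<Rightarrow> int \<Rightarrow> sfun set" where
  "FF n a b d = {f \<in> Lam n. \<forall>A m. fps_nth (f A) m \<noteq> 0 \<longrightarrow> d \<le> a * int m + sum b A}"

text \<open>A filtration instead of a grading: elements are formal series, and only lower bounds on
  degrees are tracked. The weights used later are those of the Euler field, of subsets of the odd
  variables, and two families depending on k.\<close>

definition VF :: "nat \<Rightarrow> int \<Rightarrow> (nat \<Rightarrow> int) \<Rightarrow> int \<Rightarrow> vfield set" where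
  "VF n a b d = {X \<in> W n. \<forall>i A m. fps_nth (X i A) m \<noteq> 0 \<longrightarrow> d \<le> vf_deg a b m A i}"

lemma vf_deg_eq: "vf_deg a b m A i = a * int m + sum b A - wt a b i"
  by (simp add: vf_deg_def wt_def)

lemma VF_W: "X \<in> VF n a b d \<Longrightarrow> X \<in> W n"
  by (simp add: VF_def)

lemma VF_deg: "X \<in> VF n a b d \<Longrightarrow> fps_nth (X i A) m \<noteq> 0 \<Longrightarrow> d \<le> vf_deg a b m A i"
  by (simp add: VF_def)

lemma VF_mono: "d' \<le> d \<Longrightarrow> X \<in> VF n a b d \<Longrightarrow> X \<in> VF n a b d'"
  by (force simp: VF_def)

lemma FF_Lam: "f \<in> FF n a b d \<Longrightarrow> f \<in> Lam n"
  by (simp add: FF_def)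

lemma FF_deg: "f \<in> FF n a b d \<Longrightarrow> fps_nth (f A) m \<noteq> 0 \<Longrightarrow> d \<le> a * int m + sum b A"
  by (simp add: FF_def)

lemma FFI: "f \<in> Lam n \<Longrightarrow> (\<And>A m. fps_nth (f A) m \<noteq> 0 \<Longrightarrow> d \<le> a * int m + sum b A) \<Longrightarrow> f \<in> FF n a b d"
  by (simp add: FF_def)

lemma VF_component: "X \<in> VF n a b d \<Longrightarrow> X i \<in> FF n a b (d + wt a b i)"
  by (rule FFI, rule W_component[OF VF_W], assumption, drule (1) VF_deg, simp add: vf_deg_eq)

lemma VF_I: "X \<in> W n \<Longrightarrow> (\<And>i. X i \<in> FF n a b (d + wt a b i)) \<Longrightarrow> X \<in> VF n a b d"
  unfolding VF_def vf_deg_eq using FF_deg[of "X i" n a b "d + wt a b i" for i] by force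

lemma FF_add: "f \<in> FF n a b d \<Longrightarrow> g \<in> FF n a b d \<Longrightarrow> f + g \<in> FF n a b d"
  and FF_diff: "f \<in> FF n a b d \<Longrightarrow> g \<in> FF n a b d \<Longrightarrow> f - g \<in> FF n a b d"
  and FF_sc: "f \<in> FF n a b d \<Longrightarrow> sc c f \<in> FF n a b d"
  and FF_zero [simp]: "0 \<in> FF n a b d"
proof -
  assume f: "f \<in> FF n a b d"
  show "sc c f \<in> FF n a b d"
  proof (rule FFI)
    fix A m assume "fps_nth (sc c f A) m \<noteq> 0"
    then have "fps_nth (f A) m \<noteq> 0" by (simp add: sc_def)
    then show "d \<le> a * int m + sum b A" by (rule FF_deg[OF f])
  qed (rule Lam_sc[OF FF_Lam[OF f]])
  assume g: "g \<in> FF n a b d"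
  have *: "d \<le> a * int m + sum b A" if "fps_nth (f A) m \<noteq> 0 \<or> fps_nth (g A) m \<noteq> 0" for A m
    using that FF_deg[OF f, of A m] FF_deg[OF g, of A m] by argo
  show "f + g \<in> FF n a b d"
    by (rule FFI, rule Lam_add[OF FF_Lam[OF f] FF_Lam[OF g]], rule *, auto)
  show "f - g \<in> FF n a b d"
    by (rule FFI, rule Lam_diff[OF FF_Lam[OF f] FF_Lam[OF g]], rule *, auto)
qed (simp add: FF_def)

lemma FF_sum:
  assumes "\<And>i. i \<in> I \<Longrightarrow> f i \<in> FF n a b d"
  shows "(\<Sum>i\<in>I. f i) \<in> FF n a b d"
proof (rule FFI)
  fix A m assume "fps_nth ((\<Sum>i\<in>I. f i) A) m \<noteq> 0"
  then obtain i where "i \<in> I" "fps_nth (f i A) m \<noteq> 0"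
    unfolding sum_apply fps_sum_nth by (meson sum.not_neutral_contains_not_neutral)
  then show "d \<le> a * int m + sum b A" using FF_deg[OF assms] by blast
qed (rule Lam_sum, rule FF_Lam, rule assms)

lemma shuffle_sign_cases: "shuffle_sign A B = 1 \<or> shuffle_sign A B = - 1"
  by (auto simp: shuffle_sign_def minus_one_power_iff)

lemma FF_mult:
  assumes "f \<in> FF n a b d" "g \<in> FF n a b e"
  shows "sfun_mult f g \<in> FF n a b (d + e)"
proof (rule FFI)
  fix A m assume h: "fps_nth (sfun_mult f g A) m \<noteq> 0"
  then have fin: "finite A" by (metis sfun_mult_infinite fps_zero_nth)
  obtain B where B: "B \<in> Pow A" "fps_nth (shuffle_sign B (A - B) * f B * g (A - B)) m \<noteq> 0"
    using h unfolding sfun_mult_def fps_sum_nth by (meson sum.not_neutral_contains_not_neutral)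
  then have "fps_nth (f B * g (A - B)) m \<noteq> 0"
    using shuffle_sign_cases[of B "A - B"] by auto
  then obtain k where k: "k \<in> {0..m}" "fps_nth (f B) k * fps_nth (g (A - B)) (m - k) \<noteq> 0"
    unfolding fps_mult_nth by (meson sum.not_neutral_contains_not_neutral)
  have "fps_nth (f B) k \<noteq> 0" "fps_nth (g (A - B)) (m - k) \<noteq> 0" using k by auto
  then have "d \<le> a * int k + sum b B" "e \<le> a * int (m - k) + sum b (A - B)"
    by (blast intro: FF_deg[OF assms(1)] FF_deg[OF assms(2)])+
  moreover have "sum b A = sum b B + sum b (A - B)"
    using B fin by (metis PowD add.commute sum.subset_diff)
  moreover have "a * int m = a * int k + a * int (m - k)"
    using k by (simp add: distrib_left [symmetric])
  ultimately show "d + e \<le> a * int m + sum b A" by linarith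
qed (rule Lam_mult[OF FF_Lam[OF assms(1)] FF_Lam[OF assms(2)]])

lemma FF_pd:
  assumes "f \<in> FF n a b d"
  shows "pd i f \<in> FF n a b (d - wt a b i)"
proof (rule FFI)
  fix A m assume h: "fps_nth (pd i f A) m \<noteq> 0"
  show "d - wt a b i \<le> a * int m + sum b A"
  proof (cases "i = 0")
    case True
    then have "fps_nth (f A) (Suc m) \<noteq> 0" using h by (auto simp: pd_def d_x_def)
    then show ?thesis using FF_deg[OF assms, of A "Suc m"] True by (simp add: wt_def algebra_simps)
  next
    case False
    then have "i \<notin> A" "fps_nth (shuffle_sign {i} A * f (insert i A)) m \<noteq> 0"
      using h by (auto simp: pd_def d_xi_apply split: if_splits)
    then have i: "i \<notin> A" "fps_nth (f (insert i A)) m \<noteq> 0"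
      using shuffle_sign_cases[of "{i}" A] by auto
    then have "finite (insert i A)"
      using Lam_infinite[OF FF_Lam[OF assms]] by (metis fps_zero_nth)
    then show ?thesis using FF_deg[OF assms i(2)] i(1) False by (simp add: wt_def)
  qed
qed (rule Lam_pd[OF FF_Lam[OF assms]])

lemma FF_act:
  assumes "X \<in> VF n a b d" "f \<in> FF n a b e"
  shows "vf_act n X f \<in> FF n a b (d + e)"
  unfolding vf_act_eq_sum
proof (rule FF_sum)
  fix i
  show "sfun_mult (X i) (pd i f) \<in> FF n a b (d + e)"
    using FF_mult[OF VF_component[OF assms(1), of i] FF_pd[OF assms(2), of i]] by simp
qed

lemma VF_subspace: "vf.subspace (VF n a b d)"
proof (rule vf.subspaceI)
  show "0 \<in> VF n a b d" using vf.subspace_0[OF W_subspace] by (auto simp: VF_def)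
  fix X Y c assume h: "X \<in> VF n a b d" "Y \<in> VF n a b d"
  have "(X + Y) i \<in> FF n a b (d + wt a b i)" for i
    using FF_add[OF VF_component[OF h(1)] VF_component[OF h(2)], of i] by simp
  then show "X + Y \<in> VF n a b d"
    by (intro VF_I vf.subspace_add[OF W_subspace VF_W[OF h(1)] VF_W[OF h(2)]])
  have "vf_scale c X i \<in> FF n a b (d + wt a b i)" for i
    using FF_sc[OF VF_component[OF h(1)]] by (simp add: vf_scale_eq_sc)
  then show "vf_scale c X \<in> VF n a b d"
    by (intro VF_I vf.subspace_scale[OF W_subspace VF_W[OF h(1)]])
qed

lemma VF_even: "X \<in> VF n a b d \<Longrightarrow> vf_even X \<in> VF n a b d"
  using W_even by (auto simp: VF_def vf_even_def)

lemma VF_odd: "X \<in> VF n a b d \<Longrightarrow> vf_odd X \<in> VF n a b d"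
  unfolding vf_odd_def by (intro vf.subspace_diff VF_subspace VF_even)

lemma VF_bracket:
  assumes "X \<in> VF n a b d" "Y \<in> VF n a b e"
  shows "vf_bracket n X Y \<in> VF n a b (d + e)"
proof (rule VF_I)
  show "vf_bracket n X Y \<in> W n" by (rule W_bracket[OF VF_W[OF assms(1)] VF_W[OF assms(2)]])
  fix i
  have "vf_act n X (Y i) \<in> FF n a b (d + e + wt a b i)"
    using FF_act[OF assms(1) VF_component[OF assms(2), of i]] by (simp add: add.assoc)
  moreover have "vf_act n Y (X i) \<in> FF n a b (d + e + wt a b i)"
    using FF_act[OF assms(2) VF_component[OF assms(1), of i]] by (simp add: ac_simps)
  moreover have "vf_act n (vf_odd Y) (vf_odd X i) \<in> FF n a b (d + e + wt a b i)"
    using FF_act[OF VF_odd[OF assms(2)] VF_component[OF VF_odd[OF assms(1)], of i]] by (simp add: ac_simps)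
  ultimately show "vf_bracket n X Y i \<in> FF n a b (d + e + wt a b i)"
    unfolding vf_bracket_apply by (intro FF_add FF_diff FF_sc)
qed

text \<open>The Euler filtration. As sets A have at most n elements in \<open>W n\<close>, it is
  cofinal with the x-adic one and so describes the topology.\<close>

abbreviation EF :: "nat \<Rightarrow> int \<Rightarrow> vfield set" where
  "EF n \<equiv> VF n 1 (\<lambda>_. 1)"

lemma euler_deg: "vf_deg 1 (\<lambda>_. 1) m A i = int m + int (card A) - 1"
  by (simp add: vf_deg_def)

lemma W_EF: "X \<in> W n \<Longrightarrow> X \<in> EF n (-1)"
  by (simp add: VF_def euler_deg)

section \<open>Surjectivity of ad \<partial>/\<partial>x and an explicit form of S(1,n)\<close>

section \<open>Generation of S(1,n)\<close>

lemma const_vf_S0: "i \<le> n \<Longrightarrow> n \<ge> 1 \<Longrightarrow> const_vf i \<in> S0 n"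
proof -
  assume i: "i \<le> n" "n \<ge> 1"
  have inv: "sfun_invol sfun_one = sfun_one" "sfun_invol 0 = 0"
    by (auto simp: sfun_invol_def sfun_one_def fun_eq_iff)
  have "vf_div n (const_vf i) = 0"
    unfolding vf_div_eq_sum by (intro sum.neutral) (auto simp: const_vf_apply pd_sfun_one inv)
  then show ?thesis using i const_vf_W by (auto simp: S0_def S'_def const_vf_apply sfun_one_def)
qed

lemma S0_bracket: "X \<in> S0 n \<Longrightarrow> Y \<in> S0 n \<Longrightarrow> vf_bracket n X Y \<in> S0 n"
  using S'_bracket_S0 by (simp add: S0_def)

lemma vf_div_apply: "vf_div n X A = fps_deriv (X 0 A) +
    (\<Sum>j\<in>{1..n} - A. shuffle_sign {j} A * (-1) ^ card (insert j A) * X j (insert j A))"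
proof -
  have "vf_div n X A = fps_deriv (X 0 A) + (\<Sum>j\<in>{1..n}. d_xi j (sfun_invol (X j)) A)"
    by (simp add: vf_div_def d_x_def sum_apply)
  also have "(\<Sum>j\<in>{1..n}. d_xi j (sfun_invol (X j)) A) = (\<Sum>j\<in>{1..n} - A. d_xi j (sfun_invol (X j)) A)"
    by (intro sum.mono_neutral_right) (auto simp: d_xi_def)
  also have "\<dots> = (\<Sum>j\<in>{1..n} - A. shuffle_sign {j} A * (-1) ^ card (insert j A) * X j (insert j A))"
    by (intro sum.cong) (auto simp: d_xi_apply sfun_invol_def)
  finally show ?thesis .
qed

text \<open>Integrating every coefficient in x leaves a divergence that is constant in x. Constants
  of integration cancel it, for each A in one direction \<xi>_k with k the least index missing from
  A. For A = {1..n} there is no such k, and there the vanishing top coefficient is used.\<close>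

lemma S0_integrate:
  assumes "X \<in> S0 n" "X \<in> EF n d"
  shows "\<exists>Y \<in> S0 n \<inter> EF n (d + 1). vf_bracket n (const_vf 0) Y = X"
proof -
  have X: "X \<in> W n" "vf_div n X = 0" "X 0 {1..n} = 0" using assms by (auto simp: S0_def S'_def)
  \<comment> \<open>Here B stands for \<open>insert j A\<close>. The sign is minus the one with
    which the coefficient of \<xi>_B in direction j enters \<open>vf_div_apply\<close>, whence
    \<open>card B + 1\<close>.\<close>
  define corr :: "nat \<Rightarrow> nat set \<Rightarrow> complex" where
    "corr j B = (if j \<in> B \<and> B \<subseteq> {1..n} \<and> j = Min ({1..n} - (B - {j}))
      then fps_nth (shuffle_sign {j} (B - {j})) 0 * (-1) ^ (card B + 1) * fps_nth (X 0 (B - {j})) 0 else 0)" for j B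
  define Y where "Y = (\<lambda>i A. fps_integral (X i A) (if i = 0 then 0 else corr i A))"
  have corr0: "corr j B = 0" if "\<not> B \<subseteq> {1..n} \<or> j > n" for j B
    using that by (auto simp: corr_def)
  have YW: "Y \<in> W n"
    unfolding W_def Y_def
    using X(1) corr0 by (auto simp: W_def Lam_def fun_eq_iff fps_integral0_zero)
  have deriv: "fps_deriv (Y i A) = X i A" for i A
    by (simp add: Y_def fps_deriv_fps_integral)
  have sgd: "fps_deriv (shuffle_sign A B * (-1) ^ k * f) = shuffle_sign A B * (-1) ^ k * fps_deriv f" for A B k f
    using shuffle_sign_cases[of A B] by (cases "even k") auto
  have "vf_div n Y A = 0" for A
  proof (cases "A \<subseteq> {1..n}")
    case False then show ?thesis using LamD[OF vf_div_Lam[OF YW]] by blast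
  next
    case A: True
    then have finA: "finite A" using finite_subset by blast
    have "fps_deriv (vf_div n Y A) = vf_div n X A"
      unfolding vf_div_apply by (simp only: fps_deriv_add fps_deriv_sum sgd deriv)
    then have 1: "vf_div n Y A = fps_const (fps_nth (vf_div n Y A) 0)" by (simp add: X)
    have "fps_nth (vf_div n Y A) 0 = fps_nth (X 0 A) 0 +
        (\<Sum>j\<in>{1..n} - A. fps_nth (shuffle_sign {j} A * (-1) ^ card (insert j A)) 0 * corr j (insert j A))"
      unfolding vf_div_apply deriv by (simp add: fps_sum_nth) (intro sum.cong, auto simp: Y_def)
    also have "\<dots> = 0"
    proof (cases "A = {1..n}")
      case True then show ?thesis using X(3) by simp
    next
      case False
      define k where "k = Min ({1..n} - A)"
      have "{1..n} - A \<noteq> {}" using A False by blast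
      then have k: "k \<in> {1..n} - A" unfolding k_def by (intro Min_in) auto
      have "(\<Sum>j\<in>{1..n} - A. fps_nth (shuffle_sign {j} A * (-1) ^ card (insert j A)) 0 * corr j (insert j A))
        = (\<Sum>j\<in>{1..n} - A. if j = k then - fps_nth (X 0 A) 0 else 0)"
      proof (rule sum.cong [OF refl])
        fix j assume j: "j \<in> {1..n} - A"
        then have "insert j A - {j} = A" by auto
        then show "fps_nth (shuffle_sign {j} A * (-1) ^ card (insert j A)) 0 * corr j (insert j A) =
          (if j = k then - fps_nth (X 0 A) 0 else 0)"
          using A j finA shuffle_sign_cases[of "{j}" A]
          by (cases "even (card A)") (auto simp: corr_def k_def)
      qed
      then show ?thesis using k by simp
    qed
    finally show ?thesis using 1 by simp
  qed
  then have "vf_div n Y = 0" by (simp add: fun_eq_iff)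
  then have S: "Y \<in> S0 n" using YW X(3) by (simp add: S0_def S'_def Y_def fps_integral0_zero)
  have "d + 1 \<le> vf_deg 1 (\<lambda>_. 1) m A i" if h: "fps_nth (Y i A) m \<noteq> 0" for i A m
  proof (cases m)
    case 0
    then have c: "i \<noteq> 0" "corr i A \<noteq> 0" using h by (cases "i = 0"; simp add: Y_def)+
    then have "i \<in> A" "A \<subseteq> {1..n}" "fps_nth (X 0 (A - {i})) 0 \<noteq> 0" by (auto simp: corr_def split: if_splits)
    moreover have "finite A" using \<open>A \<subseteq> {1..n}\<close> finite_subset by blast
    ultimately show ?thesis
      using VF_deg[OF assms(2), of 0 "A - {i}" 0] card_gt_0_iff[of A] 0
      by (auto simp: euler_deg card_Diff_singleton)
  next
    case (Suc k)
    then have "fps_nth (X i A) k \<noteq> 0" using h by (auto simp: Y_def)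
    then show ?thesis using VF_deg[OF assms(2)] Suc by (force simp: euler_deg)
  qed
  then have "Y \<in> EF n (d + 1)" using YW by (simp add: VF_def)
  moreover have "vf_bracket n (const_vf 0) Y = X"
    using bracket_const_vf[of 0 n Y] YW by (simp add: pd_def d_x_def deriv fun_eq_iff)
  ultimately show ?thesis using S by blast
qed

text \<open>Brackets with \<partial>/\<partial>x alone already fill \<open>S0 n\<close>.\<close>

lemma S_eq_S0:
  assumes "n \<ge> 1"
  shows "S n = S0 n"
proof
  show "S n \<subseteq> S0 n"
    unfolding S_def by (intro vf.span_minimal S0_subspace) (auto intro: S'_bracket_S0)
  show "S0 n \<subseteq> S n"
  proof
    fix X assume X: "X \<in> S0 n"
    then have "X \<in> EF n (-1)" by (intro W_EF) (simp add: S0_def S'_def)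
    then obtain Y where "Y \<in> S0 n" "vf_bracket n (const_vf 0) Y = X" using S0_integrate[OF X] by blast
    moreover have "const_vf 0 \<in> S0 n" using assms by (intro const_vf_S0) auto
    ultimately show "X \<in> S n" unfolding S_def by (intro vf.span_base) (auto simp: S0_def)
  qed
qed

section \<open>The Euler field as the degree operator\<close>

section \<open>The Euler field\<close>

lemma sfun_mult_single:
  assumes "finite A" "\<And>C. C \<noteq> B \<Longrightarrow> g C = 0"
  shows "sfun_mult g f A = (if B \<subseteq> A then shuffle_sign B (A - B) * g B * f (A - B) else 0)"
proof -
  have "sfun_mult g f A = (\<Sum>C\<in>Pow A. if C = B then shuffle_sign B (A - B) * g B * f (A - B) else 0)"
    unfolding sfun_mult_def using assms(2) by (intro sum.cong) auto
  then show ?thesis using assms(1) by simp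
qed

lemma euler_0: "euler n 0 = (\<lambda>A. if A = {} then fps_X else 0)"
  by (auto simp: euler_def sum_apply vf_monom_def fun_eq_iff intro!: sum.neutral)

lemma euler_Suc: "i \<ge> 1 \<Longrightarrow> euler n i = (\<lambda>A. if i \<le> n \<and> A = {i} then 1 else 0)"
proof -
  assume i: "i \<ge> 1"
  have "(\<Sum>j=1..n. vf_monom 0 {j} j i A) = (\<Sum>j=1..n. if j = i then (if A = {i} then 1 else 0) else 0)" for A
    by (intro sum.cong refl) (auto simp: vf_monom_def)
  then show ?thesis using i by (simp add: euler_def sum_apply fun_eq_iff) (auto simp: vf_monom_def)
qed

lemma euler_W: "euler n \<in> W n"
  unfolding W_def
proof (safe)
  fix i show "i \<le> n \<Longrightarrow> euler n i \<in> Lam n"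
    by (cases "i = 0") (auto simp: euler_0 euler_Suc Lam_def)
  show "i > n \<Longrightarrow> euler n i = 0" by (auto simp: euler_Suc fun_eq_iff)
qed

lemma euler_odd: "vf_odd (euler n) = 0"
proof -
  have "vf_even (euler n) i A = euler n i A" for i A
    by (cases "i = 0") (auto simp: vf_even_def euler_0 euler_Suc)
  then have "vf_even (euler n) = euler n" by (intro ext)
  then show ?thesis by (simp add: vf_odd_def)
qed

lemma act_euler:
  assumes "f \<in> Lam n" "A \<subseteq> {1..n}"
  shows "vf_act n (euler n) f A = fps_X * fps_deriv (f A) + of_nat (card A) * f A"
proof -
  have fin: "finite A" using assms finite_subset by blast
  have "sfun_mult (euler n i) (pd i f) A = (if i = 0 then fps_X * fps_deriv (f A) else if i \<in> A then f A else 0)"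
    if i: "i \<le> n" for i
  proof (cases "i = 0")
    case True
    then show ?thesis by (subst sfun_mult_single[OF fin, of "{}"]) (auto simp: euler_0 pd_def d_x_def)
  next
    case False
    show ?thesis
      using False i
      by (subst sfun_mult_single[OF fin, of "{i}"])
        (auto simp: euler_Suc pd_def d_xi_apply insert_absorb shuffle_sign_square')
  qed
  then have "vf_act n (euler n) f A = (\<Sum>i\<le>n. if i = 0 then fps_X * fps_deriv (f A) else if i \<in> A then f A else 0)"
    unfolding vf_act_eq_sum sum_apply by (intro sum.cong) auto
  also have "\<dots> = fps_X * fps_deriv (f A) + (\<Sum>i\<in>{1..n}. if i \<in> A then f A else 0)"
    by (simp add: atMost_eq_insert_0)
  also have "(\<Sum>i\<in>{1..n}. if i \<in> A then f A else 0) = (\<Sum>i\<in>A. f A)"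
    using assms(2) by (subst sum.inter_restrict [symmetric]) (auto simp: inf.absorb2)
  finally show ?thesis by simp
qed

lemma act_on_euler:
  assumes "Y \<in> W n" "i \<le> n"
  shows "vf_act n Y (euler n i) = Y i"
proof -
  have "pd k (euler n i) = (if k = i then sfun_one else 0)" if k: "k \<le> n" for k
  proof (cases "i = 0")
    case True
    then show ?thesis by (auto simp: pd_def euler_0 d_x_def d_xi_def sfun_one_def fun_eq_iff)
  next
    case False
    have "d_xi k (euler n i) = (if k = i then sfun_one else 0)" if "k \<noteq> 0"
    proof
      fix A show "d_xi k (euler n i) A = (if k = i then sfun_one else 0) A"
        using False assms(2) by (auto simp: d_xi_apply euler_Suc sfun_one_def)
    qed
    then show ?thesis using False by (auto simp: pd_def d_x_def euler_Suc fun_eq_iff)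
  qed
  then have "vf_act n Y (euler n i) = (\<Sum>k\<le>n. if k = i then Y i else 0)"
    unfolding vf_act_eq_sum
    by (intro sum.cong) (auto simp: sfun_mult_one_right[OF W_component[OF assms(1)]])
  then show ?thesis using assms by simp
qed

text \<open>The -1 in the degree comes from Y(E_i) = Y_i, the coefficients of E being the
  coordinates themselves.\<close>

lemma bracket_euler:
  assumes "Y \<in> W n"
  shows "fps_nth (vf_bracket n (euler n) Y i A) m = of_int (vf_deg 1 (\<lambda>_. 1) m A i) * fps_nth (Y i A) m"
proof (cases "i \<le> n \<and> A \<subseteq> {1..n}")
  case True
  have "vf_bracket n (euler n) Y i A = vf_act n (euler n) (Y i) A - Y i A"
    using True by (simp add: vf_bracket_apply euler_odd act_on_euler[OF assms])
  then have "fps_nth (vf_bracket n (euler n) Y i A) m =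
      fps_nth (fps_X * fps_deriv (Y i A) + fps_const (of_nat (card A)) * Y i A - Y i A) m"
    using True by (simp add: act_euler[OF W_component[OF assms]] fps_of_nat)
  then show ?thesis by (cases m) (simp_all add: euler_deg algebra_simps)
next
  case False
  then have "Y i A = 0" "vf_bracket n (euler n) Y i A = 0"
    using W_nonzero[OF assms] W_nonzero[OF W_bracket[OF euler_W assms]] by blast+
  then show ?thesis by simp
qed

section \<open>Openness and continuity in terms of the Euler filtration\<close>

section \<open>The formal topology\<close>

lemma open_fps_contains:
  fixes f :: "complex fps"
  assumes "open U" "f \<in> U"
  shows "\<exists>N. \<forall>g. (\<forall>m<N. fps_nth g m = fps_nth f m) \<longrightarrow> g \<in> U"
proof -
  obtain e where e: "e > 0" "\<And>g. dist g f < e \<Longrightarrow> g \<in> U"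
    using assms by (auto simp: open_dist)
  obtain N where N: "inverse (2 ^ N) < e"
    using real_arch_pow_inv[OF e(1), of "1/2"] by (auto simp: power_one_over inverse_eq_divide)
  have "g \<in> U" if g: "\<forall>m<N. fps_nth g m = fps_nth f m" for g
  proof (cases "g = f")
    case False
    then have "subdegree (g - f) \<ge> N" using g by (intro subdegree_geI) auto
    then have "inverse ((2::real) ^ subdegree (g - f)) \<le> inverse (2 ^ N)"
      by (intro le_imp_inverse_le power_increasing) auto
    moreover have "dist g f = inverse (2 ^ subdegree (g - f))" using False by (simp only: dist_fps_def if_False)
    ultimately have "dist g f < e" using N by linarith
    then show ?thesis by (rule e)
  qed (use assms in simp)
  then show ?thesis by blast
qed

lemma open_fun_contains:
  fixes x :: "'a \<Rightarrow> 'b::topological_space"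
  assumes "open U" "x \<in> U"
  obtains V where "\<And>i. open (V i)" "\<And>i. x i \<in> V i" "\<And>y. (\<And>i. y i \<in> V i) \<Longrightarrow> y \<in> U"
proof -
  have "openin (product_topology (\<lambda>i. euclidean) UNIV) U" using assms by (simp add: open_fun_def)
  from product_topology_open_contains_basis[OF this assms(2)]
  obtain V where V: "x \<in> (\<Pi>\<^sub>E i\<in>UNIV. V i)" "\<And>i. open (V i)" "(\<Pi>\<^sub>E i\<in>UNIV. V i) \<subseteq> U" by auto
  show thesis by (rule that[of V]) (use V in auto)
qed

text \<open>A neighbourhood bounds each coefficient to its own order. Only finitely many pairs (i,
  A) occur in \<open>W n\<close>, so the maximum of these orders serves for all.\<close>

lemma open_vfield_contains:
  assumes "open T" "X \<in> T" "X \<in> W n"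
  shows "\<exists>N. \<forall>Y\<in>W n. Y - X \<in> EF n N \<longrightarrow> Y \<in> T"
proof -
  obtain V where V: "\<And>i. open (V i)" "\<And>i. X i \<in> V i" "\<And>Y. (\<And>i. Y i \<in> V i) \<Longrightarrow> Y \<in> T"
    using open_fun_contains[OF assms(1,2)] by blast
  have "\<forall>i. \<exists>U. (\<forall>A. open (U A)) \<and> (\<forall>A. X i A \<in> U A) \<and> (\<forall>y. (\<forall>A. y A \<in> U A) \<longrightarrow> y \<in> V i)"
    using open_fun_contains[OF V(1) V(2)] by metis
  then obtain U where U: "\<And>i A. open (U i A)" "\<And>i A. X i A \<in> U i A" "\<And>i y. (\<And>A. y A \<in> U i A) \<Longrightarrow> y \<in> V i"
    by metis
  have "\<forall>i A. \<exists>N. \<forall>g. (\<forall>m<N. fps_nth g m = fps_nth (X i A) m) \<longrightarrow> g \<in> U i A"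
    using open_fps_contains[OF U(1) U(2)] by blast
  then obtain N where N: "\<And>i A g. (\<forall>m<N i A. fps_nth g m = fps_nth (X i A) m) \<Longrightarrow> g \<in> U i A" by metis
  define M where "M = Max ((\<lambda>(i, A). N i A) ` ({..n} \<times> Pow {1..n}))"
  have M: "N i A \<le> M" if "i \<le> n" "A \<subseteq> {1..n}" for i A
    unfolding M_def using that by (intro Max_ge) auto
  \<comment> \<open>A term has degree m + card A - 1 with card A at most n, so degree at least M + n
    forces m > M.\<close>
  have "Y \<in> T" if Y: "Y \<in> W n" "Y - X \<in> EF n (int M + int n)" for Y
  proof (rule V(3), rule U(3))
    fix i A
    show "Y i A \<in> U i A"
    proof (cases "i \<le> n \<and> A \<subseteq> {1..n}")
      case True
      have "card A \<le> n" using card_mono[of "{1..n}" A] True by simp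
      then have "fps_nth (Y i A) m = fps_nth (X i A) m" if "m < M" for m
        using VF_deg[OF Y(2), of i A m] that by (fastforce simp: euler_deg)
      moreover have "N i A \<le> M" using True by (intro M) auto
      ultimately show ?thesis by (intro N) auto
    next
      case False
      then have "Y i A = X i A" using W_nonzero[OF Y(1)] W_nonzero[OF assms(3)] by metis
      then show ?thesis using U(2) by simp
    qed
  qed
  then show ?thesis by blast
qed

lemma open_coeff: "open {f :: complex fps. fps_nth f m = c}"
  unfolding open_dist
proof (intro ballI exI conjI allI impI)
  fix f g :: "complex fps" assume f: "f \<in> {f. fps_nth f m = c}" and d: "dist g f < inverse (2 ^ m)"
  have "fps_nth (g - f) m = 0"
  proof (cases "g = f")
    case False
    then have "(2::real) ^ m < 2 ^ subdegree (g - f)" using d by (simp add: dist_fps_def)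
    then have "m < subdegree (g - f)" by simp
    then show ?thesis by (rule nth_less_subdegree_zero)
  qed simp
  then show "g \<in> {f. fps_nth f m = c}" using f by simp
qed simp

lemma open_vfield_nbhd:
  assumes "X \<in> W n"
  shows "\<exists>T. open T \<and> X \<in> T \<and> (\<forall>Y\<in>W n \<inter> T. Y - X \<in> EF n N)"
proof -
  define I where "I = {..n} \<times> Pow {1..n} \<times> {..nat (N + 1)}"
  define T where "T = (\<Inter>(i, A, m)\<in>I. {Y :: vfield. fps_nth (Y i A) m = fps_nth (X i A) m})"
  have "open {Y :: vfield. fps_nth (Y i A) m = c}" for i A m c
  proof -
    have "continuous_on UNIV (\<lambda>Y :: vfield. Y i A)"
      by (rule continuous_on_product_then_coordinatewise) simp
    from open_vimage[OF open_coeff[of m c] this] show ?thesis by (simp add: vimage_def)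
  qed
  then have "open T" unfolding T_def I_def by (intro open_INT) auto
  moreover have "Y - X \<in> EF n N" if Y: "Y \<in> W n" "Y \<in> T" for Y
    unfolding VF_def
  proof safe
    show "Y - X \<in> W n" using Y assms by (intro vf.subspace_diff W_subspace)
    fix i A m assume h: "fps_nth ((Y - X) i A) m \<noteq> 0"
    then have "(Y - X) i A \<noteq> 0" by auto
    then have "i \<le> n" "A \<subseteq> {1..n}" using W_nonzero[OF \<open>Y - X \<in> W n\<close>] by blast+
    then have "m > nat (N + 1)" using h Y(2) by (force simp: T_def I_def)
    then show "N \<le> vf_deg 1 (\<lambda>_. 1) m A i" by (simp add: euler_deg)
  qed
  moreover have "X \<in> T" unfolding T_def by (simp add: split_def)
  ultimately show ?thesis by (intro exI[of _ T] conjI ballI) simp_all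
qed

lemma continuous_on_EF:
  assumes "L \<subseteq> W n" "\<And>X Y. X \<in> L \<Longrightarrow> Y \<in> L \<Longrightarrow> D (Y - X) = D Y - D X" "\<And>X. X \<in> L \<Longrightarrow> D X \<in> W n"
    "\<And>X Y. X \<in> L \<Longrightarrow> Y \<in> L \<Longrightarrow> Y - X \<in> L"
    "\<And>N. \<exists>M. \<forall>Z\<in>L. Z \<in> EF n M \<longrightarrow> D Z \<in> EF n N"
  shows "continuous_on L D"
  unfolding continuous_on_topological
proof safe
  fix X B assume X: "X \<in> L" and B: "open B" "D X \<in> B"
  obtain N where N: "\<forall>Y\<in>W n. Y - D X \<in> EF n N \<longrightarrow> Y \<in> B"
    using open_vfield_contains[OF B assms(3)[OF X]] by metis
  obtain M where M: "\<forall>Z\<in>L. Z \<in> EF n M \<longrightarrow> D Z \<in> EF n N" using assms(5) by blast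
  have "X \<in> W n" using assms(1) X by blast
  from open_vfield_nbhd[OF this] obtain T where T: "open T" "X \<in> T" "\<forall>Y\<in>W n \<inter> T. Y - X \<in> EF n M"
    by metis
  have "D Y \<in> B" if Y: "Y \<in> L" "Y \<in> T" for Y
  proof -
    have "Y - X \<in> EF n M" using Y T(3) assms(1) by blast
    then have "D (Y - X) \<in> EF n N" using M assms(4)[OF X Y(1)] by blast
    then show ?thesis using N assms(2)[OF X Y(1)] assms(3)[OF Y(1)] by simp
  qed
  then show "\<exists>A. open A \<and> X \<in> A \<and> (\<forall>y\<in>L. y \<in> A \<longrightarrow> D y \<in> B)" using T by blast
qed

text \<open>Openness of subalgebras is used below only in this form.\<close>

lemma openin_subspace_iff:
  assumes "L \<subseteq> W n" "vf.subspace L" "vf.subspace K" "K \<subseteq> L"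
  shows "openin (top_of_set L) K \<longleftrightarrow> (\<exists>N. L \<inter> EF n N \<subseteq> K)"
proof
  assume "openin (top_of_set L) K"
  then obtain T where T: "open T" "K = L \<inter> T" by (auto simp: openin_open)
  have "0 \<in> T" using T(2) vf.subspace_0[OF assms(3)] by simp
  from open_vfield_contains[OF T(1) this vf.subspace_0[OF W_subspace[of n]]]
  obtain N where N: "\<forall>Y\<in>W n. Y - 0 \<in> EF n N \<longrightarrow> Y \<in> T" by metis
  have "L \<inter> EF n N \<subseteq> K" unfolding T(2) using N assms(1) by auto
  then show "\<exists>N. L \<inter> EF n N \<subseteq> K" by blast
next
  assume "\<exists>N. L \<inter> EF n N \<subseteq> K"
  then obtain N where N: "L \<inter> EF n N \<subseteq> K" by blast
  show "openin (top_of_set L) K"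
  proof (subst openin_subopen, safe)
    fix X assume X: "X \<in> K"
    then have XL: "X \<in> L" using assms(4) by blast
    then have "X \<in> W n" using assms(1) by blast
    from open_vfield_nbhd[OF this] obtain T where T: "open T" "X \<in> T" "\<forall>Y\<in>W n \<inter> T. Y - X \<in> EF n N"
      by metis
    have "L \<inter> T \<subseteq> K"
    proof
      fix Y assume Y: "Y \<in> L \<inter> T"
      then have "Y - X \<in> L" by (intro vf.subspace_diff[OF assms(2)] XL) simp
      moreover have "Y - X \<in> EF n N" using Y T(3) assms(1) by blast
      ultimately have "Y - X \<in> K" using N by blast
      then show "Y \<in> K" using vf.subspace_add[OF assms(3) _ X, of "Y - X"] by simp
    qed
    then show "\<exists>T. openin (top_of_set L) T \<and> X \<in> T \<and> T \<subseteq> K"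
      using T(1,2) XL by (intro exI[of _ "L \<inter> T"]) (simp add: openin_open_Int)
  qed
qed

section \<open>Finite exponentials of even fields, and continuous superderivations\<close>

section \<open>Automorphisms and derivations of S(1,n)\<close>

text \<open>
  Here \<open>h k i j\<close> is to be thought of as \<open>D\<^sup>k (D\<^sup>i a \<cdot> D\<^sup>j b)\<close> for a derivation \<open>D\<close> of some bilinear product.
\<close>

lemma binomial_step:
  fixes h :: "nat \<Rightarrow> nat \<Rightarrow> nat \<Rightarrow> vfield"
  assumes "\<And>k i j. h (Suc k) i j = h k (Suc i) j + h k i (Suc j)"
  shows "h k i j = (\<Sum>l\<le>k. vf_scale (of_nat (k choose l)) (h 0 (i + (k - l)) (j + l)))"
proof (induction k arbitrary: i j)
  case 0
  show "h 0 i j = (\<Sum>l\<le>0. vf_scale (of_nat (0 choose l)) (h 0 (i + (0 - l)) (j + l)))" by simp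
next
  case (Suc k)
  define f where "f l = h 0 (i + (Suc k - l)) (j + l)" for l
  have "h (Suc k) i j = (\<Sum>l\<le>k. vf_scale (of_nat (k choose l)) (f l)) +
      (\<Sum>l\<le>k. vf_scale (of_nat (k choose l)) (f (Suc l)))"
    unfolding assms[of k] Suc f_def
    by (intro arg_cong2[of _ _ _ _ "(+)"] sum.cong) (auto simp: Suc_diff_le)
  also have "(\<Sum>l\<le>k. vf_scale (of_nat (k choose l)) (f l)) =
      (\<Sum>l\<le>Suc k. vf_scale (of_nat (k choose l)) (f l))"
    by (simp add: binomial_eq_0)
  also have "\<dots> = f 0 + (\<Sum>l\<le>k. vf_scale (of_nat (k choose Suc l)) (f (Suc l)))"
    unfolding sum.atMost_Suc_shift by simp
  also have "\<dots> + (\<Sum>l\<le>k. vf_scale (of_nat (k choose l)) (f (Suc l))) =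
      f 0 + (\<Sum>l\<le>k. vf_scale (of_nat (Suc k choose Suc l)) (f (Suc l)))"
    by (simp add: vf.scale_left_distrib sum.distrib add_ac)
  also have "\<dots> = (\<Sum>l\<le>Suc k. vf_scale (of_nat (Suc k choose l)) (f l))"
    unfolding sum.atMost_Suc_shift by simp
  finally show "h (Suc k) i j =
      (\<Sum>l\<le>Suc k. vf_scale (of_nat (Suc k choose l)) (h 0 (i + (Suc k - l)) (j + l)))"
    unfolding f_def .
qed

text \<open>Multiplicativity of the exponential of a derivation: the binomial formula gives the sum
  over the triangle i + j < 2M, and the terms outside the square i, j < M vanish. It is applied to
  brackets, to inverses and to conjugation of operators.\<close>

lemma exponential_step:
  fixes h :: "nat \<Rightarrow> nat \<Rightarrow> nat \<Rightarrow> vfield"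
  assumes "\<And>k i j. h (Suc k) i j = h k (Suc i) j + h k i (Suc j)"
    and "\<And>i j. i \<ge> M \<or> j \<ge> M \<Longrightarrow> h 0 i j = 0"
  shows "(\<Sum>k<2 * M. vf_scale (1 / fact k) (h k 0 0)) =
    (\<Sum>i<M. \<Sum>j<M. vf_scale (1 / (fact i * fact j)) (h 0 i j))"
proof -
  define g where "g i j = vf_scale (1 / (fact i * fact j)) (h 0 j i)" for i j
  have "vf_scale (1 / fact k) (h k 0 0) = (\<Sum>l\<le>k. g l (k - l))" for k
    unfolding binomial_step[of h k 0 0, OF assms(1)] vf.scale_sum_right
  proof (rule sum.cong [OF refl])
    fix l assume l: "l \<in> {..k}"
    then have "1 / fact k * of_nat (k choose l) = (1 / (fact l * fact (k - l)) :: complex)"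
      by (simp add: binomial_fact)
    then show "vf_scale (1 / fact k) (vf_scale (of_nat (k choose l)) (h 0 (0 + (k - l)) (0 + l))) = g l (k - l)"
      by (simp add: g_def)
  qed
  then have "(\<Sum>k<2 * M. vf_scale (1 / fact k) (h k 0 0)) = (\<Sum>k<2 * M. \<Sum>l\<le>k. g l (k - l))"
    by simp
  also have "\<dots> = (\<Sum>(i, j)\<in>{(i, j). i + j < 2 * M}. g i j)"
    by (rule sum.triangle_reindex [symmetric])
  also have "\<dots> = (\<Sum>(i, j)\<in>{..<M} \<times> {..<M}. g i j)"
  proof (rule sum.mono_neutral_right)
    show "finite {(i, j). i + j < 2 * M}"
      by (rule finite_subset[of _ "{..<2 * M} \<times> {..<2 * M}"]) auto
    show "\<forall>x\<in>{(i, j). i + j < 2 * M} - {..<M} \<times> {..<M}. (case x of (i, j) \<Rightarrow> g i j) = 0"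
      using assms(2) by (auto simp: g_def not_less)
  qed auto
  also have "\<dots> = (\<Sum>i<M. \<Sum>j<M. g i j)" by (simp add: sum.cartesian_product)
  also have "\<dots> = (\<Sum>i<M. \<Sum>j<M. g j i)" by (rule sum.swap)
  finally show ?thesis by (simp add: g_def mult.commute)
qed

text \<open>
  The exponential is only applied to the admissible \<open>Z\<close> below: \<open>ad Z\<close> raises a degree with values in
  \<open>{-1..n}\<close>, hence the series stops after \<open>n + 2\<close> terms.
\<close>

definition nilp :: "nat \<Rightarrow> nat" where
  "nilp n = n + 2"

definition exv :: "nat \<Rightarrow> vfield \<Rightarrow> complex \<Rightarrow> vfield \<Rightarrow> vfield" where
  "exv n Z t X = (\<Sum>k<nilp n. vf_scale (t ^ k / fact k) ((vf_bracket n Z ^^ k) X))"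

lemma ad_pow_add: "(vf_bracket n Z ^^ k) (X + Y) = (vf_bracket n Z ^^ k) X + (vf_bracket n Z ^^ k) Y"
  by (induction k) (simp_all only: funpow.simps id_apply o_apply vf_bracket_add_right)

lemma ad_pow_scale: "(vf_bracket n Z ^^ k) (vf_scale c X) = vf_scale c ((vf_bracket n Z ^^ k) X)"
  by (induction k) (simp_all only: funpow.simps id_apply o_apply vf_bracket_scale_right)

lemma ad_pow_zero: "(vf_bracket n Z ^^ k) 0 = 0"
  using ad_pow_scale[of k n Z 0 0] by simp

lemma ad_pow_sum: "(vf_bracket n Z ^^ k) (\<Sum>i\<in>I. f i) = (\<Sum>i\<in>I. (vf_bracket n Z ^^ k) (f i))"
  using sum_comp_morphism[of "vf_bracket n Z ^^ k" f I] by (simp add: o_def ad_pow_add ad_pow_zero)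

lemma even_eq_self: "vf_odd Z = 0 \<Longrightarrow> vf_even Z = Z"
  using even_plus_odd[of Z] by simp

lemma ad_pow_even:
  assumes "vf_odd Z = 0"
  shows "vf_even ((vf_bracket n Z ^^ k) X) = (vf_bracket n Z ^^ k) (vf_even X)"
proof (induction k)
  case (Suc k)
  then show "vf_even ((vf_bracket n Z ^^ Suc k) X) = (vf_bracket n Z ^^ Suc k) (vf_even X)"
    by (simp add: vf_even_bracket even_eq_self[OF assms] assms)
qed simp

text \<open>J is the set of odd variables counted with degree 1, all other variables having degree
  0. It varies: a single \<xi>_i for linear substitutions, the last k variables for the
  straightening.\<close>

definition adm :: "nat \<Rightarrow> vfield \<Rightarrow> bool" where
  "adm n Z \<longleftrightarrow> Z \<in> S n \<and> vf_odd Z = 0 \<and> (\<exists>J \<subseteq> {1..n}. Z \<in> VF n 0 (\<lambda>j. if j \<in> J then 1 else 0) 1)"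

lemma vf_deg_indicator:
  assumes "J \<subseteq> {1..n}" "finite A"
  shows "vf_deg 0 (\<lambda>j. if j \<in> J then 1 else 0) m A i \<ge> -1"
    "vf_deg 0 (\<lambda>j. if j \<in> J then 1 else 0) m A i \<le> int (card J)"
proof -
  have *: "(\<Sum>j\<in>A. if j \<in> J then 1 else 0 :: int) = int (card (A \<inter> J))"
    using assms(2) by (simp add: sum.inter_restrict [symmetric])
  have "card (A \<inter> J) \<le> card J"
    using assms finite_subset by (intro card_mono) auto
  then show "vf_deg 0 (\<lambda>j. if j \<in> J then 1 else 0) m A i \<ge> -1"
    "vf_deg 0 (\<lambda>j. if j \<in> J then 1 else 0) m A i \<le> int (card J)"
    by (auto simp: vf_deg_def *)
qed

lemma VF_indicator_zero:
  assumes "J \<subseteq> {1..n}" "X \<in> VF n 0 (\<lambda>j. if j \<in> J then 1 else 0) d" "d > int (card J)"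
  shows "X = 0"
proof -
  have "fps_nth (X i A) m = 0" for i A m
  proof (rule ccontr)
    assume h: "fps_nth (X i A) m \<noteq> 0"
    then have "X i A \<noteq> 0" by auto
    then have "finite A" using W_nonzero[OF VF_W[OF assms(2)]] by blast
    then show False
      using VF_deg[OF assms(2) h] vf_deg_indicator(2)[OF assms(1), of A m i] assms(3) by linarith
  qed
  then show ?thesis by (simp add: fun_eq_iff fps_eq_iff)
qed

lemma VF_indicator_W:
  assumes "J \<subseteq> {1..n}" "X \<in> W n"
  shows "X \<in> VF n 0 (\<lambda>j. if j \<in> J then 1 else 0) (-1)"
  unfolding VF_def
proof safe
  fix i A m assume "fps_nth (X i A) m \<noteq> 0"
  then have "X i A \<noteq> 0" by auto
  then have "finite A" using W_nonzero[OF assms(2)] by blast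
  then show "- 1 \<le> vf_deg 0 (\<lambda>j. if j \<in> J then 1 else 0) m A i"
    using vf_deg_indicator(1)[OF assms(1)] by blast
qed (rule assms(2))

lemma adm_nilpotent:
  assumes "adm n Z" "X \<in> W n" "k \<ge> nilp n"
  shows "(vf_bracket n Z ^^ k) X = 0"
proof -
  obtain J where J: "J \<subseteq> {1..n}" "Z \<in> VF n 0 (\<lambda>j. if j \<in> J then 1 else 0) 1"
    using assms(1) by (auto simp: adm_def)
  have "(vf_bracket n Z ^^ l) X \<in> VF n 0 (\<lambda>j. if j \<in> J then 1 else 0) (int l - 1)" for l
  proof (induction l)
    case 0
    show "(vf_bracket n Z ^^ 0) X \<in> VF n 0 (\<lambda>j. if j \<in> J then 1 else 0) (int 0 - 1)"
      using VF_indicator_W[OF J(1) assms(2)] by simp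
  next
    case (Suc l)
    show "(vf_bracket n Z ^^ Suc l) X \<in> VF n 0 (\<lambda>j. if j \<in> J then 1 else 0) (int (Suc l) - 1)"
      using VF_bracket[OF J(2) Suc] by simp
  qed
  moreover have "card J \<le> n" using card_mono[OF _ J(1)] by simp
  ultimately show ?thesis using VF_indicator_zero[OF J(1), of "(vf_bracket n Z ^^ k) X" "int k - 1"] assms(3)
    by (simp add: nilp_def)
qed

lemma exv_add: "exv n Z t (X + Y) = exv n Z t X + exv n Z t Y"
  by (simp add: exv_def ad_pow_add vf.scale_right_distrib sum.distrib)

lemma exv_scale: "exv n Z t (vf_scale c X) = vf_scale c (exv n Z t X)"
  by (simp add: exv_def ad_pow_scale vf.scale_sum_right mult.commute)

lemma exv_even: "vf_odd Z = 0 \<Longrightarrow> vf_even (exv n Z t X) = exv n Z t (vf_even X)"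
proof -
  assume Z: "vf_odd Z = 0"
  have "vf_even (\<Sum>i\<in>I. f i) = (\<Sum>i\<in>I. vf_even (f i))" for f :: "nat \<Rightarrow> vfield" and I
    using sum_comp_morphism[of vf_even f I] by (simp add: o_def vf_even_add)
  then show ?thesis by (simp add: exv_def vf_even_scale ad_pow_even[OF Z])
qed

lemma exv_inverse:
  assumes "adm n Z" "X \<in> W n"
  shows "exv n Z t (exv n Z (- t) X) = X"
proof -
  define T where "T = vf_bracket n Z"
  \<comment> \<open>The recursion holds with 0 for k > 0 because t^(i+1) (-t)^j and t^i (-t)^(j+1)
    cancel; on the left of \<open>exponential_step\<close> only X is then left.\<close>
  define h where "h k i j = (if k = 0 then vf_scale (t ^ i * (- t) ^ j) ((T ^^ (i + j)) X) else 0)" for k i j :: nat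
  have "(\<Sum>k<2 * nilp n. vf_scale (1 / fact k) (h k 0 0)) =
    (\<Sum>i<nilp n. \<Sum>j<nilp n. vf_scale (1 / (fact i * fact j)) (h 0 i j))"
  proof (rule exponential_step)
    show "h (Suc k) i j = h k (Suc i) j + h k i (Suc j)" for k i j
      by (simp add: h_def flip: vf.scale_left_distrib)
    show "h 0 i j = 0" if "i \<ge> nilp n \<or> j \<ge> nilp n" for i j
      using adm_nilpotent[OF assms, of "i + j"] that by (auto simp: h_def T_def)
  qed
  also have "\<dots> = exv n Z t (exv n Z (- t) X)"
    by (simp add: exv_def h_def ad_pow_sum ad_pow_scale vf.scale_sum_right funpow_add T_def)
  also have "(\<Sum>k<2 * nilp n. vf_scale (1 / fact k) (h k 0 0)) = (\<Sum>k<2 * nilp n. if k = 0 then X else 0)"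
    by (intro sum.cong) (auto simp: h_def)
  also have "\<dots> = X"
    by (subst sum.delta) (auto simp: nilp_def)
  finally show ?thesis by (rule sym)
qed

lemma vf_bracket_sum_left: "vf_bracket n (\<Sum>i\<in>I. f i) Y = (\<Sum>i\<in>I. vf_bracket n (f i) Y)"
  using sum_comp_morphism[of "\<lambda>X. vf_bracket n X Y" f I] by (simp add: o_def vf_bracket_add_left)

lemma vf_bracket_sum_right: "vf_bracket n X (\<Sum>i\<in>I. f i) = (\<Sum>i\<in>I. vf_bracket n X (f i))"
  using sum_comp_morphism[of "vf_bracket n X" f I] by (simp add: o_def vf_bracket_add_right)

lemma exv_longer:
  assumes "adm n Z" "X \<in> W n"
  shows "exv n Z t X = (\<Sum>k<2 * nilp n. vf_scale (t ^ k / fact k) ((vf_bracket n Z ^^ k) X))"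
  unfolding exv_def
  by (rule sum.mono_neutral_left) (use adm_nilpotent[OF assms] in auto)

text \<open>By the Jacobi identity ad Z is an even derivation, and the exponential of a derivation
  is an automorphism.\<close>

lemma exv_bracket:
  assumes "adm n Z" "X \<in> W n" "Y \<in> W n"
  shows "exv n Z t (vf_bracket n X Y) = vf_bracket n (exv n Z t X) (exv n Z t Y)"
proof -
  define T where "T = vf_bracket n Z"
  have Z: "vf_odd Z = 0" using assms(1) by (simp add: adm_def)
  define h where "h k i j = vf_scale (t ^ (k + i + j)) ((T ^^ k) (vf_bracket n ((T ^^ i) X) ((T ^^ j) Y)))" for k i j
  have "(\<Sum>k<2 * nilp n. vf_scale (1 / fact k) (h k 0 0)) =
    (\<Sum>i<nilp n. \<Sum>j<nilp n. vf_scale (1 / (fact i * fact j)) (h 0 i j))"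
  proof (rule exponential_step)
    fix k i j
    have "(T ^^ Suc k) (vf_bracket n ((T ^^ i) X) ((T ^^ j) Y)) =
      (T ^^ k) (T (vf_bracket n ((T ^^ i) X) ((T ^^ j) Y)))" by (simp add: funpow_swap1)
    then show "h (Suc k) i j = h k (Suc i) j + h k i (Suc j)"
      by (simp add: h_def T_def jacobi_even[OF Z] ad_pow_add vf.scale_right_distrib)
  next
    fix i j assume "i \<ge> nilp n \<or> j \<ge> nilp n"
    then show "h 0 i j = 0"
      using adm_nilpotent[OF assms(1,2), of i] adm_nilpotent[OF assms(1,3), of j] by (auto simp: h_def T_def)
  qed
  also have "\<dots> = vf_bracket n (exv n Z t X) (exv n Z t Y)"
    by (subst sum.swap) (simp add: exv_def h_def vf_bracket_sum_left vf_bracket_sum_right vf_bracket_linear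
        vf.scale_sum_right power_add T_def mult.commute)
  also have "(\<Sum>k<2 * nilp n. vf_scale (1 / fact k) (h k 0 0)) = exv n Z t (vf_bracket n X Y)"
    by (simp add: exv_longer[OF assms(1) W_bracket[OF assms(2,3)]] h_def T_def)
  finally show ?thesis by simp
qed

lemma S_S0: "n \<ge> 1 \<Longrightarrow> X \<in> S n \<longleftrightarrow> X \<in> W n \<and> vf_div n X = 0 \<and> X 0 {1..n} = 0"
  by (simp add: S_eq_S0 S0_def S'_def)

lemma S_W: "n \<ge> 1 \<Longrightarrow> X \<in> S n \<Longrightarrow> X \<in> W n"
  by (simp add: S_S0)

lemma S_subspace: "vf.subspace (S n)"
  by (simp add: S_def)

lemma S_bracket: "n \<ge> 1 \<Longrightarrow> X \<in> S n \<Longrightarrow> Y \<in> S n \<Longrightarrow> vf_bracket n X Y \<in> S n"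
  by (simp add: S_eq_S0 S0_bracket)

lemma S_even: "n \<ge> 1 \<Longrightarrow> X \<in> S n \<Longrightarrow> vf_even X \<in> S n"
  using S'_even[of X n] by (auto simp: S_eq_S0 S0_def vf_even_def)

lemma S_odd: "n \<ge> 1 \<Longrightarrow> X \<in> S n \<Longrightarrow> vf_odd X \<in> S n"
  unfolding vf_odd_def by (intro vf.subspace_diff S_subspace S_even)

lemma S_ad_pow: "n \<ge> 1 \<Longrightarrow> Z \<in> S n \<Longrightarrow> X \<in> S n \<Longrightarrow> (vf_bracket n Z ^^ k) X \<in> S n"
  by (induction k) (simp_all add: S_bracket)

lemma ad_pow_EF: "Z \<in> W n \<Longrightarrow> X \<in> EF n d \<Longrightarrow> (vf_bracket n Z ^^ k) X \<in> EF n (d - int k)"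
proof (induction k)
  case (Suc k)
  then show "(vf_bracket n Z ^^ Suc k) X \<in> EF n (d - int (Suc k))"
    using VF_bracket[OF W_EF[OF Suc.prems(1)] Suc.IH] by (simp add: algebra_simps)
qed simp

text \<open>Describes continuous even endomorphisms; invertibility enters through the second map in
  \<open>aut_pair\<close>.\<close>

definition autm :: "nat \<Rightarrow> vf_op \<Rightarrow> bool" where
  "autm n u \<longleftrightarrow> (\<forall>X\<in>S n. u X \<in> S n \<and> vf_even (u X) = u (vf_even X)) \<and>
     (\<forall>X\<in>S n. \<forall>Y\<in>S n. u (X + Y) = u X + u Y \<and> u (vf_bracket n X Y) = vf_bracket n (u X) (u Y)) \<and>
     (\<forall>c. \<forall>X\<in>S n. u (vf_scale c X) = vf_scale c (u X)) \<and> continuous_on (S n) u"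

lemma continuous_on_S:
  assumes "n \<ge> 1" "\<And>X Y. X \<in> S n \<Longrightarrow> Y \<in> S n \<Longrightarrow> D (X + Y) = D X + D Y"
    "\<And>c X. X \<in> S n \<Longrightarrow> D (vf_scale c X) = vf_scale c (D X)" "\<And>X. X \<in> S n \<Longrightarrow> D X \<in> W n"
    "\<And>N X. X \<in> S n \<Longrightarrow> X \<in> EF n (N + c) \<Longrightarrow> D X \<in> EF n N"
  shows "continuous_on (S n) D"
proof (rule continuous_on_EF)
  show "S n \<subseteq> W n" using S_W[OF assms(1)] by blast
  fix X Y assume XY: "X \<in> S n" "Y \<in> S n"
  have "D (- X) = - D X" using assms(3)[OF XY(1), of "-1"] by simp
  moreover have "D (Y + (- X)) = D Y + D (- X)" using XY by (intro assms(2) vf.subspace_neg S_subspace)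
  ultimately show "D (Y - X) = D Y - D X" by simp
  show "Y - X \<in> S n" using XY by (intro vf.subspace_diff S_subspace)
next
  fix N show "\<exists>M. \<forall>Z\<in>S n. Z \<in> EF n M \<longrightarrow> D Z \<in> EF n N" using assms(5) by blast
qed (rule assms(4))

lemma exv_S: "n \<ge> 1 \<Longrightarrow> adm n Z \<Longrightarrow> X \<in> S n \<Longrightarrow> exv n Z t X \<in> S n"
  unfolding exv_def adm_def by (intro vf.subspace_sum vf.subspace_scale S_subspace S_ad_pow) auto

lemma autm_exv:
  assumes "n \<ge> 1" "adm n Z"
  shows "autm n (exv n Z t)"
proof -
  have Z: "vf_odd Z = 0" "Z \<in> W n" using assms S_W by (auto simp: adm_def)
  have "continuous_on (S n) (exv n Z t)"
  proof (rule continuous_on_S[OF assms(1)])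
    fix N X assume X: "X \<in> S n" "X \<in> EF n (N + int (nilp n))"
    show "exv n Z t X \<in> EF n N"
      unfolding exv_def
    proof (intro vf.subspace_sum[OF VF_subspace] vf.subspace_scale[OF VF_subspace])
      fix k assume "k \<in> {..<nilp n}"
      then show "(vf_bracket n Z ^^ k) X \<in> EF n N"
        by (intro VF_mono[OF _ ad_pow_EF[OF Z(2) X(2), of k]]) auto
    qed
  qed (auto simp: exv_add exv_scale intro: S_W[OF assms(1)] exv_S[OF assms])
  then show ?thesis
    using exv_bracket[OF assms(2)] S_W[OF assms(1)]
    by (simp add: autm_def exv_add exv_scale exv_even[OF Z(1)] exv_S[OF assms])
qed

section \<open>Operators on S(1,n): filtered continuity and parity components of derivations\<close>

lemma lin_mem: "linear_op_on (S n) D \<Longrightarrow> X \<in> S n \<Longrightarrow> D X \<in> S n"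
  and lin_out: "linear_op_on (S n) D \<Longrightarrow> X \<notin> S n \<Longrightarrow> D X = 0"
  and lin_add: "linear_op_on (S n) D \<Longrightarrow> X \<in> S n \<Longrightarrow> Y \<in> S n \<Longrightarrow> D (X + Y) = D X + D Y"
  and lin_scale: "linear_op_on (S n) D \<Longrightarrow> X \<in> S n \<Longrightarrow> D (vf_scale c X) = vf_scale c (D X)"
  by (simp_all add: linear_op_on_def)

lemma lin_zero: "linear_op_on (S n) D \<Longrightarrow> D 0 = 0"
  using lin_scale[of n D 0 0] vf.subspace_0[OF S_subspace] by simp

lemma lin_diff:
  assumes "linear_op_on (S n) D" "X \<in> S n" "Y \<in> S n"
  shows "D (X - Y) = D X - D Y"
proof -
  have "D (- Y) = - D Y" using lin_scale[OF assms(1,3), of "-1"] by simp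
  moreover have "D (X + (- Y)) = D X + D (- Y)"
    using assms by (intro lin_add[of n] vf.subspace_neg S_subspace)
  ultimately show ?thesis by simp
qed

lemma S_add: "X \<in> S n \<Longrightarrow> Y \<in> S n \<Longrightarrow> X + Y \<in> S n"
  and S_diff: "X \<in> S n \<Longrightarrow> Y \<in> S n \<Longrightarrow> X - Y \<in> S n"
  and S_scale: "X \<in> S n \<Longrightarrow> vf_scale c X \<in> S n"
  and S_zero [simp]: "0 \<in> S n"
  by (simp_all add: vf.subspace_add vf.subspace_diff vf.subspace_scale vf.subspace_0 S_subspace)

text \<open>For linear operators this is continuity at 0, in a form that passes at once to sums and
  composites.\<close>

definition filt_cont :: "nat \<Rightarrow> vf_op \<Rightarrow> bool" where
  "filt_cont n D \<longleftrightarrow> (\<forall>N. \<exists>M. \<forall>Z\<in>S n. Z \<in> EF n M \<longrightarrow> D Z \<in> EF n N)"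

lemma continuous_on_S_iff:
  assumes "n \<ge> 1" "linear_op_on (S n) D"
  shows "continuous_on (S n) D \<longleftrightarrow> filt_cont n D"
proof
  assume c: "continuous_on (S n) D"
  have "\<exists>M. \<forall>Z\<in>S n. Z \<in> EF n M \<longrightarrow> D Z \<in> EF n N" for N
  proof -
    obtain T where T: "open T" "0 \<in> T" "\<forall>Y\<in>W n \<inter> T. Y - 0 \<in> EF n N"
      using open_vfield_nbhd[OF vf.subspace_0[OF W_subspace[of n]], of N] by metis
    have "D 0 \<in> T" using T lin_zero[OF assms(2)] by simp
    then obtain A where A: "open A" "0 \<in> A" "\<forall>y\<in>S n. y \<in> A \<longrightarrow> D y \<in> T"
      using c[unfolded continuous_on_topological, rule_format, OF S_zero T(1)] by metis
    obtain M where M: "\<forall>Y\<in>W n. Y - 0 \<in> EF n M \<longrightarrow> Y \<in> A"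
      using open_vfield_contains[OF A(1,2) vf.subspace_0[OF W_subspace[of n]]] by metis
    have "D Z \<in> EF n N" if Z: "Z \<in> S n" "Z \<in> EF n M" for Z
    proof -
      have "Z \<in> A" using M S_W[OF assms(1) Z(1)] Z(2) by simp
      then have "D Z \<in> T" using A(3) Z(1) by blast
      moreover have "D Z \<in> W n" using lin_mem[OF assms(2) Z(1)] S_W[OF assms(1)] by blast
      ultimately show ?thesis using T(3) by (metis IntI diff_zero)
    qed
    then show ?thesis by blast
  qed
  then show "filt_cont n D" by (simp add: filt_cont_def)
next
  assume f: "filt_cont n D"
  show "continuous_on (S n) D"
  proof (rule continuous_on_EF)
    show "\<exists>M. \<forall>Z\<in>S n. Z \<in> EF n M \<longrightarrow> D Z \<in> EF n N" for N
      using f by (simp add: filt_cont_def)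
  qed (use S_W[OF assms(1)] lin_diff[OF assms(2)] lin_mem[OF assms(2)] S_diff in auto)
qed

lemma filt_cont_add:
  assumes "filt_cont n D" "filt_cont n D'"
  shows "filt_cont n (\<lambda>X. D X + D' X)"
  unfolding filt_cont_def
proof
  fix N
  obtain M M' where "\<forall>Z\<in>S n. Z \<in> EF n M \<longrightarrow> D Z \<in> EF n N" "\<forall>Z\<in>S n. Z \<in> EF n M' \<longrightarrow> D' Z \<in> EF n N"
    using assms unfolding filt_cont_def by metis
  then have "\<forall>Z\<in>S n. Z \<in> EF n (max M M') \<longrightarrow> D Z + D' Z \<in> EF n N"
    using VF_mono[of M "max M M'"] VF_mono[of M' "max M M'"]
    by (auto intro!: vf.subspace_add[OF VF_subspace])
  then show "\<exists>M. \<forall>Z\<in>S n. Z \<in> EF n M \<longrightarrow> D Z + D' Z \<in> EF n N" by blast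
qed

lemma filt_cont_scale: "filt_cont n D \<Longrightarrow> filt_cont n (\<lambda>X. vf_scale c (D X))"
  unfolding filt_cont_def by (meson vf.subspace_scale[OF VF_subspace])

lemma filt_cont_diff:
  assumes "filt_cont n D" "filt_cont n D'"
  shows "filt_cont n (\<lambda>X. D X - D' X)"
  using filt_cont_add[OF assms(1) filt_cont_scale[OF assms(2), of "-1"]] by simp

lemma filt_cont_compose:
  assumes "filt_cont n D" "filt_cont n D'" "\<And>X. X \<in> S n \<Longrightarrow> D' X \<in> S n"
  shows "filt_cont n (\<lambda>X. D (D' X))"
  using assms unfolding filt_cont_def by meson

lemma filt_cont_cong: "(\<And>X. X \<in> S n \<Longrightarrow> D X = D' X) \<Longrightarrow> filt_cont n D \<Longrightarrow> filt_cont n D'"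
  unfolding filt_cont_def by metis

lemma filt_cont_even: "filt_cont n vf_even" and filt_cont_odd: "filt_cont n vf_odd"
  unfolding filt_cont_def using VF_even VF_odd by blast+

text \<open>\<open>Der\<close> tests the even and the odd part of an operator separately. Working
  with the two kinds of derivation keeps the sign rules apart and makes closure properties checkable
  one parity at a time.\<close>

definition even_der :: "nat \<Rightarrow> vf_op \<Rightarrow> bool" where
  "even_der n A \<longleftrightarrow> linear_op_on (S n) A \<and> filt_cont n A \<and> (\<forall>X\<in>S n. vf_even (A X) = A (vf_even X)) \<and>
     (\<forall>X\<in>S n. \<forall>Y\<in>S n. A (vf_bracket n X Y) = vf_bracket n (A X) Y + vf_bracket n X (A Y))"

definition odd_der :: "nat \<Rightarrow> vf_op \<Rightarrow> bool" where
  "odd_der n B \<longleftrightarrow> linear_op_on (S n) B \<and> filt_cont n B \<and> (\<forall>X\<in>S n. vf_even (B X) = B (vf_odd X)) \<and>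
     (\<forall>X\<in>S n. \<forall>Y\<in>S n. B (vf_bracket n X Y) = vf_bracket n (B X) Y + vf_bracket n (vf_even X - vf_odd X) (B Y))"

lemma even_der_odd:
  assumes "n \<ge> 1" "even_der n A" "X \<in> S n"
  shows "vf_odd (A X) = A (vf_odd X)"
proof -
  have "linear_op_on (S n) A" "vf_even (A X) = A (vf_even X)"
    using assms(2,3) by (auto simp: even_der_def)
  then show ?thesis using lin_diff[of n A X "vf_even X"] S_even assms by (simp add: vf_odd_def)
qed

lemma odd_der_odd:
  assumes "n \<ge> 1" "odd_der n B" "X \<in> S n"
  shows "vf_odd (B X) = B (vf_even X)"
proof -
  have "linear_op_on (S n) B" "vf_even (B X) = B (vf_odd X)"
    using assms(2,3) by (auto simp: odd_der_def)
  moreover have "X - vf_odd X = vf_even X" by (simp add: vf_odd_def)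
  ultimately show ?thesis
    using lin_diff[of n B X "vf_odd X"] S_odd assms by (metis vf_odd_def)
qed

lemma decompose_op:
  assumes "n \<ge> 1" "even_der n A" "odd_der n B"
  shows "op_even (S n) (A + B) = A" "op_odd (S n) (A + B) = B"
proof -
  have l: "linear_op_on (S n) A" "linear_op_on (S n) B" using assms by (auto simp: even_der_def odd_der_def)
  have e: "vf_even (A X) = A (vf_even X)" "vf_odd (A X) = A (vf_odd X)"
    "vf_even (B X) = B (vf_odd X)" "vf_odd (B X) = B (vf_even X)" if "X \<in> S n" for X
    using assms that by (auto simp: even_der_odd odd_der_odd) (auto simp: even_der_def odd_der_def)
  have s: "A (vf_even X) + A (vf_odd X) = A X" "B (vf_even X) + B (vf_odd X) = B X" if "X \<in> S n" for X
    using that lin_add[OF l(1), of "vf_even X" "vf_odd X"] lin_add[OF l(2), of "vf_even X" "vf_odd X"]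
      S_even[OF assms(1)] S_odd[OF assms(1)] by (simp_all add: even_plus_odd)
  show "op_even (S n) (A + B) = A"
  proof
    fix X show "op_even (S n) (A + B) X = A X"
      using S_even[OF assms(1), of X] S_odd[OF assms(1), of X] lin_out[OF l(1), of X] s(1)[of X]
      by (auto simp: op_even_def vf_even_add vf_odd_add e lin_zero[OF l(2)])
  qed
  show "op_odd (S n) (A + B) = B"
  proof
    fix X show "op_odd (S n) (A + B) X = B X"
      using S_even[OF assms(1), of X] S_odd[OF assms(1), of X] lin_out[OF l(2), of X] s(2)[of X]
      by (auto simp: op_odd_def vf_even_add vf_odd_add e lin_zero[OF l(1)])
  qed
qed

lemma lin_comb:
  assumes "linear_op_on (S n) A" "linear_op_on (S n) B"
  shows "linear_op_on (S n) (\<lambda>X. A X + B X)" "linear_op_on (S n) (\<lambda>X. A X - B X)"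
    "linear_op_on (S n) (\<lambda>X. A (B X))" "linear_op_on (S n) (\<lambda>X. vf_scale c (A X))"
  using assms lin_zero[OF assms(1)] lin_zero[OF assms(2)]
  by (simp_all add: linear_op_on_def S_add S_diff S_scale vf.scale_right_distrib
      vf.scale_right_diff_distrib algebra_simps)

lemma Der_I:
  assumes "n \<ge> 1" "even_der n A" "odd_der n B"
  shows "A + B \<in> Der n (S n)"
proof -
  have l: "linear_op_on (S n) A" "linear_op_on (S n) B" "filt_cont n A" "filt_cont n B"
    using assms by (auto simp: even_der_def odd_der_def)
  have "linear_op_on (S n) (A + B)" "filt_cont n (A + B)"
    using lin_comb(1)[OF l(1,2)] filt_cont_add[OF l(3,4)] by (simp_all add: plus_fun_def)
  then show ?thesis
    using assms(2,3) unfolding Der_def mem_Collect_eq decompose_op[OF assms] even_der_def odd_der_def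
    by (metis continuous_on_S_iff[OF assms(1)])
qed

lemma Der_E:
  assumes "n \<ge> 1" "D \<in> Der n (S n)"
  shows "even_der n (op_even (S n) D)" "odd_der n (op_odd (S n) D)" "D = op_even (S n) D + op_odd (S n) D"
    "linear_op_on (S n) D" "filt_cont n D"
proof -
  show l: "linear_op_on (S n) D" using assms(2) by (simp add: Der_def)
  then show f: "filt_cont n D" using assms continuous_on_S_iff by (simp add: Der_def)
  have eo: "vf_even X \<in> S n" "vf_odd X \<in> S n" if "X \<in> S n" for X
    using that S_even S_odd assms(1) by auto
  have "linear_op_on (S n) (op_even (S n) D)"
    unfolding linear_op_on_def op_even_def
    by (simp add: vf_even_add vf_odd_add vf_even_scale vf_odd_scale lin_add[OF l] lin_scale[OF l]
        eo lin_mem[OF l] S_add S_scale vf.scale_right_distrib)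
  moreover have "linear_op_on (S n) (op_odd (S n) D)"
    unfolding linear_op_on_def op_odd_def
    by (simp add: vf_even_add vf_odd_add vf_even_scale vf_odd_scale lin_add[OF l] lin_scale[OF l]
        eo lin_mem[OF l] S_add S_scale vf.scale_right_distrib)
  moreover have "filt_cont n (op_even (S n) D)"
    by (rule filt_cont_cong[OF _ filt_cont_add[OF
        filt_cont_compose[OF filt_cont_even filt_cont_compose[OF f filt_cont_even]]
        filt_cont_compose[OF filt_cont_odd filt_cont_compose[OF f filt_cont_odd]]]])
      (simp_all add: op_even_def eo lin_mem[OF l])
  moreover have "filt_cont n (op_odd (S n) D)"
    by (rule filt_cont_cong[OF _ filt_cont_add[OF
        filt_cont_compose[OF filt_cont_odd filt_cont_compose[OF f filt_cont_even]]
        filt_cont_compose[OF filt_cont_even filt_cont_compose[OF f filt_cont_odd]]]])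
      (simp_all add: op_odd_def eo lin_mem[OF l])
  ultimately show "even_der n (op_even (S n) D)" "odd_der n (op_odd (S n) D)"
    using assms(2) unfolding even_der_def odd_der_def
    by (auto simp: Der_def) (auto simp: op_even_def op_odd_def eo vf_even_add lin_zero[OF l])
  show "D = op_even (S n) D + op_odd (S n) D"
  proof
    fix X show "D X = (op_even (S n) D + op_odd (S n) D) X"
    proof (cases "X \<in> S n")
      case True
      have "D X = D (vf_even X) + D (vf_odd X)"
        using lin_add[OF l eo[OF True]] by (simp add: even_plus_odd)
      also have "\<dots> = (vf_even (D (vf_even X)) + vf_odd (D (vf_even X))) + (vf_even (D (vf_odd X)) + vf_odd (D (vf_odd X)))"
        by (simp only: even_plus_odd)
      finally show ?thesis using True by (simp add: op_even_def op_odd_def add_ac)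
    qed (simp add: op_even_def op_odd_def lin_out[OF l])
  qed
qed

lemma odd_der_zero: "odd_der n (\<lambda>_. 0)"
  by (auto simp: odd_der_def linear_op_on_def filt_cont_def vf.subspace_0[OF VF_subspace])

lemma even_der_add: "even_der n A \<Longrightarrow> even_der n A' \<Longrightarrow> even_der n (\<lambda>X. A X + A' X)"
  unfolding even_der_def
  by (simp add: lin_comb filt_cont_add vf_even_add vf_bracket_linear add_ac)

lemma odd_der_add: "odd_der n A \<Longrightarrow> odd_der n A' \<Longrightarrow> odd_der n (\<lambda>X. A X + A' X)"
  unfolding odd_der_def
  by (simp add: lin_comb filt_cont_add vf_even_add vf_bracket_linear add_ac)

lemma even_der_scale: "even_der n A \<Longrightarrow> even_der n (\<lambda>X. vf_scale c (A X))"
  unfolding even_der_def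
  by (simp add: lin_comb(4)[of n A A] filt_cont_scale vf_even_scale vf_bracket_linear vf.scale_right_distrib)

lemma odd_der_scale: "odd_der n A \<Longrightarrow> odd_der n (\<lambda>X. vf_scale c (A X))"
  unfolding odd_der_def
  by (simp add: lin_comb(4)[of n A A] filt_cont_scale vf_even_scale vf_bracket_linear vf.scale_right_distrib)

lemma even_even_commutator:
  assumes n: "n \<ge> 1" and A: "even_der n A" "even_der n A'"
  shows "even_der n (\<lambda>X. A (A' X) - A' (A X))"
proof -
  have l: "linear_op_on (S n) A" "linear_op_on (S n) A'" "filt_cont n A" "filt_cont n A'"
    and m: "\<And>X. X \<in> S n \<Longrightarrow> A X \<in> S n" "\<And>X. X \<in> S n \<Longrightarrow> A' X \<in> S n"
    using A by (auto simp: even_der_def lin_mem)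
  show ?thesis
    using A n m unfolding even_der_def
    by (simp add: lin_comb lin_add[OF l(1)] lin_add[OF l(2)] filt_cont_diff filt_cont_compose vf_even_diff
        S_bracket S_even vf_bracket_linear)
qed

lemma vf_bracket_minus: "vf_bracket n (- X) Y = - vf_bracket n X Y" "vf_bracket n X (- Y) = - vf_bracket n X Y"
  using vf_bracket_diff_left[of n 0 X Y] vf_bracket_diff_right[of n X 0 Y] by simp_all

lemma odd_odd_commutator:
  assumes n: "n \<ge> 1" and A: "odd_der n A" "odd_der n A'"
  shows "even_der n (\<lambda>X. A (A' X) + A' (A X))"
proof -
  \<comment> \<open>The parity automorphism. Odd operators anticommute with it, so the mixed terms
    of A A' and A' A applied to a bracket cancel.\<close>
  define sg :: vf_op where "sg X = vf_even X - vf_odd X" for X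
  have l: "linear_op_on (S n) A" "linear_op_on (S n) A'" "filt_cont n A" "filt_cont n A'"
    and m: "\<And>X. X \<in> S n \<Longrightarrow> A X \<in> S n" "\<And>X. X \<in> S n \<Longrightarrow> A' X \<in> S n"
    using A by (auto simp: odd_der_def lin_mem)
  have e: "vf_even (A X) = A (vf_odd X)" "vf_even (A' X) = A' (vf_odd X)" if "X \<in> S n" for X
    using that A by (auto simp: odd_der_def)
  have o: "vf_odd (A X) = A (vf_even X)" "vf_odd (A' X) = A' (vf_even X)" if "X \<in> S n" for X
    using that n A by (simp_all add: odd_der_odd)
  have s: "sg (sg X) = X" "X \<in> S n \<Longrightarrow> sg X \<in> S n" "X \<in> S n \<Longrightarrow> A (sg X) = - sg (A X)"
    "X \<in> S n \<Longrightarrow> A' (sg X) = - sg (A' X)" for X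
    by (simp_all add: sg_def vf_even_diff vf_odd_diff even_plus_odd S_diff S_even[OF n] S_odd[OF n] e o
        lin_diff[OF l(1)] lin_diff[OF l(2)])
  have b: "A (vf_bracket n X Y) = vf_bracket n (A X) Y + vf_bracket n (sg X) (A Y)"
    "A' (vf_bracket n X Y) = vf_bracket n (A' X) Y + vf_bracket n (sg X) (A' Y)"
    if "X \<in> S n" "Y \<in> S n" for X Y
    using that A by (auto simp: odd_der_def sg_def)
  show ?thesis
    unfolding even_der_def
  proof (intro conjI ballI)
    fix X Y assume XY: "X \<in> S n" "Y \<in> S n"
    then show "A (A' (vf_bracket n X Y)) + A' (A (vf_bracket n X Y)) =
      vf_bracket n (A (A' X) + A' (A X)) Y + vf_bracket n X (A (A' Y) + A' (A Y))"
      by (simp add: b s m lin_add[OF l(1)] lin_add[OF l(2)] S_bracket[OF n] vf_bracket_linear vf_bracket_minus)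
  qed (use l in \<open>simp_all add: lin_comb filt_cont_add filt_cont_compose m vf_even_add e o S_even[OF n] S_odd[OF n]\<close>)
qed

lemma even_odd_commutator:
  assumes n: "n \<ge> 1" and A: "even_der n A" "odd_der n B"
  shows "odd_der n (\<lambda>X. A (B X) - B (A X))"
proof -
  have l: "linear_op_on (S n) A" "linear_op_on (S n) B" "filt_cont n A" "filt_cont n B"
    and m: "\<And>X. X \<in> S n \<Longrightarrow> A X \<in> S n" "\<And>X. X \<in> S n \<Longrightarrow> B X \<in> S n"
    using A by (auto simp: odd_der_def even_der_def lin_mem)
  have o: "vf_odd (A X) = A (vf_odd X)" "vf_odd (B X) = B (vf_even X)" if "X \<in> S n" for X
    using that n A by (simp_all add: odd_der_odd even_der_odd)
  show ?thesis
    using A n m unfolding even_der_def odd_der_def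
    by (simp add: lin_comb lin_add[OF l(1)] lin_add[OF l(2)] lin_diff[OF l(1)] lin_diff[OF l(2)] filt_cont_diff
        filt_cont_compose vf_even_add vf_even_diff vf_odd_diff o S_bracket S_even S_odd S_diff vf_bracket_linear)
qed

lemma Der_bracket:
  assumes n: "n \<ge> 1" and D: "D \<in> Der n (S n)" "D' \<in> Der n (S n)"
  shows "op_bracket (S n) D D' \<in> Der n (S n)"
proof -
  define A B A' B' where d: "A = op_even (S n) D" "B = op_odd (S n) D" "A' = op_even (S n) D'" "B' = op_odd (S n) D'"
  have p: "even_der n A" "odd_der n B" "even_der n A'" "odd_der n B'" "D = A + B" "D' = A' + B'"
    using Der_E[OF n D(1)] Der_E[OF n D(2)] by (simp_all add: d)
  have l: "linear_op_on (S n) A" "linear_op_on (S n) A'" "linear_op_on (S n) B" "linear_op_on (S n) B'"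
    using p by (auto simp: odd_der_def even_der_def)
  \<comment> \<open>The correction 2 D'_1 D_1 in \<open>op_bracket\<close> turns the commutator of
    the odd parts into an anticommutator. Sorting by parity gives the odd part O' and the even part
    E'.\<close>
  define O' where "O' = (\<lambda>X. (A (B' X) - B' (A X)) + vf_scale (-1) (A' (B X) - B (A' X)))"
  define E' where "E' = (\<lambda>X. (A (A' X) - A' (A X)) + (B (B' X) + B' (B X)))"
  have "op_bracket (S n) D D' X = (E' + O') X" for X
  proof (cases "X \<in> S n")
    case True
    have "vf_scale 2 Y = Y + Y" for Y
      using vf.scale_left_distrib[of 1 1 Y] by simp
    then show ?thesis
      using True lin_mem[OF l(1)] lin_mem[OF l(2)] lin_mem[OF l(3)] lin_mem[OF l(4)]
        lin_add[OF l(1)] lin_add[OF l(2)] lin_add[OF l(3)] lin_add[OF l(4)]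
      unfolding op_bracket_def d(2,4)[symmetric] by (simp add: p(5,6) E'_def O'_def)
  next
    case False
    then show ?thesis
      unfolding op_bracket_def d(2,4)[symmetric]
      by (simp add: p(5,6) E'_def O'_def lin_out[OF l(1)] lin_out[OF l(2)] lin_out[OF l(3)] lin_out[OF l(4)]
          lin_zero[OF l(1)] lin_zero[OF l(2)] lin_zero[OF l(3)] lin_zero[OF l(4)])
  qed
  then have "op_bracket (S n) D D' = E' + O'" by (rule ext)
  moreover have "even_der n E'"
    unfolding E'_def using p by (intro even_der_add even_even_commutator odd_odd_commutator n)
  moreover have "odd_der n O'"
    unfolding O'_def using p by (intro odd_der_add odd_der_scale even_odd_commutator n)
  ultimately show ?thesis using Der_I[OF n] by simp
qed

lemma Der_add:
  assumes n: "n \<ge> 1" and D: "D \<in> Der n (S n)" "D' \<in> Der n (S n)"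
  shows "D + D' \<in> Der n (S n)"
proof -
  note E = Der_E[OF n D(1)] and E' = Der_E[OF n D(2)]
  have "D + D' = (\<lambda>X. op_even (S n) D X + op_even (S n) D' X) + (\<lambda>X. op_odd (S n) D X + op_odd (S n) D' X)"
    by (subst E(3), subst E'(3)) (simp add: fun_eq_iff)
  then show ?thesis using Der_I[OF n even_der_add[OF E(1) E'(1)] odd_der_add[OF E(2) E'(2)]] by simp
qed

lemma Der_scale:
  assumes n: "n \<ge> 1" and D: "D \<in> Der n (S n)"
  shows "op_scale c D \<in> Der n (S n)"
proof -
  note E = Der_E[OF n D]
  have "op_scale c D = (\<lambda>X. vf_scale c (op_even (S n) D X)) + (\<lambda>X. vf_scale c (op_odd (S n) D X))"
    by (subst E(3)) (simp add: fun_eq_iff op_scale_def vf_scale_def algebra_simps)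
  then show ?thesis using Der_I[OF n even_der_scale[OF E(1)] odd_der_scale[OF E(2)]] by simp
qed

lemma Der_even:
  assumes n: "n \<ge> 1" and D: "D \<in> Der n (S n)"
  shows "op_even (S n) D \<in> Der n (S n)"
  using Der_I[OF n Der_E(1)[OF n D] odd_der_zero] by (simp add: plus_fun_def)

lemma ad_op_Der:
  assumes n: "n \<ge> 1" and X: "X \<in> S n"
  shows "ad_op n (S n) X \<in> Der n (S n)"
    "vf_odd X = 0 \<Longrightarrow> op_odd (S n) (ad_op n (S n) X) = 0"
proof -
  have lin: "linear_op_on (S n) (ad_op n (S n) Z)" "filt_cont n (ad_op n (S n) Z)" if Z: "Z \<in> S n" for Z
  proof -
    show "linear_op_on (S n) (ad_op n (S n) Z)"
      using Z by (simp add: linear_op_on_def ad_op_def S_bracket[OF n] S_add S_scale vf_bracket_linear)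
    have "ad_op n (S n) Z Y \<in> EF n N" if "Y \<in> S n" "Y \<in> EF n (N + 1)" for Y N
      using VF_bracket[OF W_EF[OF S_W[OF n Z]] that(2)] that(1) by (simp add: ad_op_def)
    then show "filt_cont n (ad_op n (S n) Z)" unfolding filt_cont_def by blast
  qed
  have e: "even_der n (ad_op n (S n) (vf_even X))"
    unfolding even_der_def using lin[OF S_even[OF n X]]
    by (simp add: ad_op_def S_bracket[OF n] S_even[OF n] vf_even_bracket jacobi_even)
  have o: "odd_der n (ad_op n (S n) (vf_odd X))"
    unfolding odd_der_def using lin[OF S_odd[OF n X]]
    by (simp add: ad_op_def S_bracket[OF n] S_odd[OF n] S_even[OF n] vf_even_bracket jacobi_odd)
  have s: "ad_op n (S n) X = ad_op n (S n) (vf_even X) + ad_op n (S n) (vf_odd X)"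
    by (auto simp: fun_eq_iff[of "ad_op n (S n) X"] ad_op_def vf_bracket_add_left[symmetric] even_plus_odd)
  show "ad_op n (S n) X \<in> Der n (S n)" unfolding s by (rule Der_I[OF n e o])
  assume "vf_odd X = 0"
  then have "ad_op n (S n) (vf_odd X) = 0" by (simp add: ad_op_def fun_eq_iff[of _ "0 :: vf_op"])
  then show "op_odd (S n) (ad_op n (S n) X) = 0" using decompose_op(2)[OF n e o] s by simp
qed

section \<open>Automorphisms of Der L induced by automorphisms of L\<close>

section \<open>Conjugation of derivations\<close>

text \<open>With v inverse to u this is u D u^-1; the value 0 outside \<open>S n\<close> follows the
  convention for operators.\<close>

definition conj_op :: "nat \<Rightarrow> vf_op \<Rightarrow> vf_op \<Rightarrow> vf_op \<Rightarrow> vf_op" where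
  "conj_op n u v D = (\<lambda>X. if X \<in> S n then u (D (v X)) else 0)"

text \<open>The maps are total functions on all coefficient families, and are inverse to each other
  only on \<open>S n\<close>; so the inverse is carried along explicitly.\<close>

definition aut_pair :: "nat \<Rightarrow> vf_op \<Rightarrow> vf_op \<Rightarrow> bool" where
  "aut_pair n u v \<longleftrightarrow> autm n u \<and> autm n v \<and> (\<forall>X\<in>S n. u (v X) = X \<and> v (u X) = X)"

lemma aut_pair_sym: "aut_pair n u v \<Longrightarrow> aut_pair n v u"
  by (auto simp: aut_pair_def)

lemma autm_simps:
  assumes "autm n u"
  shows "X \<in> S n \<Longrightarrow> u X \<in> S n" "X \<in> S n \<Longrightarrow> Y \<in> S n \<Longrightarrow> u (X + Y) = u X + u Y"
    "X \<in> S n \<Longrightarrow> u (vf_scale c X) = vf_scale c (u X)"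
    "X \<in> S n \<Longrightarrow> Y \<in> S n \<Longrightarrow> u (vf_bracket n X Y) = vf_bracket n (u X) (u Y)"
    "X \<in> S n \<Longrightarrow> u (vf_even X) = vf_even (u X)"
  using assms by (auto simp: autm_def)

lemma autm_zero: "autm n u \<Longrightarrow> u 0 = 0"
  using autm_simps(3)[of n u 0 0] by simp

lemma autm_diff:
  assumes "autm n u" "X \<in> S n" "Y \<in> S n"
  shows "u (X - Y) = u X - u Y"
proof -
  have "u (- Y) = - u Y" using autm_simps(3)[OF assms(1,3), of "-1"] by simp
  moreover have "u (X + (- Y)) = u X + u (- Y)"
    by (rule autm_simps(2)[OF assms(1,2) vf.subspace_neg[OF S_subspace assms(3)]])
  ultimately show ?thesis by simp
qed

lemma autm_odd: "n \<ge> 1 \<Longrightarrow> autm n u \<Longrightarrow> X \<in> S n \<Longrightarrow> u (vf_odd X) = vf_odd (u X)"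
  using autm_diff[of n u X "vf_even X"] autm_simps(5)[of n u X] S_even[of n X] by (simp add: vf_odd_def)

lemma autm_filt_cont:
  assumes n: "n \<ge> 1" and "autm n u"
  shows "filt_cont n u"
proof -
  define D where "D X = (if X \<in> S n then u X else 0)" for X
  have "linear_op_on (S n) D"
    using autm_simps[OF assms(2)] by (simp add: linear_op_on_def D_def S_add S_scale)
  moreover have "continuous_on (S n) D"
    using assms(2) by (simp add: autm_def D_def cong: continuous_on_cong)
  ultimately have "filt_cont n D" using continuous_on_S_iff[OF n] by blast
  then show ?thesis by (rule filt_cont_cong [rotated]) (simp add: D_def)
qed

lemma conj_op_lin:
  assumes "n \<ge> 1" "aut_pair n u v" "linear_op_on (S n) D" "filt_cont n D"
  shows "linear_op_on (S n) (conj_op n u v D)" "filt_cont n (conj_op n u v D)"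
proof -
  have a: "autm n u" "autm n v" using assms(2) by (auto simp: aut_pair_def)
  show "linear_op_on (S n) (conj_op n u v D)"
    by (simp add: linear_op_on_def conj_op_def autm_simps[OF a(1)] autm_simps[OF a(2)]
        lin_mem[OF assms(3)] lin_add[OF assms(3)] lin_scale[OF assms(3)] S_add S_scale)
  have "filt_cont n (\<lambda>X. u (D (v X)))"
    by (rule filt_cont_compose[OF autm_filt_cont[OF assms(1) a(1)] filt_cont_compose[OF assms(4)
          autm_filt_cont[OF assms(1) a(2)]]])
      (simp_all add: autm_simps(1)[OF a(2)] lin_mem[OF assms(3)])
  then show "filt_cont n (conj_op n u v D)"
    by (rule filt_cont_cong [rotated]) (simp add: conj_op_def)
qed

lemma conj_op_even_der:
  assumes n: "n \<ge> 1" and "aut_pair n u v" "even_der n A"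
  shows "even_der n (conj_op n u v A)"
proof -
  have a: "autm n u" "autm n v" "\<And>X. X \<in> S n \<Longrightarrow> u (v X) = X" using assms(2) by (auto simp: aut_pair_def)
  have l: "linear_op_on (S n) A" "filt_cont n A" using assms(3) by (auto simp: even_der_def)
  have A: "A (vf_bracket n X Y) = vf_bracket n (A X) Y + vf_bracket n X (A Y)" "A (vf_even X) = vf_even (A X)"
    if "X \<in> S n" "Y \<in> S n" for X Y
    using that assms(3) by (auto simp: even_der_def)
  note m = autm_simps(1)[OF a(1)] autm_simps(1)[OF a(2)] lin_mem[OF l(1)]
  show ?thesis
    unfolding even_der_def using conj_op_lin[OF n assms(2) l]
    by (simp add: conj_op_def S_bracket[OF n] S_even[OF n] autm_simps[OF a(2)] A m autm_simps(2-5)[OF a(1)] a(3))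
qed

lemma conj_op_odd_der:
  assumes n: "n \<ge> 1" and "aut_pair n u v" "odd_der n B"
  shows "odd_der n (conj_op n u v B)"
proof -
  have a: "autm n u" "autm n v" "\<And>X. X \<in> S n \<Longrightarrow> u (v X) = X" using assms(2) by (auto simp: aut_pair_def)
  have l: "linear_op_on (S n) B" "filt_cont n B" using assms(3) by (auto simp: odd_der_def)
  have B: "B (vf_bracket n X Y) = vf_bracket n (B X) Y + vf_bracket n (vf_even X - vf_odd X) (B Y)"
    "B (vf_odd X) = vf_even (B X)"
    if "X \<in> S n" "Y \<in> S n" for X Y
    using that assms(3) by (auto simp: odd_der_def)
  note m = autm_simps(1)[OF a(1)] autm_simps(1)[OF a(2)] lin_mem[OF l(1)]
  have e: "vf_even (u Y) = u (vf_even Y)" "vf_odd (u Y) = u (vf_odd Y)" if "Y \<in> S n" for Y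
    using that by (simp_all add: autm_simps(5)[OF a(1)] autm_odd[OF n a(1)])
  have s: "u (vf_even (v X) - vf_odd (v X)) = vf_even X - vf_odd X" if "X \<in> S n" for X
    using that by (simp add: autm_diff[OF a(1)] S_even[OF n] S_odd[OF n] m a(3) flip: e)
  show ?thesis
    unfolding odd_der_def
  proof (intro conjI ballI)
    fix X Y assume XY: "X \<in> S n" "Y \<in> S n"
    then show "conj_op n u v B (vf_bracket n X Y) = vf_bracket n (conj_op n u v B X) Y +
      vf_bracket n (vf_even X - vf_odd X) (conj_op n u v B Y)"
      by (simp add: conj_op_def S_bracket[OF n] S_even[OF n] S_odd[OF n] S_diff autm_simps(4)[OF a(2)]
        B m autm_simps(2,4)[OF a(1)] a(3) s)
    show "vf_even (conj_op n u v B X) = conj_op n u v B (vf_odd X)"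
      using XY by (simp add: conj_op_def S_odd[OF n] autm_odd[OF n a(2)] e B m)
  qed (use conj_op_lin[OF n assms(2) l] in auto)
qed

lemma conj_op_add:
  assumes "aut_pair n u v" "linear_op_on (S n) D" "linear_op_on (S n) D'"
  shows "conj_op n u v (D + D') = conj_op n u v D + conj_op n u v D'"
proof -
  have a: "autm n u" "autm n v" using assms(1) by (auto simp: aut_pair_def)
  show ?thesis
    by (auto simp: conj_op_def fun_eq_iff[of _ "_ + (_ :: vf_op)"] autm_simps[OF a(1)] autm_simps[OF a(2)]
        lin_mem[OF assms(2)] lin_mem[OF assms(3)])
qed

lemma conj_op_Der:
  assumes n: "n \<ge> 1" and p: "aut_pair n u v" and D: "D \<in> Der n (S n)"
  shows "conj_op n u v D \<in> Der n (S n)"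
    "op_even (S n) (conj_op n u v D) = conj_op n u v (op_even (S n) D)"
    "op_odd (S n) (conj_op n u v D) = conj_op n u v (op_odd (S n) D)"
proof -
  note E = Der_E[OF n D]
  have l: "linear_op_on (S n) (op_even (S n) D)" "linear_op_on (S n) (op_odd (S n) D)"
    using E(1,2) by (auto simp: even_der_def odd_der_def)
  have s: "conj_op n u v D = conj_op n u v (op_even (S n) D) + conj_op n u v (op_odd (S n) D)"
    by (subst E(3)) (rule conj_op_add[OF p l])
  have *: "even_der n (conj_op n u v (op_even (S n) D))" "odd_der n (conj_op n u v (op_odd (S n) D))"
    using conj_op_even_der[OF n p E(1)] conj_op_odd_der[OF n p E(2)] by auto
  show "conj_op n u v D \<in> Der n (S n)" unfolding s by (rule Der_I[OF n *])
  show "op_even (S n) (conj_op n u v D) = conj_op n u v (op_even (S n) D)"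
    "op_odd (S n) (conj_op n u v D) = conj_op n u v (op_odd (S n) D)"
    by (simp_all add: s decompose_op[OF n *])
qed

lemma conj_op_inverse:
  assumes "aut_pair n u v" "linear_op_on (S n) D"
  shows "conj_op n v u (conj_op n u v D) = D"
proof -
  have "autm n u" using assms(1) by (auto simp: aut_pair_def)
  then show ?thesis
    using assms lin_mem[OF assms(2)] lin_out[OF assms(2)]
    by (auto simp: conj_op_def fun_eq_iff[of _ D] autm_simps(1) aut_pair_def)
qed

lemma conj_op_bracket:
  assumes n: "n \<ge> 1" and p: "aut_pair n u v" and D: "D \<in> Der n (S n)" "D' \<in> Der n (S n)"
  shows "conj_op n u v (op_bracket (S n) D D') = op_bracket (S n) (conj_op n u v D) (conj_op n u v D')"
proof -
  have a: "autm n u" "autm n v" "\<And>X. X \<in> S n \<Longrightarrow> v (u X) = X" using p by (auto simp: aut_pair_def)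
  have l: "linear_op_on (S n) D" "linear_op_on (S n) D'" "linear_op_on (S n) (op_odd (S n) D)" "linear_op_on (S n) (op_odd (S n) D')"
    using Der_E[OF n D(1)] Der_E[OF n D(2)] by (auto simp: odd_der_def)
  note m = lin_mem[OF l(1)] lin_mem[OF l(2)] lin_mem[OF l(3)] lin_mem[OF l(4)] autm_simps(1)[OF a(1)] autm_simps(1)[OF a(2)]
  have 1: "conj_op n u v F (conj_op n u v G X) = u (F (G (v X)))"
    if "X \<in> S n" "linear_op_on (S n) G" for F G X
    using that by (simp add: conj_op_def m a(3) lin_mem)
  show ?thesis
  proof
    fix X
    show "conj_op n u v (op_bracket (S n) D D') X = op_bracket (S n) (conj_op n u v D) (conj_op n u v D') X"
    proof (cases "X \<in> S n")
      case True
      then show ?thesis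
        unfolding op_bracket_def conj_op_Der(3)[OF n p D(1)] conj_op_Der(3)[OF n p D(2)]
        by (simp add: 1 l) (simp add: conj_op_def autm_simps(2,3)[OF a(1)] autm_diff[OF a(1)] m S_add S_diff S_scale)
    next
      case False
      have z: "conj_op n u v F 0 = 0" if "linear_op_on (S n) F" for F
        unfolding conj_op_def autm_zero[OF a(2)] lin_zero[OF that] autm_zero[OF a(1)] by simp
      show ?thesis
        unfolding op_bracket_def conj_op_Der(3)[OF n p D(1)] conj_op_Der(3)[OF n p D(2)]
        using False z l by (simp add: conj_op_def)
    qed
  qed
qed

text \<open>The topology on operators is pointwise convergence, so continuity in D reduces to
  continuity of u at the values D (v X).\<close>

lemma continuous_aut_conj_op:
  assumes n: "n \<ge> 1" and p: "aut_pair n u v"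
  shows "continuous_aut n (S n) (restrict (conj_op n u v) (Der n (S n)))"
proof -
  have a: "autm n u" "autm n v" "continuous_on (S n) u" using p by (auto simp: aut_pair_def autm_def)
  have p': "aut_pair n v u" by (rule aut_pair_sym[OF p])
  have "bij_betw (conj_op n u v) (Der n (S n)) (Der n (S n))"
    by (rule bij_betw_byWitness[of _ "conj_op n v u"])
      (auto simp: conj_op_inverse[OF p] conj_op_inverse[OF p'] Der_E(4)[OF n] conj_op_Der(1)[OF n p] conj_op_Der(1)[OF n p'])
  then have bij: "restrict (conj_op n u v) (Der n (S n)) \<in> Bij (Der n (S n))"
    by (simp add: Bij_def bij_betw_restrict_eq)
  have "continuous_on (Der n (S n)) (conj_op n u v)"
  proof (rule continuous_on_coordinatewise_then_product)
    fix X
    show "continuous_on (Der n (S n)) (\<lambda>D. conj_op n u v D X)"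
    proof (cases "X \<in> S n")
      case True
      have "continuous_on (Der n (S n)) (\<lambda>D. u (D (v X)))"
      proof (rule continuous_on_compose2[OF a(3)])
        show "continuous_on (Der n (S n)) (\<lambda>D. D (v X))"
          by (rule continuous_on_subset[OF continuous_on_product_coordinates]) simp
        show "(\<lambda>D. D (v X)) ` Der n (S n) \<subseteq> S n"
          using lin_mem[OF Der_E(4)[OF n]] autm_simps(1)[OF a(2) True] by auto
      qed
      then show ?thesis using True by (simp add: conj_op_def)
    qed (simp add: conj_op_def)
  qed
  then have cont: "continuous_on (Der n (S n)) (restrict (conj_op n u v) (Der n (S n)))"
    by (simp cong: continuous_on_cong)
  have "conj_op n u v (op_scale c D) = op_scale c (conj_op n u v D)" if "D \<in> Der n (S n)" for c D
    by (auto simp: conj_op_def op_scale_def fun_eq_iff[of _ "\<lambda>X. vf_scale c _"] autm_simps[OF a(1)] autm_simps[OF a(2)]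
        lin_mem[OF Der_E(4)[OF n that]])
  then show ?thesis
    unfolding continuous_aut_def
    using bij cont conj_op_add[OF p Der_E(4)[OF n] Der_E(4)[OF n]] conj_op_Der[OF n p] conj_op_bracket[OF n p]
    by (simp add: Der_add[OF n] Der_scale[OF n] Der_even[OF n] Der_bracket[OF n])
qed

section \<open>Exponentials of inner derivations and the group they generate\<close>

section \<open>Inner automorphisms\<close>

lemma lin_sum:
  assumes "linear_op_on (S n) D" "finite I" "\<And>i. i \<in> I \<Longrightarrow> f i \<in> S n"
  shows "D (\<Sum>i\<in>I. f i) = (\<Sum>i\<in>I. D (f i))"
  using assms(2,3)
proof (induction I)
  case empty
  show "D (\<Sum>i\<in>{}. f i) = (\<Sum>i\<in>{}. D (f i))" by (simp add: lin_zero[OF assms(1)])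
next
  case (insert i I)
  have "(\<Sum>i\<in>I. f i) \<in> S n" using insert by (intro vf.subspace_sum[OF S_subspace]) auto
  then have "D (f i + (\<Sum>i\<in>I. f i)) = D (f i) + (\<Sum>i\<in>I. D (f i))"
    using insert by (simp add: lin_add[OF assms(1)])
  then show "D (\<Sum>i\<in>insert i I. f i) = (\<Sum>i\<in>insert i I. D (f i))"
    using insert.hyps by simp
qed

text \<open>As Z is even, the odd correction in \<open>op_bracket\<close> is absent and the iterates
  are those of an ordinary commutator.\<close>

lemma op_pow_Suc:
  assumes n: "n \<ge> 1" and Z: "adm n Z" and D: "D \<in> Der n (S n)"
    and E: "E = (\<lambda>k. (op_bracket (S n) (ad_op n (S n) Z) ^^ k) D)"
  shows "E k \<in> Der n (S n)"
    "Y \<in> S n \<Longrightarrow> E (Suc k) Y = vf_bracket n Z (E k Y) - E k (vf_bracket n Z Y)"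
proof -
  have ZS: "Z \<in> S n" "vf_odd Z = 0" using Z by (auto simp: adm_def)
  note a = ad_op_Der[OF n ZS(1)]
  show Ek: "E k \<in> Der n (S n)"
    unfolding E by (induction k) (simp_all add: D Der_bracket[OF n a(1)])
  note l = Der_E(4)[OF n Ek]
  have z: "op_odd (S n) (E k) 0 = 0"
    using lin_zero[of n "op_odd (S n) (E k)"] Der_E(2)[OF n Ek] by (simp add: odd_der_def)
  assume Y: "Y \<in> S n"
  have "E (Suc k) Y = op_bracket (S n) (ad_op n (S n) Z) (E k) Y" by (simp add: E)
  also have "\<dots> = vf_bracket n Z (E k Y) - E k (vf_bracket n Z Y)"
    unfolding op_bracket_def a(2)[OF ZS(2)] using Y lin_mem[OF l Y] by (simp add: z ad_op_def)
  finally show "E (Suc k) Y = vf_bracket n Z (E k Y) - E k (vf_bracket n Z Y)" .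
qed

lemma ad_pow_diff: "(vf_bracket n Z ^^ k) (X - Y) = (vf_bracket n Z ^^ k) X - (vf_bracket n Z ^^ k) Y"
  using ad_pow_add[of k n Z X "vf_scale (-1) Y"] by (simp add: ad_pow_scale[of k n Z "-1" Y, simplified])

text \<open>With T = ad Z, the k-th iterated commutator is a combination of the T^i D T^j with i + j
  = k. One exponent reaches \<open>nilp n\<close> as soon as k is at least
  \<open>2 * nilp n\<close>, so the series is finite; it sums to exp(tT) D exp(-tT).\<close>

lemma op_pow_formula:
  assumes n: "n \<ge> 1" and Z: "adm n Z" and D: "D \<in> Der n (S n)" and Y: "Y \<in> S n"
    and E: "E = (\<lambda>k. (op_bracket (S n) (ad_op n (S n) Z) ^^ k) D)"
  shows "k \<ge> 2 * nilp n \<Longrightarrow> E k Y = 0"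
    "(\<Sum>k<2 * nilp n. vf_scale (t ^ k / fact k) (E k Y)) = exv n Z t (D (exv n Z (- t) Y))"
proof -
  have ZS: "Z \<in> S n" using Z by (auto simp: adm_def)
  define T where "T = vf_bracket n Z"
  \<comment> \<open>Left factors T are counted by i and right factors by j, each right factor with
    the sign of the commutator. The value s = 1 yields the vanishing, s = t the sum.\<close>
  define h where "h s k i j = vf_scale ((-1) ^ j * s ^ (k + i + j)) ((T ^^ i) (E k ((T ^^ j) Y)))" for s :: complex and k i j
  have TY: "(T ^^ j) Y \<in> S n" for j unfolding T_def by (rule S_ad_pow[OF n ZS Y])
  have l: "linear_op_on (S n) D" using Der_E(4)[OF n D] .
  have rec: "h s (Suc k) i j = h s k (Suc i) j + h s k i (Suc j)" for s k i j
  proof -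
    have "(T ^^ i) (E (Suc k) ((T ^^ j) Y)) = (T ^^ Suc i) (E k ((T ^^ j) Y)) - (T ^^ i) (E k ((T ^^ Suc j) Y))"
      unfolding op_pow_Suc(2)[OF n Z D E TY] unfolding T_def ad_pow_diff by (simp add: funpow_swap1)
    then show ?thesis by (simp add: h_def vf.scale_right_diff_distrib)
  qed
  have h0: "h s 0 i j = 0" if "i \<ge> nilp n \<or> j \<ge> nilp n" for s i j
  proof -
    have "D ((T ^^ j) Y) \<in> W n" by (rule S_W[OF n lin_mem[OF l TY]])
    then show ?thesis
      using that adm_nilpotent[OF Z, of "D ((T ^^ j) Y)" i] adm_nilpotent[OF Z S_W[OF n Y], of j]
      by (auto simp: h_def E T_def lin_zero[OF l] ad_pow_zero)
  qed
  show "E k Y = 0" if k: "k \<ge> 2 * nilp n"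
  proof -
    have "E k Y = h 1 k 0 0" by (simp add: h_def)
    also have "\<dots> = (\<Sum>l\<le>k. vf_scale (of_nat (k choose l)) (h 1 0 (0 + (k - l)) (0 + l)))"
      by (rule binomial_step) (rule rec)
    also have "\<dots> = 0"
    proof (rule sum.neutral, rule ballI)
      fix l assume "l \<in> {..k}"
      then have "0 + (k - l) \<ge> nilp n \<or> 0 + l \<ge> nilp n" using k by auto
      from h0[OF this] show "vf_scale (of_nat (k choose l)) (h 1 0 (0 + (k - l)) (0 + l)) = 0" by simp
    qed
    finally show ?thesis .
  qed
  have "(\<Sum>k<2 * nilp n. vf_scale (t ^ k / fact k) (E k Y)) = (\<Sum>k<2 * nilp n. vf_scale (1 / fact k) (h t k 0 0))"
    by (simp add: h_def)
  also have "\<dots> = (\<Sum>i<nilp n. \<Sum>j<nilp n. vf_scale (1 / (fact i * fact j)) (h t 0 i j))"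
    by (rule exponential_step) (rule rec, rule h0)
  also have "\<dots> = (\<Sum>i<nilp n. \<Sum>j<nilp n.
      vf_scale (t ^ i / fact i) ((T ^^ i) (vf_scale ((- t) ^ j / fact j) (D ((T ^^ j) Y)))))"
  proof (intro sum.cong refl)
    fix i j
    have "(- t) ^ j = (-1) ^ j * t ^ j" using power_mult_distrib[of "-1" t j] by simp
    then show "vf_scale (1 / (fact i * fact j)) (h t 0 i j) =
      vf_scale (t ^ i / fact i) ((T ^^ i) (vf_scale ((- t) ^ j / fact j) (D ((T ^^ j) Y))))"
      by (simp add: h_def E T_def ad_pow_scale power_add mult_ac)
  qed
  also have "\<dots> = exv n Z t (\<Sum>j<nilp n. vf_scale ((- t) ^ j / fact j) (D ((T ^^ j) Y)))"
    by (simp only: exv_def T_def ad_pow_sum vf.scale_sum_right)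
  also have "(\<Sum>j<nilp n. vf_scale ((- t) ^ j / fact j) (D ((T ^^ j) Y))) = D (exv n Z (- t) Y)"
    unfolding exv_def T_def[symmetric]
    by (subst lin_sum[OF l]) (simp_all add: S_scale TY lin_scale[OF l TY])
  finally show "(\<Sum>k<2 * nilp n. vf_scale (t ^ k / fact k) (E k Y)) = exv n Z t (D (exv n Z (- t) Y))" .
qed

lemma aut_pair_exv:
  assumes n: "n \<ge> 1" and Z: "adm n Z"
  shows "aut_pair n (exv n Z t) (exv n Z (- t))"
  using autm_exv[OF n Z] exv_inverse[OF Z S_W[OF n], of _ t] exv_inverse[OF Z S_W[OF n], of _ "- t"]
  by (simp add: aut_pair_def)

text \<open>All but finitely many terms vanish, so the coefficientwise limit is the finite sum
  computed in \<open>op_pow_formula\<close>.\<close>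

lemma exp_ad_adm:
  assumes n: "n \<ge> 1" and Z: "adm n Z"
  shows "exp_ad n (S n) (ad_op n (S n) Z) t = restrict (conj_op n (exv n Z t) (exv n Z (- t))) (Der n (S n))"
    "D \<in> Der n (S n) \<Longrightarrow> Y \<in> S n \<Longrightarrow> summable (exp_ad_term (S n) (ad_op n (S n) Z) t D Y i A m)"
proof -
  have fin: "exp_ad_term (S n) (ad_op n (S n) Z) t D Y i A m k = 0"
    if "D \<in> Der n (S n)" "Y \<in> S n" "k \<notin> {..<2 * nilp n}" for D Y i A m k
    using op_pow_formula(1)[OF n Z that(1,2) refl, of k] that(3) by (simp add: exp_ad_term_def)
  show "summable (exp_ad_term (S n) (ad_op n (S n) Z) t D Y i A m)" if "D \<in> Der n (S n)" "Y \<in> S n"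
    using fin[OF that] by (intro summable_finite[of "{..<2 * nilp n}"]) auto
  show "exp_ad n (S n) (ad_op n (S n) Z) t = restrict (conj_op n (exv n Z t) (exv n Z (- t))) (Der n (S n))"
    unfolding exp_ad_def
  proof (rule restrict_ext)
    fix D assume D: "D \<in> Der n (S n)"
    show "(\<lambda>Y i A. Abs_fps (\<lambda>m. \<Sum>k. exp_ad_term (S n) (ad_op n (S n) Z) t D Y i A m k)) =
      conj_op n (exv n Z t) (exv n Z (- t)) D"
    proof
      fix Y
      show "(\<lambda>i A. Abs_fps (\<lambda>m. \<Sum>k. exp_ad_term (S n) (ad_op n (S n) Z) t D Y i A m k)) =
        conj_op n (exv n Z t) (exv n Z (- t)) D Y"
      proof (cases "Y \<in> S n")
        case True
        have "fps_nth (exv n Z t (D (exv n Z (- t) Y)) i A) m =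
          (\<Sum>k. exp_ad_term (S n) (ad_op n (S n) Z) t D Y i A m k)" for i A m
        proof -
          have "(\<Sum>k. exp_ad_term (S n) (ad_op n (S n) Z) t D Y i A m k) =
            (\<Sum>k\<in>{..<2 * nilp n}. exp_ad_term (S n) (ad_op n (S n) Z) t D Y i A m k)"
            by (rule suminf_finite) (auto intro: fin[OF D True])
          then show ?thesis
            unfolding op_pow_formula(2)[OF n Z D True refl, symmetric]
            by (simp add: sum_apply fps_sum_nth exp_ad_term_def vf_scale_def)
        qed
        then show ?thesis using True by (auto simp: conj_op_def fun_eq_iff fps_eq_iff)
      next
        case False
        have "(op_bracket (S n) (ad_op n (S n) Z) ^^ k) D Y = 0" for k
          using lin_out[OF Der_E(4)[OF n op_pow_Suc(1)[OF n Z D refl]] False] by simp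
        then show ?thesis using False by (simp add: exp_ad_term_def conj_op_def fun_eq_iff fps_eq_iff)
      qed
    qed
  qed
qed

lemma exponentiable_adm:
  assumes n: "n \<ge> 1" and Z: "adm n Z"
  shows "exponentiable n (S n) (ad_op n (S n) Z)"
proof -
  have ZS: "Z \<in> S n" "vf_odd Z = 0" using Z by (auto simp: adm_def)
  show ?thesis
    unfolding exponentiable_def exp_ad_adm(1)[OF n Z]
    using ad_op_Der[OF n ZS(1)] ZS(2) exp_ad_adm(2)[OF n Z] continuous_aut_conj_op[OF n aut_pair_exv[OF n Z]]
    by simp
qed

text \<open>Needed because multiplication in \<open>BijGroup\<close> is composition only on the
  carrier.\<close>

lemma inner_auts_Bij:
  assumes "g \<in> inner_auts n L"
  shows "g \<in> Bij (Der n L)"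
proof -
  have "{exp_ad n L a 1 | a. exponentiable n L a} \<subseteq> carrier (BijGroup (Der n L))"
    by (auto simp: exponentiable_def continuous_aut_def BijGroup_def)
  from group.generate_in_carrier[OF group_BijGroup this] assms
  have "g \<in> carrier (BijGroup (Der n L))" by (simp add: inner_auts_def)
  then show ?thesis by (simp add: BijGroup_def)
qed

text \<open>Since u respects brackets, conjugating ad X yields ad (u X). Thus an inner automorphism
  of Der L moves subsets of L by u.\<close>

lemma conj_op_ad:
  assumes n: "n \<ge> 1" and p: "aut_pair n u v" and X: "X \<in> S n"
  shows "conj_op n u v (ad_op n (S n) X) = ad_op n (S n) (u X)"
proof -
  have a: "autm n u" "autm n v" "\<And>X. X \<in> S n \<Longrightarrow> u (v X) = X" using p by (auto simp: aut_pair_def)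
  show ?thesis
    using X by (auto simp: conj_op_def ad_op_def fun_eq_iff[of "\<lambda>X. if X \<in> S n then _ X else _"]
      autm_simps(1,4)[OF a(1)] autm_simps(1)[OF a(2)] a(3))
qed

text \<open>
  The last condition keeps a subalgebra invariant under \<open>B\<close> when it is moved by \<open>u\<close> or \<open>v\<close>.
\<close>

definition inner_pair :: "nat \<Rightarrow> vfield set \<Rightarrow> vf_op \<Rightarrow> vf_op \<Rightarrow> bool" where
  "inner_pair n B u v \<longleftrightarrow> aut_pair n u v \<and>
     (\<exists>g\<in>inner_auts n (S n). \<forall>X\<in>S n. g (ad_op n (S n) X) = ad_op n (S n) (u X)) \<and>
     (\<forall>T\<in>B. \<forall>X\<in>S n. vf_bracket n T (u X) = u (vf_bracket n T X) \<and> vf_bracket n T (v X) = v (vf_bracket n T X))"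

lemma inner_pair_id:
  assumes "n \<ge> 1"
  shows "inner_pair n B (\<lambda>X. X) (\<lambda>X. X)"
proof -
  have "autm n (\<lambda>X. X)" by (auto simp: autm_def S_even assms)
  moreover have "(\<lambda>D\<in>Der n (S n). D) \<in> inner_auts n (S n)"
    using generate.one[of "BijGroup (Der n (S n))"] by (simp add: inner_auts_def BijGroup_def)
  ultimately show ?thesis using ad_op_Der(1)[OF assms]
    by (auto simp: inner_pair_def aut_pair_def intro!: bexI[of _ "\<lambda>D\<in>Der n (S n). D"])
qed

lemma autm_comp:
  assumes "autm n u" "autm n u'"
  shows "autm n (\<lambda>X. u (u' X))"
proof -
  have "continuous_on (S n) (\<lambda>X. u (u' X))"
    using assms by (intro continuous_on_compose2[of "S n" u "S n" u']) (auto simp: autm_def)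
  then show ?thesis
    using assms by (simp add: autm_def)
qed

lemma inner_pair_comp:
  assumes n: "n \<ge> 1" and g: "inner_pair n B u v" "inner_pair n B u' v'"
    and B: "\<And>T X. T \<in> B \<Longrightarrow> X \<in> S n \<Longrightarrow> vf_bracket n T X \<in> S n"
  shows "inner_pair n B (\<lambda>X. u (u' X)) (\<lambda>X. v' (v X))"
proof -
  have a: "autm n u" "autm n v" "autm n u'" "autm n v'"
    using g by (auto simp: inner_pair_def aut_pair_def)
  have p: "aut_pair n (\<lambda>X. u (u' X)) (\<lambda>X. v' (v X))"
    using g autm_comp[OF a(1,3)] autm_comp[OF a(4,2)] autm_simps(1)[OF a(2)] autm_simps(1)[OF a(3)]
    by (simp add: inner_pair_def aut_pair_def)
  obtain f f' where f: "f \<in> inner_auts n (S n)" "\<And>X. X \<in> S n \<Longrightarrow> f (ad_op n (S n) X) = ad_op n (S n) (u X)"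
    and f': "f' \<in> inner_auts n (S n)" "\<And>X. X \<in> S n \<Longrightarrow> f' (ad_op n (S n) X) = ad_op n (S n) (u' X)"
    using g unfolding inner_pair_def by metis
  have "f \<otimes>\<^bsub>BijGroup (Der n (S n))\<^esub> f' \<in> inner_auts n (S n)"
    using f(1) f'(1) unfolding inner_auts_def by (rule generate.eng)
  moreover have "f \<otimes>\<^bsub>BijGroup (Der n (S n))\<^esub> f' = compose (Der n (S n)) f f'"
    using inner_auts_Bij[OF f(1)] inner_auts_Bij[OF f'(1)] by (simp add: BijGroup_def)
  ultimately have "compose (Der n (S n)) f f' \<in> inner_auts n (S n)" by simp
  moreover have "compose (Der n (S n)) f f' (ad_op n (S n) X) = ad_op n (S n) (u (u' X))" if "X \<in> S n" for X
    using that f(2) f'(2) ad_op_Der(1)[OF n that] autm_simps(1)[OF a(3) that] by (simp add: compose_def)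
  moreover have "vf_bracket n T (u (u' X)) = u (u' (vf_bracket n T X))" "vf_bracket n T (v' (v X)) = v' (v (vf_bracket n T X))"
    if "T \<in> B" "X \<in> S n" for T X
    using g that autm_simps(1)[OF a(2)] autm_simps(1)[OF a(3)] by (simp_all add: inner_pair_def)
  ultimately show ?thesis using p unfolding inner_pair_def by blast
qed

text \<open>By the Jacobi identity ad Z and ad T commute once [Z, T] = 0.\<close>

lemma exv_commute:
  assumes "vf_odd Z = 0" "vf_bracket n Z T = 0"
  shows "vf_bracket n T (exv n Z t X) = exv n Z t (vf_bracket n T X)"
proof -
  have "(vf_bracket n Z ^^ k) (vf_bracket n T X) = vf_bracket n T ((vf_bracket n Z ^^ k) X)" for k
    by (induction k) (simp_all add: jacobi_even[OF assms(1)] assms(2))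
  then show ?thesis by (simp add: exv_def vf_bracket_sum_right vf_bracket_scale_right)
qed

lemma inner_pair_exv:
  assumes n: "n \<ge> 1" and Z: "adm n Z" and B: "\<And>T. T \<in> B \<Longrightarrow> vf_bracket n Z T = 0"
  shows "inner_pair n B (exv n Z 1) (exv n Z (- 1))"
proof -
  have "exp_ad n (S n) (ad_op n (S n) Z) 1 \<in> inner_auts n (S n)"
    unfolding inner_auts_def using exponentiable_adm[OF n Z] by (intro generate.incl) blast
  moreover have "exp_ad n (S n) (ad_op n (S n) Z) 1 (ad_op n (S n) X) = ad_op n (S n) (exv n Z 1 X)"
    if "X \<in> S n" for X
    unfolding exp_ad_adm(1)[OF n Z] using ad_op_Der(1)[OF n that] conj_op_ad[OF n aut_pair_exv[OF n Z] that]
    by simp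
  moreover have "vf_odd Z = 0" using Z by (simp add: adm_def)
  ultimately show ?thesis
    unfolding inner_pair_def using aut_pair_exv[OF n Z, of 1] exv_commute[OF _ B] by blast
qed

section \<open>Open invariant subalgebras and their transport by automorphisms\<close>

section \<open>Invariant open subalgebras\<close>

text \<open>Invariance is asked only of a spanning set B: the bracket is linear in its first
  argument and K is a subspace, so the span of B preserves K as well.\<close>

definition open_inv :: "nat \<Rightarrow> vfield set \<Rightarrow> vfield set \<Rightarrow> bool" where
  "open_inv n B K \<longleftrightarrow> subalgebra_of n (S n) K \<and> K \<noteq> S n \<and> (\<exists>N. S n \<inter> EF n N \<subseteq> K) \<and>
     (\<forall>T\<in>B. \<forall>X\<in>K. vf_bracket n T X \<in> K)"

lemma open_inv_iff:
  assumes "n \<ge> 1"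
  shows "K \<in> open_inv_subalgebras n (S n) (vf.span B) \<longleftrightarrow> open_inv n B K"
proof -
  have inv: "(\<forall>T\<in>vf.span B. \<forall>X\<in>K. vf_bracket n T X \<in> K) \<longleftrightarrow> (\<forall>T\<in>B. \<forall>X\<in>K. vf_bracket n T X \<in> K)"
    if K: "vf.subspace K"
  proof
    assume "\<forall>T\<in>vf.span B. \<forall>X\<in>K. vf_bracket n T X \<in> K"
    then show "\<forall>T\<in>B. \<forall>X\<in>K. vf_bracket n T X \<in> K" by (simp add: vf.span_base)
  next
    assume h: "\<forall>T\<in>B. \<forall>X\<in>K. vf_bracket n T X \<in> K"
    have "vf.span B \<subseteq> {T. \<forall>X\<in>K. vf_bracket n T X \<in> K}"
    proof (rule vf.span_minimal)
      show "B \<subseteq> {T. \<forall>X\<in>K. vf_bracket n T X \<in> K}" using h by blast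
      show "vf.subspace {T. \<forall>X\<in>K. vf_bracket n T X \<in> K}"
        using K by (intro vf.subspaceI) (auto simp: vf_bracket_linear vf.subspace_0 intro: vf.subspace_add vf.subspace_scale)
    qed
    then show "\<forall>T\<in>vf.span B. \<forall>X\<in>K. vf_bracket n T X \<in> K" by blast
  qed
  have opn: "openin (top_of_set (S n)) K \<longleftrightarrow> (\<exists>N. S n \<inter> EF n N \<subseteq> K)"
    if "vf.subspace K" "K \<subseteq> S n"
    by (rule openin_subspace_iff[OF _ S_subspace that]) (auto intro: S_W[OF assms])
  show ?thesis
  proof (cases "subalgebra_of n (S n) K")
    case True
    then have "vf.subspace K" "K \<subseteq> S n" by (simp_all add: subalgebra_of_def)
    from inv[OF this(1)] opn[OF this] show ?thesis
      unfolding open_inv_subalgebras_def open_inv_def mem_Collect_eq by argo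
  qed (simp add: open_inv_subalgebras_def open_inv_def)
qed

lemma open_inv_transport:
  assumes n: "n \<ge> 1" and p: "aut_pair n u v" and K: "open_inv n B K"
    and c: "\<And>T X. T \<in> B \<Longrightarrow> X \<in> S n \<Longrightarrow> vf_bracket n T (v X) = v (vf_bracket n T X)"
  shows "open_inv n B (v ` K)"
proof -
  have a: "autm n u" "autm n v" "\<And>X. X \<in> S n \<Longrightarrow> v (u X) = X" "\<And>X. X \<in> S n \<Longrightarrow> u (v X) = X"
    using p by (auto simp: aut_pair_def)
  have k: "K \<subseteq> S n" "vf.subspace K" "\<And>X. X \<in> K \<Longrightarrow> vf_even X \<in> K" "\<And>X Y. X \<in> K \<Longrightarrow> Y \<in> K \<Longrightarrow> vf_bracket n X Y \<in> K"
    using K by (auto simp: open_inv_def subalgebra_of_def)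
  have KS: "X \<in> S n" if "X \<in> K" for X using that k(1) by blast
  note s = autm_simps[OF a(2)]
  have sub: "vf.subspace (v ` K)"
  proof (rule vf.subspaceI)
    show "0 \<in> v ` K" using autm_zero[OF a(2)] vf.subspace_0[OF k(2)] by (metis image_eqI)
  next
    fix x y assume "x \<in> v ` K" "y \<in> v ` K"
    then obtain X Y where "X \<in> K" "Y \<in> K" "x = v X" "y = v Y" by blast
    then have "x + y = v (X + Y)" "X + Y \<in> K" using s(2) KS vf.subspace_add[OF k(2)] by auto
    then show "x + y \<in> v ` K" by blast
  next
    fix c x assume "x \<in> v ` K"
    then obtain X where "X \<in> K" "x = v X" by blast
    then have "vf_scale c x = v (vf_scale c X)" "vf_scale c X \<in> K" using s(3) KS vf.subspace_scale[OF k(2)] by auto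
    then show "vf_scale c x \<in> v ` K" by blast
  qed
  have incl: "v ` K \<subseteq> S n" using s(1) KS by auto
  have ev: "vf_even x \<in> v ` K" if x: "x \<in> v ` K" for x
  proof -
    obtain X where X: "X \<in> K" "x = v X" using x by auto
    then have "vf_even x = v (vf_even X)" using s(5)[OF KS] by simp
    then show ?thesis using k(3)[OF X(1)] by simp
  qed
  have br: "vf_bracket n x y \<in> v ` K" if x: "x \<in> v ` K" and y: "y \<in> v ` K" for x y
  proof -
    obtain X Y where X: "X \<in> K" "x = v X" "Y \<in> K" "y = v Y" using x y by auto
    then have "vf_bracket n x y = v (vf_bracket n X Y)" using s(4)[OF KS KS] by simp
    then show ?thesis using k(4)[OF X(1,3)] by simp
  qed
  have ne: "v ` K \<noteq> S n"
  proof
    assume h: "v ` K = S n"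
    have "S n \<subseteq> K"
    proof
      fix X assume X: "X \<in> S n"
      then have "v X \<in> v ` K" using s(1) h by blast
      then obtain Y where "Y \<in> K" "v X = v Y" by blast
      then show "X \<in> K" using a(4) X KS by metis
    qed
    then show False using K k(1) by (auto simp: open_inv_def)
  qed
  have opn: "\<exists>N. S n \<inter> EF n N \<subseteq> v ` K"
  proof -
    obtain N where N: "S n \<inter> EF n N \<subseteq> K" using K by (auto simp: open_inv_def)
    obtain M where M: "\<forall>Z\<in>S n. Z \<in> EF n M \<longrightarrow> u Z \<in> EF n N"
      using autm_filt_cont[OF n a(1)] unfolding filt_cont_def by metis
    have "S n \<inter> EF n M \<subseteq> v ` K"
    proof
      fix Z assume Z: "Z \<in> S n \<inter> EF n M"
      then have "u Z \<in> K" using M N autm_simps(1)[OF a(1)] by blast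
      then show "Z \<in> v ` K" using a(3) Z by (metis IntD1 image_eqI)
    qed
    then show ?thesis by blast
  qed
  have "vf_bracket n T x \<in> v ` K" if T: "T \<in> B" and x: "x \<in> v ` K" for T x
  proof -
    obtain X where X: "X \<in> K" "x = v X" using x by auto
    then have "vf_bracket n T x = v (vf_bracket n T X)" using c[OF T KS] by simp
    moreover have "vf_bracket n T X \<in> K" using K T X(1) by (simp add: open_inv_def)
    ultimately show ?thesis by simp
  qed
  then show ?thesis using sub incl ev br ne opn by (simp add: open_inv_def subalgebra_of_def)
qed

text \<open>K lies in u G, which is again proper, open and invariant; maximality forces equality. So
  for the moved subalgebra an inclusion in G is all that has to be found.\<close>

lemma maximal_conjugate:
  assumes n: "n \<ge> 1" and K: "maximal_open_inv n (S n) (vf.span B) K"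
    and g: "inner_pair n B u v" and KG: "v ` K \<subseteq> G" and G: "open_inv n B G"
  shows "conjugate_in n (S n) G K"
proof -
  have p: "aut_pair n u v" "aut_pair n v u" using g aut_pair_sym by (auto simp: inner_pair_def)
  have GS: "G \<subseteq> S n" using G by (auto simp: open_inv_def subalgebra_of_def)
  have KO: "open_inv n B K" and max: "\<And>K'. open_inv n B K' \<Longrightarrow> K \<subseteq> K' \<Longrightarrow> K' = K"
    using K unfolding maximal_open_inv_def open_inv_iff[OF n] Ball_def by blast+
  have KS: "K \<subseteq> S n" using KO by (auto simp: open_inv_def subalgebra_of_def)
  have "open_inv n B (u ` G)"
    using g by (intro open_inv_transport[OF n p(2) G]) (auto simp: inner_pair_def)
  moreover have "K \<subseteq> u ` G"
  proof
    fix X assume X: "X \<in> K"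
    then have "v X \<in> G" "u (v X) = X" using KG KS p(1) by (auto simp: aut_pair_def)
    then show "X \<in> u ` G" by (metis image_eqI)
  qed
  ultimately have "u ` G = K" by (rule max)
  moreover obtain f where f: "f \<in> inner_auts n (S n)" "\<And>X. X \<in> S n \<Longrightarrow> f (ad_op n (S n) X) = ad_op n (S n) (u X)"
    using g unfolding inner_pair_def by metis
  have "f ` ad_op n (S n) ` G = ad_op n (S n) ` u ` G"
    unfolding image_image using f(2) GS by (intro image_cong) auto
  ultimately have "ad_op n (S n) ` K = f ` ad_op n (S n) ` G" by simp
  then show ?thesis unfolding conjugate_in_def using GS KS f(1) by blast
qed

section \<open>Graded subalgebras as filtration steps\<close>

section \<open>Graded subalgebras\<close>

text \<open>The divergence preserves degrees, so it intertwines multiplication by a function \<phi>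
  of the degree. With \<phi> an indicator this concerns homogeneous components, with \<phi> the
  identity it concerns ad E.\<close>

lemma vf_div_graded:
  assumes "\<And>i A m. finite A \<Longrightarrow> fps_nth (Y i A) m = \<phi> (vf_deg a b m A i) * fps_nth (X i A) m"
    and "finite A"
  shows "fps_nth (vf_div n Y A) m = \<phi> (a * int m + sum b A) * fps_nth (vf_div n X A) m"
proof -
  have c: "fps_nth (shuffle_sign C D * (-1) ^ k * f) m = fps_nth (shuffle_sign C D * (-1) ^ k) 0 * fps_nth f m"
    for C D k f
    using shuffle_sign_cases[of C D] by (cases "even k") auto
  have 1: "vf_deg a b (m + 1) A 0 = a * int m + sum b A" by (simp add: vf_deg_def algebra_simps)
  have 2: "vf_deg a b m (insert j A) j = a * int m + sum b A" if "j \<in> {1..n} - A" for j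
    using that assms(2) by (simp add: vf_deg_def)
  show ?thesis
    unfolding vf_div_apply fps_add_nth fps_sum_nth c fps_deriv_nth distrib_left sum_distrib_left
  proof (intro arg_cong2[of _ _ _ _ "(+)"] sum.cong refl)
    show "of_nat (m + 1) * fps_nth (Y 0 A) (m + 1) =
      \<phi> (a * int m + sum b A) * (of_nat (m + 1) * fps_nth (X 0 A) (m + 1))"
      unfolding assms(1)[OF assms(2)] 1 by (rule mult.left_commute)
    fix j assume j: "j \<in> {1..n} - A"
    have f: "finite (insert j A)" using assms(2) by simp
    show "fps_nth (shuffle_sign {j} A * (-1) ^ card (insert j A)) 0 * fps_nth (Y j (insert j A)) m =
      \<phi> (a * int m + sum b A) *
      (fps_nth (shuffle_sign {j} A * (-1) ^ card (insert j A)) 0 * fps_nth (X j (insert j A)) m)"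
      unfolding assms(1)[OF f] 2[OF j] by (rule mult.left_commute)
  qed
qed

lemma S_graded:
  assumes n: "n \<ge> 1" and X: "X \<in> S n" and Y: "Y \<in> W n"
    and "\<And>i A m. finite A \<Longrightarrow> fps_nth (Y i A) m = \<phi> (vf_deg a b m A i) * fps_nth (X i A) m"
  shows "Y \<in> S n"
proof -
  have d: "vf_div n X = 0" "X 0 {1..n} = 0" using X S_S0[OF n] by auto
  have "vf_div n Y A = 0" for A
  proof (cases "finite A")
    case True
    show ?thesis
      using vf_div_graded[of Y \<phi> a b X A n, OF assms(4) True] d(1) by (simp add: fps_eq_iff)
  next
    case False
    then show ?thesis using Lam_infinite[OF vf_div_Lam[OF Y]] by simp
  qed
  moreover have "Y 0 {1..n} = 0" using assms(4)[of "{1..n}" 0] d(2) by (simp add: fps_eq_iff)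
  ultimately show ?thesis using S_S0[OF n] Y by (simp add: fun_eq_iff)
qed

lemma vf_comp_nth: "fps_nth (vf_comp a b d X i A) m =
    (if vf_deg a b m A i = d then 1 else 0) * fps_nth (X i A) m"
  by (simp add: vf_comp_def)

lemma vf_comp_W: "X \<in> W n \<Longrightarrow> vf_comp a b d X \<in> W n"
  by (auto simp: W_def Lam_def vf_comp_def fun_eq_iff fps_eq_iff)

text \<open>Divergence and top coefficient can be tested degree by degree, so a formal sum of
  components in \<open>S n\<close> lies in \<open>S n\<close>, and conversely.\<close>

lemma graded_subalgebra_eq:
  assumes n: "n \<ge> 1"
  shows "graded_subalgebra n (S n) a b = S n \<inter> VF n a b 0"
proof (intro equalityI subsetI IntI)
  fix X assume X: "X \<in> graded_subalgebra n (S n) a b"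
  then have XW: "X \<in> W n" by (simp add: graded_subalgebra_def)
  have neg: "fps_nth (X i A) m = 0" if "vf_deg a b m A i < 0" for i A m
  proof -
    have "vf_comp a b (vf_deg a b m A i) X = 0" using X that by (simp add: graded_subalgebra_def)
    then show ?thesis using vf_comp_nth[of a b "vf_deg a b m A i" X i A m] by simp
  qed
  then show "X \<in> VF n a b 0" using XW by (auto simp: VF_def not_less[symmetric])
  have c: "vf_comp a b d X \<in> S n" for d
    using X by (cases "d \<ge> 0") (auto simp: graded_subalgebra_def not_le)
  have cd: "vf_div n (vf_comp a b d X) = 0" "vf_comp a b d X 0 {1..n} = 0" for d
    using c[of d] S_S0[OF n] by auto
  have "vf_div n X A = 0" for A
  proof (cases "finite A")
    case True
    have "fps_nth (vf_div n X A) m = 0" for m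
      using vf_div_graded[of "vf_comp a b (a * int m + sum b A) X" _ a b X A n m, OF vf_comp_nth True] cd(1)
      by simp
    then show ?thesis by (simp add: fps_eq_iff)
  qed (use Lam_infinite[OF vf_div_Lam[OF XW]] in simp)
  moreover have "fps_nth (X 0 {1..n}) m = 0" for m
    using vf_comp_nth[of a b "vf_deg a b m {1..n} 0" X 0 "{1..n}" m] cd(2) by simp
  then have "X 0 {1..n} = 0" by (simp add: fps_eq_iff)
  ultimately show "X \<in> S n" using S_S0[OF n] XW by (simp add: fun_eq_iff)
next
  fix X assume "X \<in> S n \<inter> VF n a b 0"
  then have X: "X \<in> S n" "X \<in> VF n a b 0" by auto
  have "vf_comp a b d X \<in> S n" for d
    by (rule S_graded[OF n X(1) vf_comp_W[OF S_W[OF n X(1)]] vf_comp_nth])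
  moreover have "vf_comp a b d X = 0" if "d < 0" for d
  proof -
    have "fps_nth (vf_comp a b d X i A) m = 0" for i A m
      using VF_deg[OF X(2), of i A m] that by (cases "fps_nth (X i A) m = 0") (auto simp: vf_comp_nth)
    then show ?thesis by (simp add: fun_eq_iff fps_eq_iff)
  qed
  ultimately show "X \<in> graded_subalgebra n (S n) a b"
    using S_W[OF n X(1)] by (simp add: graded_subalgebra_def)
qed

lemma euler_S:
  assumes "n \<ge> 1" "X \<in> S n"
  shows "vf_bracket n (euler n) X \<in> S n"
  by (rule S_graded[OF assms W_bracket[OF euler_W S_W[OF assms]], of of_int 1 "\<lambda>_. 1"])
    (rule bracket_euler[OF S_W[OF assms]])

lemma euler_VF: "euler n \<in> VF n a b 0"
  unfolding VF_def
proof safe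
  fix i A m assume h: "fps_nth (euler n i A) m \<noteq> 0"
  show "0 \<le> vf_deg a b m A i"
  proof (cases "i = 0")
    case True
    then show ?thesis using h by (auto simp: euler_0 vf_deg_def split: if_splits)
  next
    case False
    then have "A = {i} \<and> m = 0" using h by (auto simp: euler_Suc split: if_splits)
    then show ?thesis using False by (simp add: vf_deg_def)
  qed
qed (rule euler_W)

lemma S_monom:
  assumes "n \<ge> 1" "A \<subseteq> {1..n}" "A \<noteq> {1..n}"
  shows "vf_monom 0 A 0 \<in> S n"
proof -
  have "vf_monom 0 A 0 \<in> W n" using assms by (auto simp: W_def Lam_def vf_monom_def fun_eq_iff)
  moreover have "vf_div n (vf_monom 0 A 0) = 0"
    by (auto simp: fun_eq_iff vf_div_apply vf_monom_def intro!: sum.neutral)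
  ultimately show ?thesis using assms by (simp add: S_S0 vf_monom_def)
qed

lemma top_S': "top_vf n \<in> S' n"
proof -
  have "top_vf n \<in> W n" by (auto simp: W_def Lam_def vf_monom_def top_vf_def fun_eq_iff)
  moreover have "vf_div n (top_vf n) = 0"
    by (auto simp: fun_eq_iff vf_div_apply vf_monom_def top_vf_def intro!: sum.neutral)
  ultimately show ?thesis by (simp add: S'_def)
qed

lemma top_S: "n \<ge> 1 \<Longrightarrow> X \<in> S n \<Longrightarrow> vf_bracket n (top_vf n) X \<in> S n"
  using S'_bracket_S0[OF top_S'] by (simp add: S_eq_S0) (simp add: S0_def)

lemma top_VF: "d \<le> vf_deg a b 0 {1..n} 0 \<Longrightarrow> top_vf n \<in> VF n a b d"
  using top_S'[of n] by (auto simp: VF_def S'_def top_vf_def vf_monom_def split: if_splits)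

lemma ones_zeros_deg:
  assumes "finite A"
  shows "vf_deg 1 (ones_zeros n k) m A i = int m + int (card (A \<inter> {..n - k})) - (if i \<le> n - k then 1 else 0)"
proof -
  have "sum (ones_zeros n k) A = int (card (A \<inter> {..n - k}))"
    using assms unfolding ones_zeros_def by (simp add: sum.inter_restrict [symmetric] flip: atMost_iff)
  then show ?thesis by (simp add: vf_deg_def ones_zeros_def)
qed

text \<open>By \<open>graded_subalgebra_eq\<close>, the graded subalgebra with k zeros.\<close>

abbreviation GS :: "nat \<Rightarrow> nat \<Rightarrow> vfield set" where
  "GS n k \<equiv> S n \<inter> VF n 1 (ones_zeros n k) 0"

lemma const_vf_S: "n \<ge> 1 \<Longrightarrow> i \<le> n \<Longrightarrow> const_vf i \<in> S n"
  using const_vf_S0 by (simp add: S_eq_S0)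

lemma const_vf_GS:
  assumes "n \<ge> 1" "n - k < j" "j \<le> n"
  shows "const_vf j \<in> GS n k"
  using const_vf_S[OF assms(1,3)] const_vf_W[OF assms(3)] assms(2)
  by (auto simp: VF_def ones_zeros_deg const_vf_def vf_monom_def split: if_splits)

text \<open>For k at most n, the top field has degree n - k - 1 in this grading, which is negative
  only for k = n; the Euler field has degree 0 in every grading.\<close>

lemma open_inv_GS:
  assumes n: "n \<ge> 1" and B: "B \<subseteq> {euler n, top_vf n}" and k: "top_vf n \<in> B \<Longrightarrow> k < n"
  shows "open_inv n B (GS n k)"
  unfolding open_inv_def
proof (intro conjI ballI)
  show "subalgebra_of n (S n) (GS n k)"
    unfolding subalgebra_of_def using VF_bracket[of _ n 1 "ones_zeros n k" 0 _ 0]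
    by (simp add: vf.subspace_inter[OF S_subspace VF_subspace] S_even[OF n] VF_even S_bracket[OF n])
  have "const_vf 0 \<in> S n" using const_vf_S[OF n] by simp
  moreover have "const_vf 0 \<notin> VF n 1 (ones_zeros n k) 0"
    using VF_deg[of "const_vf 0" n 1 "ones_zeros n k" 0 0 "{}" 0]
    by (auto simp: ones_zeros_deg const_vf_apply sfun_one_def)
  ultimately show "GS n k \<noteq> S n" by blast
  \<comment> \<open>As card A is at most n, Euler degree at least n forces a factor x, and its
    weight 1 makes up for any \<partial>_i.\<close>
  have "S n \<inter> EF n (int n) \<subseteq> GS n k"
  proof
    fix X assume X: "X \<in> S n \<inter> EF n (int n)"
    have "0 \<le> vf_deg 1 (ones_zeros n k) m A i" if h: "fps_nth (X i A) m \<noteq> 0" for i A m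
    proof -
      have "X i A \<noteq> 0" using h by auto
      moreover have "X \<in> W n" using S_W[OF n] X by blast
      ultimately have A: "A \<subseteq> {1..n}" "finite A" using W_nonzero[of X n i A] by simp_all
      then have "card A \<le> n" using card_mono[of "{1..n}" A] by simp
      moreover have "int n \<le> int m + int (card A) - 1" using X h VF_deg[of X] by (force simp: euler_deg)
      ultimately have "m \<ge> 1" by linarith
      then show ?thesis by (simp add: ones_zeros_deg[OF A(2)])
    qed
    then show "X \<in> GS n k" using X S_W[OF n] by (simp add: VF_def)
  qed
  then show "\<exists>N. S n \<inter> EF n N \<subseteq> GS n k" by blast
  fix T X assume T: "T \<in> B" and X: "X \<in> GS n k"
  have "T \<in> VF n 1 (ones_zeros n k) 0"
  proof (cases "T = euler n")
    case False
    then have "T = top_vf n" "k < n" using T B k by auto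
    moreover have "{1..n} \<inter> {..n - k} = {1..n - k}" by auto
    ultimately show ?thesis by (simp, intro top_VF) (simp add: ones_zeros_deg)
  qed (simp add: euler_VF)
  then have "vf_bracket n T X \<in> VF n 1 (ones_zeros n k) 0"
    using VF_bracket[of T n 1 "ones_zeros n k" 0 X 0] X by simp
  moreover have "vf_bracket n T X \<in> S n" using T B X euler_S[OF n] top_S[OF n] by auto
  ultimately show "vf_bracket n T X \<in> GS n k" by simp
qed

section \<open>Values at the origin, and the exclusion of \<partial>/\<partial>x\<close>

section \<open>Leading terms\<close>

text \<open>The value of X at the origin. The constant fields are the terms of Euler degree -1, so
  these numbers are the obstruction to lying in \<open>EF n 0\<close>.\<close>

definition cf :: "vfield \<Rightarrow> nat \<Rightarrow> complex" where
  "cf X i = fps_nth (X i {}) 0"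

lemma cf_add: "cf (X + Y) i = cf X i + cf Y i"
  and cf_diff: "cf (X - Y) i = cf X i - cf Y i"
  and cf_scale: "cf (vf_scale c X) i = c * cf X i"
  by (simp_all add: cf_def vf_scale_def)

lemma coeff_sum: "fps_nth ((\<Sum>j\<in>I. f j) i A) m = (\<Sum>j\<in>I. fps_nth ((f j :: vfield) i A) m)"
  by (simp add: sum_apply fps_sum_nth)

lemma cf_sum: "cf (\<Sum>j\<in>I. f j) i = (\<Sum>j\<in>I. cf (f j) i)"
  by (simp add: cf_def coeff_sum)

lemma cf_const: "cf (const_vf j) i = (if i = j then 1 else 0)"
  by (simp add: cf_def const_vf_apply sfun_one_def)

lemma EF_0_iff: "X \<in> EF n 0 \<longleftrightarrow> X \<in> W n \<and> (\<forall>i\<le>n. cf X i = 0)"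
proof safe
  fix i assume "X \<in> EF n 0" "i \<le> n"
  then show "cf X i = 0" using VF_deg[of X n 1 "\<lambda>_. 1" 0 i "{}" 0] by (auto simp: cf_def euler_deg)
next
  assume X: "X \<in> W n" "\<forall>i\<le>n. cf X i = 0"
  show "X \<in> EF n 0"
    unfolding VF_def
  proof safe
    fix i A m assume h: "fps_nth (X i A) m \<noteq> 0"
    then have "X i A \<noteq> 0" by auto
    then have A: "i \<le> n" "finite A" using W_nonzero[OF X(1)] by blast+
    have "m \<noteq> 0 \<or> A \<noteq> {}" using h X(2) A(1) by (auto simp: cf_def)
    moreover have "A \<noteq> {} \<Longrightarrow> card A > 0" using A(2) by (simp add: card_gt_0_iff)
    ultimately have "1 \<le> int m + int (card A)" by linarith
    then show "0 \<le> vf_deg 1 (\<lambda>_. 1) m A i" by (simp add: euler_deg)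
  qed (rule X(1))
qed (rule VF_W)

lemma lead_decomp:
  assumes "X \<in> W n"
  shows "X - (\<Sum>r\<le>n. vf_scale (cf X r) (const_vf r)) \<in> EF n 0"
proof -
  have "(\<Sum>r\<le>n. vf_scale (cf X r) (const_vf r)) \<in> W n"
    by (intro vf.subspace_sum[OF W_subspace] vf.subspace_scale[OF W_subspace] const_vf_W) auto
  moreover have "cf (\<Sum>r\<le>n. vf_scale (cf X r) (const_vf r)) i = cf X i" if "i \<le> n" for i
    using that by (simp add: cf_sum cf_scale cf_const if_distrib[of "(*) _"] cong: if_cong)
  ultimately show ?thesis
    using assms by (simp add: EF_0_iff cf_diff vf.subspace_diff[OF W_subspace])
qed

text \<open>Modulo constant fields X has Euler degree at least 0, and that part brackets with V to
  something without value at the origin.\<close>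

lemma cf_bracket:
  assumes "X \<in> W n" "V \<in> EF n 0" "l \<le> n"
  shows "cf (vf_bracket n X V) l = (\<Sum>r\<le>n. cf X r * fps_nth (pd r (V l) {}) 0)"
proof -
  define R where "R = X - (\<Sum>r\<le>n. vf_scale (cf X r) (const_vf r))"
  have R: "R \<in> EF n 0" unfolding R_def by (rule lead_decomp[OF assms(1)])
  have "vf_bracket n R V \<in> EF n 0" using VF_bracket[OF R assms(2)] by simp
  then have "cf (vf_bracket n R V) l = 0" using assms(3) by (simp add: EF_0_iff)
  moreover have "vf_bracket n X V = (\<Sum>r\<le>n. vf_scale (cf X r) (vf_bracket n (const_vf r) V)) + vf_bracket n R V"
    by (simp add: R_def vf_bracket_diff_left vf_bracket_sum_left vf_bracket_scale_left)
  moreover have "cf (vf_bracket n (const_vf r) V) l = fps_nth (pd r (V l) {}) 0" if "r \<le> n" for r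
    by (simp add: bracket_const_vf[OF that VF_W[OF assms(2)]] cf_def)
  ultimately show ?thesis by (simp add: cf_add cf_sum cf_scale)
qed

lemma open_invD:
  assumes "open_inv n B K"
  shows "K \<subseteq> S n" "vf.subspace K" "\<And>X. X \<in> K \<Longrightarrow> vf_even X \<in> K"
    "\<And>X Y. X \<in> K \<Longrightarrow> Y \<in> K \<Longrightarrow> vf_bracket n X Y \<in> K"
    "\<And>T X. T \<in> B \<Longrightarrow> X \<in> K \<Longrightarrow> vf_bracket n T X \<in> K" "K \<noteq> S n"
  using assms by (simp_all add: open_inv_def subalgebra_of_def)

lemma open_inv_no_dx:
  assumes n: "n \<ge> 1" and K: "open_inv n B K" and X: "X \<in> K"
  shows "cf X 0 = 0"
proof (rule ccontr)
  assume nz: "cf X 0 \<noteq> 0"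
  note k = open_invD[OF K]
  define c where "c = cf X 0"
  \<comment> \<open>An even field has no \<partial>/\<partial>\<xi>_j at the origin, so the leading
    term of X' is exactly c \<partial>/\<partial>x.\<close>
  define X' where "X' = vf_even X"
  have X': "X' \<in> K" using k(3) X by (simp add: X'_def)
  then have X'S: "X' \<in> S n" using k(1) by blast
  define R where "R = X' - vf_scale c (const_vf 0)"
  have RS: "R \<in> S n" unfolding R_def by (intro S_diff S_scale X'S const_vf_S[OF n]) simp
  have "cf X' i = (if i = 0 then c else 0)" for i
    by (simp add: X'_def cf_def vf_even_def c_def)
  then have "cf R i = 0" if "i \<le> n" for i
    by (simp add: R_def cf_diff cf_scale cf_const)
  then have R: "R \<in> EF n 0" using S_W[OF n RS] by (simp add: EF_0_iff)
  obtain N where N: "S n \<inter> EF n N \<subseteq> K" using K by (auto simp: open_inv_def)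
  \<comment> \<open>Writing V = [\<partial>/\<partial>x, Y] with Y one degree higher gives c V =
    [X', Y] - [R, Y]. Both brackets lie in K, the second one because R does not lower
    degrees.\<close>
  have "S n \<inter> EF n (N - int d) \<subseteq> K" for d
  proof (induction d)
    case 0 then show ?case using N by simp
  next
    case (Suc d)
    show ?case
    proof
      fix V assume V: "V \<in> S n \<inter> EF n (N - int (Suc d))"
      then have V0: "V \<in> S0 n" using S_eq_S0[OF n] by simp
      obtain Y where Y: "Y \<in> S0 n" "Y \<in> EF n (N - int d)" "vf_bracket n (const_vf 0) Y = V"
        using S0_integrate[OF V0, of "N - int (Suc d)"] V by auto
      have YS: "Y \<in> S n" using Y(1) S_eq_S0[OF n] by simp
      have YK: "Y \<in> K" using Suc YS Y(2) by blast
      have "vf_bracket n R Y \<in> S n \<inter> EF n (N - int d)"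
        using VF_bracket[OF R Y(2)] S_bracket[OF n RS YS] by simp
      then have "vf_bracket n R Y \<in> K" using Suc by blast
      moreover have "vf_bracket n X' Y \<in> K" by (rule k(4)[OF X' YK])
      ultimately have "vf_bracket n X' Y - vf_bracket n R Y \<in> K" by (rule vf.subspace_diff[OF k(2), rotated])
      moreover have "vf_bracket n X' Y - vf_bracket n R Y = vf_scale c V"
        by (simp add: R_def vf_bracket_linear Y(3))
      ultimately have "vf_scale c V \<in> K" by simp
      from vf.subspace_scale[OF k(2) this, of "1 / c"] show "V \<in> K" using nz by (simp add: c_def)
    qed
  qed
  from this[of "nat (N + 1)"] have "S n \<subseteq> K"
    using VF_mono[OF _ W_EF[OF S_W[OF n]], of "N - int (nat (N + 1))"] by auto
  then show False using k(1,6) by blast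
qed

section \<open>Excluding terms of degree -1 by their size; maximality and the Euler case\<close>

section \<open>Successive approximation\<close>

text \<open>
  The gradings of type \<open>(e | e, \<dots>, e, 1, \<dots>, 1)\<close> with \<open>k\<close> ones interpolate between the Euler grading
  and, for large \<open>e\<close>, the grading of type \<open>(1 | 1, \<dots>, 1, 0, \<dots>, 0)\<close>.
\<close>

definition bw :: "nat \<Rightarrow> nat \<Rightarrow> nat \<Rightarrow> nat \<Rightarrow> int" where
  "bw n k e j = (if j \<le> n - k then int e else 1)"

text \<open>The terms \<xi>_A \<partial>_i in question are precisely those of degree -1 in the
  grading with k zeros; e bounds the size of A up to which they are known to be absent.\<close>

definition lowfree :: "nat \<Rightarrow> nat \<Rightarrow> nat \<Rightarrow> vfield \<Rightarrow> bool" where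
  "lowfree n k e X \<longleftrightarrow> (\<forall>i\<le>n - k. \<forall>A\<subseteq>{n - k<..n}. card A < e \<longrightarrow> fps_nth (X i A) 0 = 0)"

lemma lowfreeD:
  "lowfree n k e X \<Longrightarrow> i \<le> n - k \<Longrightarrow> A \<subseteq> {n - k<..n} \<Longrightarrow> card A < e \<Longrightarrow> fps_nth (X i A) 0 = 0"
  by (simp add: lowfree_def)

abbreviation PF :: "nat \<Rightarrow> nat \<Rightarrow> nat \<Rightarrow> vfield set" where
  "PF n k e \<equiv> VF n (int e) (bw n k e) 0"

lemma bw_deg:
  assumes "finite A"
  shows "vf_deg (int e) (bw n k e) m A i =
    int e * int m + int e * int (card (A \<inter> {..n - k})) + int (card (A \<inter> {n - k<..}))
    - (if i \<le> n - k then int e else 1)"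
proof -
  have "sum (bw n k e) A = sum (bw n k e) (A \<inter> {..n - k}) + sum (bw n k e) (A \<inter> {n - k<..})"
    using assms by (subst sum.union_disjoint [symmetric]) (auto intro!: arg_cong[of _ _ "sum (bw n k e)"])
  also have "sum (bw n k e) (A \<inter> {..n - k}) = (\<Sum>j\<in>A \<inter> {..n - k}. int e)"
    by (intro sum.cong) (auto simp: bw_def)
  also have "sum (bw n k e) (A \<inter> {n - k<..}) = (\<Sum>j\<in>A \<inter> {n - k<..}. 1)"
    by (intro sum.cong) (auto simp: bw_def)
  finally show ?thesis by (simp add: vf_deg_def bw_def)
qed

lemma bw_deg_low:
  assumes "A \<subseteq> {n - k<..n}"
  shows "vf_deg (int e) (bw n k e) 0 A i = int (card A) - (if i \<le> n - k then int e else 1)"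
proof -
  have "finite A" using assms finite_subset by blast
  moreover have "A \<inter> {..n - k} = {}" "A \<inter> {n - k<..} = A" using assms by auto
  ultimately show ?thesis by (simp add: bw_deg)
qed

text \<open>In this grading a factor x or a low \<xi> has weight e and pays for any \<partial>_i.
  Negative degree is left to the terms in \<open>lowfree\<close> and to the constant \<partial>_j
  with j > n - k. Unlike \<open>lowfree\<close>, the filtration step \<open>PF\<close> is closed
  under brackets.\<close>

lemma VF_bw_iff:
  assumes e: "e \<ge> 1" and d: "d = 0 \<or> d = 1"
  shows "X \<in> VF n (int e) (bw n k e) d \<Longrightarrow> lowfree n k (e + nat d) X \<and> (\<forall>i. n - k < i \<longrightarrow> cf X i = 0)"
    "d = 0 \<Longrightarrow> X \<in> W n \<Longrightarrow> lowfree n k e X \<Longrightarrow> (\<And>i. n - k < i \<Longrightarrow> i \<le> n \<Longrightarrow> cf X i = 0) \<Longrightarrow> X \<in> PF n k e"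
proof -
  assume X: "X \<in> VF n (int e) (bw n k e) d"
  have "fps_nth (X i A) 0 = 0" if "i \<le> n - k" "A \<subseteq> {n - k<..n}" "card A < e + nat d" for i A
    using VF_deg[OF X, of i A 0] that d by (cases "fps_nth (X i A) 0 = 0") (auto simp: bw_deg_low)
  moreover have "cf X i = 0" if "n - k < i" for i
    using VF_deg[OF X, of i "{}" 0] that d by (cases "fps_nth (X i {}) 0 = 0") (auto simp: bw_deg_low cf_def)
  ultimately show "lowfree n k (e + nat d) X \<and> (\<forall>i. n - k < i \<longrightarrow> cf X i = 0)"
    by (simp add: lowfree_def)
next
  assume X: "X \<in> W n" "lowfree n k e X" "\<And>i. n - k < i \<Longrightarrow> i \<le> n \<Longrightarrow> cf X i = 0"
  show "X \<in> PF n k e"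
    unfolding VF_def
  proof safe
    fix i A m assume h: "fps_nth (X i A) m \<noteq> 0"
    then have "X i A \<noteq> 0" by auto
    then have A: "i \<le> n" "A \<subseteq> {1..n}" "finite A" using W_nonzero[OF X(1)] by blast+
    show "0 \<le> vf_deg (int e) (bw n k e) m A i"
    proof (cases "m = 0 \<and> A \<subseteq> {n - k<..n}")
      case True
      show ?thesis
      proof (cases "i \<le> n - k")
        case i: True
        then have "e \<le> card A" using lowfreeD[OF X(2) i, of A] h True by (metis not_le)
        then show ?thesis using True i by (simp add: bw_deg_low)
      next
        case False
        then have "cf X i = 0" by (intro X(3) A(1)) simp
        then have "A \<noteq> {}" using h True by (auto simp: cf_def)
        then have "card A \<ge> 1" using A(3) by (simp add: Suc_le_eq card_gt_0_iff)
        then show ?thesis using True False by (simp add: bw_deg_low)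
      qed
    next
      case False
      have "1 \<le> m + card (A \<inter> {..n - k})"
      proof (cases "m = 0")
        case True
        then have "A \<inter> {..n - k} \<noteq> {}" using False A(2) by (auto simp: subset_iff not_less)
        then show ?thesis using A(3) by (simp add: Suc_le_eq card_gt_0_iff)
      qed simp
      then have "int e * 1 \<le> int e * int (m + card (A \<inter> {..n - k}))"
        by (intro mult_left_mono) auto
      then show ?thesis using e by (simp add: bw_deg[OF A(3)] distrib_left)
    qed
  qed (rule X(1))
qed

lemma lowfree_mono: "lowfree n k e X \<Longrightarrow> e' \<le> e \<Longrightarrow> lowfree n k e' X"
  by (auto simp: lowfree_def)

lemma lowfree_add: "lowfree n k e X \<Longrightarrow> lowfree n k e Y \<Longrightarrow> lowfree n k e (X + Y)"
  and lowfree_diff: "lowfree n k e X \<Longrightarrow> lowfree n k e Y \<Longrightarrow> lowfree n k e (X - Y)"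
  and lowfree_scale: "lowfree n k e X \<Longrightarrow> lowfree n k e (vf_scale c X)"
  by (auto simp: lowfree_def vf_scale_def)

lemma lowfree_sum: "(\<And>j. j \<in> I \<Longrightarrow> lowfree n k e (f j)) \<Longrightarrow> lowfree n k e (\<Sum>j\<in>I. f j)"
  by (auto simp: lowfree_def coeff_sum intro!: sum.neutral)

lemma lowfree_const: "n - k < j \<Longrightarrow> lowfree n k e (const_vf j)"
  by (auto simp: lowfree_def const_vf_def vf_monom_def)

lemma PF_Suc: "e \<ge> 1 \<Longrightarrow> X \<in> PF n k (Suc e) \<Longrightarrow> X \<in> PF n k e"
  using VF_bw_iff(1)[of "Suc e" 0 X n k] lowfree_mono[of n k "Suc e" X e]
  by (intro VF_bw_iff(2)[of e 0]) (auto dest: VF_W)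

text \<open>Degree 1 for weight e rules out the terms of size e too. This links the gradings for e
  and e + 1.\<close>

lemma VF_bw_1: "e \<ge> 1 \<Longrightarrow> X \<in> VF n (int e) (bw n k e) 1 \<Longrightarrow> X \<in> PF n k (Suc e)"
  using VF_bw_iff(1)[of e 1 X n k] by (intro VF_bw_iff(2)[of "Suc e" 0]) (auto dest: VF_W)

text \<open>The constant \<partial>_j are the only terms of negative degree left in X; subtracting
  multiples of the Y_j removes them without creating others.\<close>

lemma remove_leads:
  assumes X: "X \<in> W n" and e: "e \<ge> 1" and Y: "\<And>j. n - k < j \<Longrightarrow> j \<le> n \<Longrightarrow> Y j - const_vf j \<in> PF n k e"
    and low: "lowfree n k e X"
  shows "X - (\<Sum>j\<in>{n - k<..n}. vf_scale (cf X j) (Y j)) \<in> PF n k e"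
proof (rule VF_bw_iff(2)[OF e, of 0])
  define U where "U = (\<Sum>j\<in>{n - k<..n}. vf_scale (cf X j) (Y j))"
  have Yd: "Y j = const_vf j + (Y j - const_vf j)" for j by simp
  have YW: "Y j \<in> W n" if "n - k < j" "j \<le> n" for j
    by (subst Yd) (intro vf.subspace_add[OF W_subspace] const_vf_W VF_W[OF Y] that)
  have "U \<in> W n" unfolding U_def
    by (intro vf.subspace_sum[OF W_subspace] vf.subspace_scale[OF W_subspace] YW) auto
  then show "X - (\<Sum>j\<in>{n - k<..n}. vf_scale (cf X j) (Y j)) \<in> W n"
    unfolding U_def by (intro vf.subspace_diff[OF W_subspace] X)
  have "lowfree n k e (Y j)" if "n - k < j" "j \<le> n" for j
    using VF_bw_iff(1)[OF e _ Y[OF that]] lowfree_add[OF lowfree_const[OF that(1)], of e "Y j - const_vf j"] by simp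
  then show "lowfree n k e (X - (\<Sum>j\<in>{n - k<..n}. vf_scale (cf X j) (Y j)))"
    by (intro lowfree_diff low lowfree_sum lowfree_scale) auto
  fix i assume i: "n - k < i" "i \<le> n"
  have "cf (Y j) i = (if i = j then 1 else 0)" if "n - k < j" "j \<le> n" for j
    using VF_bw_iff(1)[OF e _ Y[OF that]] i(1) cf_diff[of "Y j" "const_vf j" i] by (simp add: cf_const)
  then have "cf U i = (\<Sum>j\<in>{n - k<..n}. if i = j then cf X j else 0)"
    unfolding U_def cf_sum by (intro sum.cong) (auto simp: cf_scale)
  then show "cf (X - (\<Sum>j\<in>{n - k<..n}. vf_scale (cf X j) (Y j))) i = 0"
    using i by (simp add: cf_diff U_def)
qed simp_all

text \<open>After subtraction of the leads, X' lies in \<open>PF n k e\<close>. For A of size e and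
  j in A, the bracket [Y_j, X'] lies in K and has no term of size e - 1, and neither has
  [Y_j - \<partial>_j, X']; so the coefficient at A vanishes. Accuracy e + 1 of the Y_j is used when
  the leads are added back.\<close>

lemma lowfree_step:
  assumes n: "n \<ge> 1" and K: "open_inv n B K" and e: "e \<ge> 1" and low: "\<And>X. X \<in> K \<Longrightarrow> lowfree n k e X"
    and Y: "\<And>j. n - k < j \<Longrightarrow> j \<le> n \<Longrightarrow> Y j \<in> K \<and> Y j - const_vf j \<in> PF n k (Suc e)"
    and X: "X \<in> K"
  shows "lowfree n k (Suc e) X"
proof -
  note kk = open_invD[OF K]
  have W: "V \<in> W n" if "V \<in> K" for V using that kk(1) S_W[OF n] by blast
  have Ye: "Y j - const_vf j \<in> PF n k e" if "n - k < j" "j \<le> n" for j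
    using Y[OF that] PF_Suc[OF e] by blast
  define U where "U = (\<Sum>j\<in>{n - k<..n}. vf_scale (cf X j) (Y j))"
  define X' where "X' = X - U"
  have UK: "U \<in> K" unfolding U_def using Y by (intro vf.subspace_sum[OF kk(2)] vf.subspace_scale[OF kk(2)]) auto
  have X'K: "X' \<in> K" unfolding X'_def by (rule vf.subspace_diff[OF kk(2) X UK])
  have X'P: "X' \<in> PF n k e" unfolding X'_def U_def by (rule remove_leads[OF W[OF X] e Ye low[OF X]])
  have "lowfree n k (Suc e) (Y j)" if "n - k < j" "j \<le> n" for j
  proof -
    have "lowfree n k (Suc e) (Y j - const_vf j)" using VF_bw_iff(1)[of "Suc e" 0 "Y j - const_vf j"] Y[OF that] by simp
    from lowfree_add[OF lowfree_const[OF that(1), of "Suc e"] this] show ?thesis by simp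
  qed
  then have U: "lowfree n k (Suc e) U" unfolding U_def by (intro lowfree_sum lowfree_scale) auto
  have "fps_nth (X' i A) 0 = 0" if i: "i \<le> n - k" and A: "A \<subseteq> {n - k<..n}" and c: "card A < Suc e" for i A
  proof (cases "card A < e")
    case True
    then show ?thesis using low[OF X'K] i A by (simp add: lowfree_def)
  next
    case False
    then have "card A = e" using c by simp
    then obtain j where j: "j \<in> A" using e by (cases "A = {}") auto
    have fA: "finite A" using A finite_subset by blast
    have jn: "n - k < j" "j \<le> n" using j A by auto
    define D where "D = A - {j}"
    have D: "D \<subseteq> {n - k<..n}" "card D < e" "j \<notin> D" "insert j D = A"
      using A j \<open>card A = e\<close> e fA by (auto simp: D_def card_Diff_singleton)
    have 1: "fps_nth (vf_bracket n (Y j) X' i D) 0 = 0"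
      using low[OF kk(4)[of "Y j" X']] Y[OF jn] X'K D i by (simp add: lowfree_def)
    have "vf_bracket n (Y j - const_vf j) X' \<in> PF n k e"
      using VF_bracket[OF Ye[OF jn] X'P] by simp
    then have 2: "fps_nth (vf_bracket n (Y j - const_vf j) X' i D) 0 = 0"
      using VF_bw_iff(1)[OF e, of 0] D i by (simp add: lowfree_def)
    have "vf_bracket n (Y j) X' = vf_bracket n (const_vf j) X' + vf_bracket n (Y j - const_vf j) X'"
      by (simp add: vf_bracket_linear)
    then have "fps_nth (vf_bracket n (const_vf j) X' i D) 0 = 0" using 1 2 by simp
    then have "fps_nth (pd j (X' i) D) 0 = 0"
      using bracket_const_vf[OF jn(2) W[OF X'K]] by simp
    then have "fps_nth (shuffle_sign {j} D * X' i A) 0 = 0"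
      using D jn by (simp add: pd_def d_xi_apply)
    then show ?thesis using shuffle_sign_cases[of "{j}" D] by auto
  qed
  then have "lowfree n k (Suc e) X'" by (simp add: lowfree_def)
  from lowfree_add[OF this U] show ?thesis by (simp add: X'_def)
qed

text \<open>A set of odd variables has at most n elements, so at e = n + 1 no term of degree -1 is
  left.\<close>

lemma lowfree_GS:
  assumes n: "n \<ge> 1" and X: "X \<in> S n" "lowfree n k (Suc n) X"
  shows "X \<in> GS n k"
proof -
  have "0 \<le> vf_deg 1 (ones_zeros n k) m A i" if h: "fps_nth (X i A) m \<noteq> 0" for i A m
  proof (rule ccontr)
    assume neg: "\<not> 0 \<le> vf_deg 1 (ones_zeros n k) m A i"
    have "X i A \<noteq> 0" using h by auto
    then have A: "A \<subseteq> {1..n}" "finite A" using W_nonzero[OF S_W[OF n X(1)]] by blast+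
    define c where "c = card (A \<inter> {..n - k})"
    have "\<not> 0 \<le> int m + int c - (if i \<le> n - k then 1 else 0)"
      using neg unfolding ones_zeros_deg[OF A(2)] c_def .
    then have "m = 0" "i \<le> n - k" "c = 0" by (auto split: if_splits)
    moreover have "A \<inter> {..n - k} = {}" using \<open>c = 0\<close> A(2) by (simp add: c_def)
    then have "A \<subseteq> {n - k<..n}"
      using A by (auto simp: disjoint_iff not_le)
    moreover have "card A < Suc n" using card_mono[OF _ A(1)] by simp
    ultimately show False using X(2) h by (auto simp: lowfree_def)
  qed
  then show ?thesis using X(1) S_W[OF n X(1)] by (simp add: VF_def)
qed

lemma lowfree_1I:
  assumes "\<And>i. i \<le> n - k \<Longrightarrow> cf X i = 0"
  shows "lowfree n k 1 X"
proof -
  have "A = {}" if "A \<subseteq> {n - k<..n}" "card A < 1" for A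
    using that finite_subset[OF that(1)] by simp
  then show ?thesis using assms by (auto simp: lowfree_def cf_def)
qed

text \<open>K contains \<xi>_i \<partial>/\<partial>x for 0 < i \<le> n - k, which would turn a
  leading term \<partial>_i into \<partial>/\<partial>x; as n is at least 2, this field differs from
  the top field and lies in \<open>S n\<close>. The constant \<partial>_j with j > n - k are in K
  exactly, so \<open>lowfree_step\<close> runs without corrections.\<close>

lemma GS_maximal:
  assumes n: "n \<ge> 2" and K: "open_inv n B K" and G: "GS n k \<subseteq> K"
  shows "K = GS n k"
proof -
  have n1: "n \<ge> 1" using n by simp
  note kk = open_invD[OF K]
  have W: "V \<in> W n" if "V \<in> K" for V using that kk(1) S_W[OF n1] by blast
  have cf0: "cf X i = 0" if X: "X \<in> K" and i: "i \<le> n - k" for X i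
  proof (cases "i = 0")
    case True then show ?thesis using open_inv_no_dx[OF n1 K X] by simp
  next
    case False
    define V where "V = vf_monom 0 {i} 0"
    have "{i} \<noteq> {1..n}"
    proof
      assume "{i} = {1..n}"
      then have "card {i} = card {1..n}" by simp
      then show False using n by simp
    qed
    then have VS: "V \<in> S n" unfolding V_def using i False by (intro S_monom[OF n1]) auto
    have "V \<in> VF n 1 (ones_zeros n k) 0"
      using S_W[OF n1 VS] i by (auto simp: VF_def V_def vf_monom_def ones_zeros_deg split: if_splits)
    then have "V \<in> K" using VS G by blast
    then have "cf (vf_bracket n X V) 0 = 0" using open_inv_no_dx[OF n1 K kk(4)[OF X]] by blast
    moreover have "V \<in> EF n 0" using S_W[OF n1 VS] by (auto simp: VF_def V_def vf_monom_def euler_deg split: if_splits)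
    moreover have "fps_nth (pd r (V 0) {}) 0 = (if r = i then 1 else 0)" for r
      using False by (auto simp: pd_def d_x_def d_xi_apply V_def vf_monom_def)
    ultimately have "(\<Sum>r\<le>n. cf X r * (if r = i then 1 else 0)) = 0"
      using cf_bracket[OF W[OF X], of V 0] by simp
    moreover have "i \<le> n" using i by linarith
    ultimately show ?thesis by (simp add: if_distrib[of "(*) _"] cong: if_cong)
  qed
  have "lowfree n k (Suc e) X" if "X \<in> K" for e X
    using that
  proof (induction e arbitrary: X)
    case 0
    then have "lowfree n k 1 X" using cf0 by (intro lowfree_1I) auto
    then show "lowfree n k (Suc 0) X" by simp
  next
    case (Suc e)
    show "lowfree n k (Suc (Suc e)) X"
    proof (rule lowfree_step[OF n1 K _ Suc.IH _ Suc.prems, where Y = const_vf])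
      fix j assume "n - k < j" "j \<le> n"
      then show "const_vf j \<in> K \<and> const_vf j - const_vf j \<in> PF n k (Suc (Suc e))"
        using const_vf_GS[OF n1] G vf.subspace_0[OF VF_subspace] by auto
    qed simp_all
  qed
  then have "K \<subseteq> GS n k" using lowfree_GS[OF n1] kk(1) by blast
  then show ?thesis using G by blast
qed

definition leads :: "nat \<Rightarrow> nat \<Rightarrow> vfield set \<Rightarrow> bool" where
  "leads n k K \<longleftrightarrow> (\<forall>j. n - k < j \<longrightarrow> j \<le> n \<longrightarrow> (\<exists>Y\<in>K. \<forall>i\<le>n. cf Y i = (if i = j then 1 else 0)))"

text \<open>Here the Y_j are improved inside K, so beyond the linear normal form no conjugation is
  required.\<close>

lemma euler_invariant_GS:
  assumes n: "n \<ge> 1" and K: "open_inv n B K" and E: "euler n \<in> B" and ld: "leads n k K"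
    and low: "\<And>X. X \<in> K \<Longrightarrow> lowfree n k 1 X"
  shows "K \<subseteq> GS n k"
proof -
  note kk = open_invD[OF K]
  have W: "V \<in> W n" if "V \<in> K" for V using that kk(1) S_W[OF n] by blast
  obtain Y where Y: "\<And>j. n - k < j \<Longrightarrow> j \<le> n \<Longrightarrow> Y j \<in> K \<and> (\<forall>i\<le>n. cf (Y j) i = (if i = j then 1 else 0))"
    using ld unfolding leads_def by metis
  have "lowfree n k (Suc e) X" if "X \<in> K" for e X
    using that
  proof (induction e arbitrary: X)
    case 0 then show "lowfree n k (Suc 0) X" using low by simp
  next
    case (Suc e)
    \<comment> \<open>ad E multiplies \<xi>_A \<partial>_i by card A - 1. The polynomial in
      \<open>Y'\<close> therefore multiplies it by (c - card A) / c, which kills size c = e + 1 and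
      fixes the leads.\<close>
    define c :: complex where "c = of_nat (Suc e)"
    define Y' where "Y' j = vf_scale (- 1 / c) (vf_bracket n (euler n) (Y j) - vf_scale (c - 1) (Y j))" for j
    have c0: "c \<noteq> 0" by (simp add: c_def del: of_nat_Suc)
    show "lowfree n k (Suc (Suc e)) X"
    proof (rule lowfree_step[OF n K _ Suc.IH _ Suc.prems, where Y = Y'])
      fix j assume j: "n - k < j" "j \<le> n"
      have YK: "Y j \<in> K" using Y[OF j] by blast
      have Y'K: "Y' j \<in> K"
        unfolding Y'_def by (intro vf.subspace_scale[OF kk(2)] vf.subspace_diff[OF kk(2)] kk(5)[OF E] YK)
      have coeff: "fps_nth (Y' j i A) 0 = (c - of_nat (card A)) / c * fps_nth (Y j i A) 0" for i A
        using c0 by (simp add: Y'_def vf_scale_def bracket_euler[OF W[OF YK]] euler_deg field_simps)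
      have "lowfree n k (Suc (Suc e)) (Y' j)"
        unfolding lowfree_def
      proof (intro allI impI)
        fix i A assume h: "i \<le> n - k" "A \<subseteq> {n - k<..n}" "card A < Suc (Suc e)"
        show "fps_nth (Y' j i A) 0 = 0"
        proof (cases "card A = Suc e")
          case True then show ?thesis by (simp add: coeff c_def)
        next
          case False
          then have "fps_nth (Y j i A) 0 = 0" using Suc.IH[OF YK] h by (simp add: lowfree_def)
          then show ?thesis by (simp add: coeff)
        qed
      qed
      then have "lowfree n k (Suc (Suc e)) (Y' j - const_vf j)" by (intro lowfree_diff lowfree_const j)
      moreover have "cf (Y' j) i = cf (Y j) i" for i using coeff[of i "{}"] c0 by (simp add: cf_def)
      then have "cf (Y' j - const_vf j) i = 0" if "i \<le> n" for i
        using Y[OF j] that by (simp add: cf_diff cf_const)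
      moreover have "Y' j - const_vf j \<in> W n"
        by (intro vf.subspace_diff[OF W_subspace] W Y'K const_vf_W j)
      ultimately have "Y' j - const_vf j \<in> PF n k (Suc (Suc e))"
        by (intro VF_bw_iff(2)[of "Suc (Suc e)" 0]) auto
      then show "Y' j \<in> K \<and> Y' j - const_vf j \<in> PF n k (Suc (Suc e))" using Y'K by blast
    qed simp_all
  qed
  then show ?thesis using lowfree_GS[OF n] kk(1) by blast
qed

section \<open>Gaussian elimination on leading terms by transvections\<close>

section \<open>Moving subalgebras\<close>

text \<open>K' is the image under the inverse v, so the inner automorphism attached to u carries K'
  back to K, as \<open>maximal_conjugate\<close> wants it.\<close>

definition moved :: "nat \<Rightarrow> vfield set \<Rightarrow> vfield set \<Rightarrow> vfield set \<Rightarrow> bool" where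
  "moved n B K K' \<longleftrightarrow> (\<exists>u v. inner_pair n B u v \<and> K' = v ` K)"

lemma moved_refl: "n \<ge> 1 \<Longrightarrow> moved n B K K"
  unfolding moved_def by (rule exI[of _ "\<lambda>X. X"], rule exI[of _ "\<lambda>X. X"]) (simp add: inner_pair_id)

lemma B_stable:
  assumes "n \<ge> 1" "B \<subseteq> {euler n, top_vf n}" "T \<in> B" "X \<in> S n"
  shows "vf_bracket n T X \<in> S n"
  using assms euler_S top_S by auto

lemma moved_trans:
  assumes n: "n \<ge> 1" and B: "B \<subseteq> {euler n, top_vf n}" and m: "moved n B K K'" "moved n B K' K''"
  shows "moved n B K K''"
proof -
  obtain u v where g: "inner_pair n B u v" "K' = v ` K" using m(1) unfolding moved_def by metis
  obtain u' v' where g': "inner_pair n B u' v'" "K'' = v' ` K'" using m(2) unfolding moved_def by metis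
  have "inner_pair n B (\<lambda>X. u (u' X)) (\<lambda>X. v' (v X))"
    by (rule inner_pair_comp[OF n g(1) g'(1) B_stable[OF n B]])
  moreover have "K'' = (\<lambda>X. v' (v X)) ` K" by (simp add: g(2) g'(2) image_image)
  ultimately show ?thesis unfolding moved_def by metis
qed

lemma moved_open_inv:
  assumes n: "n \<ge> 1" and m: "moved n B K K'" and K: "open_inv n B K"
  shows "open_inv n B K'"
proof -
  obtain u v where g: "inner_pair n B u v" "K' = v ` K" using m unfolding moved_def by metis
  have "aut_pair n u v" using g(1) by (simp add: inner_pair_def)
  from open_inv_transport[OF n this K] show ?thesis using g by (simp add: inner_pair_def)
qed

lemma moved_exv:
  assumes "n \<ge> 1" "adm n Z" "\<And>T. T \<in> B \<Longrightarrow> vf_bracket n Z T = 0"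
  shows "moved n B K (exv n Z (- 1) ` K)"
  unfolding moved_def using inner_pair_exv[OF assms] by metis

lemma vf_bracket_skew:
  assumes "vf_odd X = 0"
  shows "vf_bracket n X Y = - vf_bracket n Y X"
  by (rule ext) (simp add: vf_bracket_apply assms)

lemma vf_bracket_odd_sym:
  assumes "vf_odd X = X" "vf_odd Y = Y"
  shows "vf_bracket n X Y = vf_bracket n Y X"
proof
  fix i show "vf_bracket n X Y i = vf_bracket n Y X i"
    using vf_bracket_odd[of n X Y i] vf_bracket_odd[of n Y X i] assms by (simp add: add.commute)
qed

lemma top_indicator:
  assumes "J \<subseteq> {1..n}"
  shows "top_vf n \<in> VF n 0 (\<lambda>j. if j \<in> J then 1 else 0) (int (card J))"
  using assms by (intro top_VF) (simp add: vf_deg_def sum.inter_restrict [symmetric] Int_absorb1)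

text \<open>The top field already has the largest degree \<open>card J\<close> that occurs, and Z
  would raise it.\<close>

lemma top_commute:
  assumes "J \<subseteq> {1..n}" "Z \<in> VF n 0 (\<lambda>j. if j \<in> J then 1 else 0) 1"
  shows "vf_bracket n Z (top_vf n) = 0"
  by (rule VF_indicator_zero[OF assms(1) VF_bracket[OF assms(2) top_indicator[OF assms(1)]]]) simp

subsection \<open>Linear changes of the odd variables\<close>

text \<open>The field \<xi>_i times the sum of c_l \<partial>/\<partial>\<xi>_l over l \<noteq> i,
  which generates a transvection of the odd variables. Omitting l = i makes it divergence-free and
  gives it degree 1 when only \<xi>_i is counted.\<close>

definition trans_vf :: "nat \<Rightarrow> nat \<Rightarrow> (nat \<Rightarrow> complex) \<Rightarrow> vfield" where
  "trans_vf n i c = (\<lambda>l A. if 1 \<le> l \<and> l \<le> n \<and> l \<noteq> i \<and> A = {i} then fps_const (c l) else 0)"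

lemma trans_vf_W: "1 \<le> i \<Longrightarrow> i \<le> n \<Longrightarrow> trans_vf n i c \<in> W n"
  by (auto simp: W_def Lam_def trans_vf_def fun_eq_iff)

lemma adm_trans_vf:
  assumes i: "1 \<le> i" "i \<le> n"
  shows "adm n (trans_vf n i c)" "trans_vf n i c \<in> VF n 0 (\<lambda>j. if j \<in> {i} then 1 else 0) 1"
proof -
  have n: "n \<ge> 1" using i by simp
  have "vf_div n (trans_vf n i c) A = 0" for A
    unfolding vf_div_apply by (auto simp: trans_vf_def intro!: sum.neutral)
  then have S: "trans_vf n i c \<in> S n"
    using S_S0[OF n] trans_vf_W[OF i] by (simp add: fun_eq_iff trans_vf_def)
  have "vf_even (trans_vf n i c) = trans_vf n i c"
    by (auto simp: vf_even_def trans_vf_def fun_eq_iff)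
  then have o: "vf_odd (trans_vf n i c) = 0" by (simp add: vf_odd_def)
  show v: "trans_vf n i c \<in> VF n 0 (\<lambda>j. if j \<in> {i} then 1 else 0) 1"
    using trans_vf_W[OF i] by (auto simp: VF_def trans_vf_def vf_deg_def split: if_splits)
  show "adm n (trans_vf n i c)"
    unfolding adm_def using S o v i by (intro conjI exI[of _ "{i}"]) auto
qed

lemma trans_vf_EF: "1 \<le> i \<Longrightarrow> i \<le> n \<Longrightarrow> trans_vf n i c \<in> EF n 0"
  using trans_vf_W by (auto simp: VF_def euler_deg trans_vf_def split: if_splits)

text \<open>The field has Euler degree 0 and hence commutes with E; it commutes with the top field
  by \<open>top_commute\<close>.\<close>

lemma moved_trans_vf:
  assumes i: "1 \<le> i" "i \<le> n" and B: "B \<subseteq> {euler n, top_vf n}"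
  shows "moved n B K (exv n (trans_vf n i c) (- 1) ` K)"
proof (rule moved_exv)
  show "n \<ge> 1" using i by simp
  show a: "adm n (trans_vf n i c)" by (rule adm_trans_vf(1)[OF i])
  fix T assume "T \<in> B"
  then consider "T = euler n" | "T = top_vf n" using B by auto
  then show "vf_bracket n (trans_vf n i c) T = 0"
  proof cases
    case 1
    have "fps_nth (vf_bracket n (euler n) (trans_vf n i c) l A) m = 0" for l A m
      unfolding bracket_euler[OF trans_vf_W[OF i]] by (auto simp: euler_deg trans_vf_def)
    then have "vf_bracket n (euler n) (trans_vf n i c) = 0" by (simp add: fun_eq_iff fps_eq_iff)
    then show ?thesis using vf_bracket_skew[of "trans_vf n i c" n "euler n"] a 1 by (simp add: adm_def)
  next
    case 2
    then show ?thesis using top_commute[OF _ adm_trans_vf(2)[OF i]] i by simp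
  qed
qed

lemma cf_exv_trans:
  assumes i: "1 \<le> i" "i \<le> n" and X: "X \<in> W n" and l: "l \<le> n"
  shows "cf (exv n (trans_vf n i c) (- 1) X) l = cf X l + (if 1 \<le> l \<and> l \<noteq> i then cf X i * c l else 0)"
proof -
  define Z where "Z = trans_vf n i c"
  define T where "T = vf_bracket n Z"
  have Z: "Z \<in> EF n 0" "Z \<in> W n" "vf_odd Z = 0"
    using trans_vf_EF[OF i] trans_vf_W[OF i] adm_trans_vf(1)[OF i] by (simp_all add: Z_def adm_def)
  have br: "cf (T V) l = - (if 1 \<le> l \<and> l \<noteq> i then cf V i * c l else 0)" if V: "V \<in> W n" "l \<le> n" for V l
  proof -
    have "fps_nth (pd r (Z l) {}) 0 = (if r = i then (if 1 \<le> l \<and> l \<noteq> i then c l else 0) else 0)" for r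
      using i V(2) by (auto simp: pd_def d_x_def d_xi_apply Z_def trans_vf_def)
    then have "cf (vf_bracket n V Z) l = (\<Sum>r\<le>n. if r = i then cf V i * (if 1 \<le> l \<and> l \<noteq> i then c l else 0) else 0)"
      unfolding cf_bracket[OF V(1) Z(1) V(2)] by (intro sum.cong) auto
    then have "cf (vf_bracket n V Z) l = (if 1 \<le> l \<and> l \<noteq> i then cf V i * c l else 0)" using i by simp
    moreover have "cf (T V) l = - cf (vf_bracket n V Z) l"
      using vf_bracket_skew[OF Z(3), of n V] by (simp add: T_def cf_def)
    ultimately show ?thesis by simp
  qed
  have TW: "(T ^^ k) X \<in> W n" for k
    by (induction k) (simp_all add: X T_def W_bracket Z(2))
  \<comment> \<open>T reads off the i-th value only and produces none in direction i, so a second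
    application gives 0 at the origin.\<close>
  have T2: "cf ((T ^^ Suc (Suc k)) X) l = 0" for k
    using br[OF TW[of "Suc k"] l] br[OF TW[of k] i(2)] by simp
  have T1: "cf ((T ^^ Suc 0) X) l = - (if 1 \<le> l \<and> l \<noteq> i then cf X i * c l else 0)"
    using br[OF X l] by simp
  have "cf (exv n Z (- 1) X) l = (\<Sum>k<nilp n. (- 1) ^ k / fact k * cf ((T ^^ k) X) l)"
    by (simp add: exv_def cf_sum cf_scale T_def)
  also have "\<dots> = (\<Sum>k\<in>{0, Suc 0}. (- 1) ^ k / fact k * cf ((T ^^ k) X) l)"
  proof (rule sum.mono_neutral_right)
    show "\<forall>k\<in>{..<nilp n} - {0, Suc 0}. (- 1) ^ k / fact k * cf ((T ^^ k) X) l = 0"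
    proof
      fix k assume "k \<in> {..<nilp n} - {0, Suc 0}"
      then obtain k' where "k = Suc (Suc k')" by (cases k rule: nat.exhaust; cases "k - 1") auto
      then show "(- 1) ^ k / fact k * cf ((T ^^ k) X) l = 0" using T2 by simp
    qed
  qed (auto simp: nilp_def)
  also have "\<dots> = cf X l - cf ((T ^^ Suc 0) X) l" by simp
  finally show ?thesis unfolding T1 Z_def by simp
qed

text \<open>Elimination with pivot position r = n - k: the known leads are subtracted from X, a
  transvection makes the r-th value nonzero if necessary, and another one clears the remaining
  values. Both leave the leads alone, whose values at i and r are 0.\<close>

lemma leads_extend:
  assumes n: "n \<ge> 1" and B: "B \<subseteq> {euler n, top_vf n}" and K: "open_inv n B K" and ld: "leads n k K"
    and X: "X \<in> K" and i: "i \<le> n - k" and nz: "cf X i \<noteq> 0"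
  shows "Suc k \<le> n" "\<exists>K'. moved n B K K' \<and> leads n (Suc k) K'"
proof -
  note kk = open_invD[OF K]
  have W: "V \<in> W n" if "V \<in> K" for V using that kk(1) S_W[OF n] by blast
  have i0: "i \<ge> 1" using nz open_inv_no_dx[OF n K X] by (cases "i = 0") auto
  define r where "r = n - k"
  have r: "1 \<le> r" "r \<le> n" "i \<le> r" using i i0 by (auto simp: r_def)
  then show kn: "Suc k \<le> n" by (auto simp: r_def)
  have iJ: "1 \<le> i" "i \<le> n" using i0 r by auto
  obtain Y where Y: "\<And>j. r < j \<Longrightarrow> j \<le> n \<Longrightarrow> Y j \<in> K \<and> (\<forall>i\<le>n. cf (Y j) i = (if i = j then 1 else 0))"
    using ld unfolding leads_def r_def by metis
  define X1 where "X1 = X - (\<Sum>j\<in>{r<..n}. vf_scale (cf X j) (Y j))"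
  have X1: "X1 \<in> K" unfolding X1_def
    using Y by (intro vf.subspace_diff[OF kk(2) X] vf.subspace_sum[OF kk(2)] vf.subspace_scale[OF kk(2)]) auto
  have "cf (\<Sum>j\<in>{r<..n}. vf_scale (cf X j) (Y j)) l = (\<Sum>j\<in>{r<..n}. if l = j then cf X j else 0)" if "l \<le> n" for l
    unfolding cf_sum using Y that by (intro sum.cong) (auto simp: cf_scale)
  then have cX1: "cf X1 l = (if r < l then 0 else cf X l)" if "l \<le> n" for l
    using that by (simp add: X1_def cf_diff)
  have "\<exists>K1 X2. moved n B K K1 \<and> leads n k K1 \<and> X2 \<in> K1 \<and> cf X2 r = 1 \<and> (\<forall>l. r < l \<longrightarrow> l \<le> n \<longrightarrow> cf X2 l = 0)"
  proof (cases "cf X1 r = 0")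
    case False
    have "vf_scale (1 / cf X1 r) X1 \<in> K" by (rule vf.subspace_scale[OF kk(2) X1])
    moreover have "cf (vf_scale (1 / cf X1 r) X1) r = 1" "\<And>l. r < l \<Longrightarrow> l \<le> n \<Longrightarrow> cf (vf_scale (1 / cf X1 r) X1) l = 0"
      using False cX1 by (simp_all add: cf_scale)
    ultimately show ?thesis using moved_refl[OF n] ld by metis
  next
    case True
    have nz1: "cf X1 i \<noteq> 0" using cX1[OF iJ(2)] nz r by simp
    then have ir: "i \<noteq> r" using True by auto
    \<comment> \<open>Chosen so that the i-th value of X1, which is nonzero, adds exactly 1 to the
      vanishing r-th one.\<close>
    define c where "c l = (if l = r then 1 / cf X1 i else 0)" for l
    define v where "v = exv n (trans_vf n i c) (- 1)"
    have cv: "cf (v V) l = cf V l + (if l = r then cf V i / cf X1 i else 0)" if "V \<in> K" "l \<le> n" for V l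
      using cf_exv_trans[OF iJ W[OF that(1)] that(2), of c] r ir by (auto simp: v_def c_def)
    have "moved n B K (v ` K)" unfolding v_def by (rule moved_trans_vf[OF iJ B])
    moreover have "leads n k (v ` K)"
      unfolding leads_def
    proof (intro allI impI)
      fix j assume j: "n - k < j" "j \<le> n"
      then have jr: "r < j" by (simp add: r_def)
      have YK: "Y j \<in> K" and Yc: "\<And>l. l \<le> n \<Longrightarrow> cf (Y j) l = (if l = j then 1 else 0)" using Y[OF jr j(2)] by auto
      have "cf (Y j) i = 0" using Yc[OF iJ(2)] jr r by simp
      then have "\<forall>l\<le>n. cf (v (Y j)) l = (if l = j then 1 else 0)"
        using cv[OF YK] Yc by simp
      then show "\<exists>Y\<in>v ` K. \<forall>i\<le>n. cf Y i = (if i = j then 1 else 0)" using YK by blast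
    qed
    moreover have "v X1 \<in> v ` K" using X1 by blast
    moreover have "cf (v X1) r = 1" using cv[OF X1 r(2)] True nz1 by simp
    moreover have "\<forall>l. r < l \<longrightarrow> l \<le> n \<longrightarrow> cf (v X1) l = 0" using cv[OF X1] cX1 by simp
    ultimately show ?thesis by metis
  qed
  then obtain K1 X2 where K1: "moved n B K K1" "leads n k K1" "X2 \<in> K1" "cf X2 r = 1"
    "\<And>l. r < l \<Longrightarrow> l \<le> n \<Longrightarrow> cf X2 l = 0" by metis
  have O1: "open_inv n B K1" by (rule moved_open_inv[OF n K1(1) K])
  have W1: "V \<in> W n" if "V \<in> K1" for V using that open_invD(1)[OF O1] S_W[OF n] by blast
  \<comment> \<open>X2 has r-th value 1, so adding -cf X2 l times this value clears every other
    direction.\<close>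
  define v where "v = exv n (trans_vf n r (\<lambda>l. - cf X2 l)) (- 1)"
  have cv: "cf (v V) l = cf V l - (if 1 \<le> l \<and> l \<noteq> r then cf V r * cf X2 l else 0)" if "V \<in> K1" "l \<le> n" for V l
    using cf_exv_trans[OF r(1,2) W1[OF that(1)] that(2), of "\<lambda>l. - cf X2 l"] by (simp add: v_def)
  have "moved n B K1 (v ` K1)" unfolding v_def by (rule moved_trans_vf[OF r(1,2) B])
  then have "moved n B K (v ` K1)" by (rule moved_trans[OF n B K1(1)])
  moreover have "leads n (Suc k) (v ` K1)"
    unfolding leads_def
  proof (intro allI impI)
    fix j assume j: "n - Suc k < j" "j \<le> n"
    show "\<exists>Y\<in>v ` K1. \<forall>i\<le>n. cf Y i = (if i = j then 1 else 0)"
    proof (cases "j = r")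
      case True
      have "cf (v X2) l = (if l = j then 1 else 0)" if "l \<le> n" for l
        using cv[OF K1(3) that] K1(4) open_inv_no_dx[OF n O1 K1(3)] True r by (cases "l = 0") auto
      then show ?thesis using K1(3) by blast
    next
      case False
      then have jr: "n - k < j" "r < j" using j by (auto simp: r_def)
      obtain V where V: "V \<in> K1" "\<And>l. l \<le> n \<Longrightarrow> cf V l = (if l = j then 1 else 0)"
        using K1(2) jr(1) j(2) unfolding leads_def by metis
      have "cf (v V) l = (if l = j then 1 else 0)" if "l \<le> n" for l
        using cv[OF V(1) that] V(2)[OF that] V(2)[OF r(2)] jr by simp
      then show ?thesis using V(1) by blast
    qed
  qed
  ultimately show "\<exists>K'. moved n B K K' \<and> leads n (Suc k) K'" by metis
qed

text \<open>Take the largest k for which some moved copy has all k leads; any other leading term in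
  it would contradict this by \<open>leads_extend\<close>.\<close>

lemma linear_normal_form:
  assumes n: "n \<ge> 1" and B: "B \<subseteq> {euler n, top_vf n}" and K: "open_inv n B K"
  obtains k K' where "k \<le> n" "moved n B K K'" "leads n k K'" "\<And>X. X \<in> K' \<Longrightarrow> lowfree n k 1 X"
proof -
  define P where "P k \<longleftrightarrow> k \<le> n \<and> (\<exists>K'. moved n B K K' \<and> leads n k K')" for k
  have "leads n 0 K" by (simp add: leads_def)
  then have "P 0" using moved_refl[OF n, of B K] by (auto simp: P_def)
  moreover have "\<And>k. P k \<Longrightarrow> k \<le> n" by (simp add: P_def)
  ultimately have G: "P (Greatest P)" "\<And>k. P k \<Longrightarrow> k \<le> Greatest P"
    by (auto intro: GreatestI_nat Greatest_le_nat)
  define k where "k = Greatest P"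
  obtain K' where K': "k \<le> n" "moved n B K K'" "leads n k K'" using G(1) by (auto simp: P_def k_def)
  have O': "open_inv n B K'" by (rule moved_open_inv[OF n K'(2) K])
  have "lowfree n k 1 X" if X: "X \<in> K'" for X
  proof (rule lowfree_1I, rule ccontr)
    fix i assume "i \<le> n - k" "cf X i \<noteq> 0"
    note le = leads_extend[OF n B O' K'(3) X this]
    obtain K'' where "moved n B K' K''" "leads n (Suc k) K''" using le(2) by metis
    then have "P (Suc k)" using le(1) moved_trans[OF n B K'(2)] by (auto simp: P_def)
    then show False using G(2) by (fastforce simp: k_def)
  qed
  then show thesis using that K' by metis
qed

section \<open>Exclusion of k = n under invariance by the top field\<close>

section \<open>Invariance under the top field\<close>

lemma shuffle_sign_const: "shuffle_sign A B = fps_const (fps_nth (shuffle_sign A B) 0)"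
  using shuffle_sign_cases[of A B] by (auto simp flip: fps_const_neg)

lemma shuffle_sign_nz: "fps_nth (shuffle_sign A B) 0 \<noteq> 0"
  using shuffle_sign_cases[of A B] by auto

lemma monom_W: "A \<subseteq> {1..n} \<Longrightarrow> i \<le> n \<Longrightarrow> vf_monom m A i \<in> W n"
  by (auto simp: W_def Lam_def vf_monom_def fun_eq_iff)

lemma bracket_const_monom:
  assumes m: "1 \<le> m" "m \<le> n"
  shows "vf_bracket n (const_vf m) (vf_monom 0 {1..m} 0) =
    vf_scale (fps_nth (shuffle_sign {m} {1..m - 1}) 0) (vf_monom 0 {1..m - 1} 0)"
proof -
  have "vf_monom 0 {1..m} 0 \<in> W n" using m by (intro monom_W) auto
  moreover have "pd m (vf_monom 0 {1..m} 0 i) A =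
      vf_scale (fps_nth (shuffle_sign {m} {1..m - 1}) 0) (vf_monom 0 {1..m - 1} 0) i A" for i A
  proof (cases "i = 0 \<and> A = {1..m - 1}")
    case True
    moreover have "insert m {1..m - 1} = {1..m}" using m by auto
    ultimately show ?thesis
      using m shuffle_sign_const[of "{m}" "{1..m - 1}"] by (simp add: pd_def d_xi_apply vf_monom_def vf_scale_def)
  next
    case False
    have "\<not> (i = 0 \<and> m \<notin> A \<and> insert m A = {1..m})"
    proof
      assume h: "i = 0 \<and> m \<notin> A \<and> insert m A = {1..m}"
      then have "A = {1..m} - {m}" by auto
      also have "\<dots> = {1..m - 1}" by auto
      finally show False using False h by simp
    qed
    then show ?thesis using m False by (auto simp: pd_def d_xi_apply vf_monom_def vf_scale_def)
  qed
  ultimately show ?thesis using bracket_const_vf[OF m(2)] by (simp add: fun_eq_iff)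
qed

lemma top_invariant_lt:
  assumes n: "n \<ge> 1" and K: "open_inv n B K" and T: "top_vf n \<in> B" and ld: "leads n k K" and k: "k \<le> n"
  shows "k < n"
proof (rule ccontr)
  assume "\<not> k < n"
  then have kn: "n - k = 0" by simp
  note kk = open_invD[OF K]
  have W: "V \<in> W n" if "V \<in> K" for V using that kk(1) S_W[OF n] by blast
  obtain Y where Y: "\<And>j. 0 < j \<Longrightarrow> j \<le> n \<Longrightarrow> Y j \<in> K \<and> (\<forall>i\<le>n. cf (Y j) i = (if i = j then 1 else 0))"
    using ld unfolding leads_def kn by metis
  have R: "Y j - const_vf j \<in> EF n 0" if "0 < j" "j \<le> n" for j
    using Y[OF that] W const_vf_W[OF that(2)]
    by (auto simp: EF_0_iff cf_diff cf_const intro: vf.subspace_diff[OF W_subspace])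
  define mon where "mon m = vf_monom 0 {1..m} 0" for m
  have mon_EF: "mon m \<in> EF n (int m - 1)" if "m \<le> n" for m
    using that monom_W[of "{1..m}" n 0 0] by (auto simp: VF_def mon_def euler_deg vf_monom_def split: if_splits)
  \<comment> \<open>The variables are contracted in the order n, ..., 1, so the sets that occur are
    initial segments. The lowest term has Euler degree n - 2 - d; as Y_m - \<partial>_m does not
    lower degrees, its contributions stay above. At d = n - 1 the term is a multiple of
    \<partial>/\<partial>x.\<close>
  have step: "\<exists>X\<in>K. \<exists>c. c \<noteq> 0 \<and> X - vf_scale c (mon (n - 1 - d)) \<in> EF n (int (n - 1 - d))" if "d \<le> n - 1" for d
    using that
  proof (induction d)
    case 0
    \<comment> \<open>The top field lies outside \<open>S n\<close>, so the first contraction comes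
      from invariance of K. Its sign depends on the parity of the top field, that is, of n.\<close>
    define X where "X = vf_bracket n (top_vf n) (Y n)"
    have XK: "X \<in> K" unfolding X_def using n by (intro kk(5)[OF T]) (simp add: Y)
    have tn: "top_vf n = mon n" by (simp add: top_vf_def mon_def)
    have on: "vf_odd (const_vf n) = const_vf n" using n by (simp add: vf_odd_const)
    define s where "s = fps_nth (shuffle_sign {n} {1..n - 1}) 0"
    have b: "vf_bracket n (const_vf n) (top_vf n) = vf_scale s (mon (n - 1))"
      unfolding tn mon_def s_def using n by (intro bracket_const_monom) auto
    have "\<exists>c. c \<noteq> 0 \<and> vf_bracket n (top_vf n) (const_vf n) = vf_scale c (mon (n - 1))"
    proof (cases "even n")
      case True
      have "vf_even (top_vf n) = top_vf n"
        using True by (auto simp: vf_even_def top_vf_def vf_monom_def fun_eq_iff)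
      then have "vf_odd (top_vf n) = 0" by (simp add: vf_odd_def)
      then have "vf_bracket n (top_vf n) (const_vf n) = vf_scale (- s) (mon (n - 1))"
        using vf_bracket_skew[of "top_vf n" n "const_vf n"] b by simp
      then show ?thesis using shuffle_sign_nz[of "{n}" "{1..n - 1}"] unfolding s_def[symmetric]
        by (intro exI[of _ "- s"]) simp
    next
      case False
      have "vf_even (top_vf n) = 0"
        using False by (auto simp: vf_even_def top_vf_def vf_monom_def fun_eq_iff)
      then have "vf_odd (top_vf n) = top_vf n" by (simp add: vf_odd_def)
      then have "vf_bracket n (top_vf n) (const_vf n) = vf_scale s (mon (n - 1))"
        using vf_bracket_odd_sym[OF _ on, of "top_vf n" n] b by simp
      then show ?thesis using shuffle_sign_nz[of "{n}" "{1..n - 1}"] unfolding s_def[symmetric]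
        by (intro exI[of _ s]) simp
    qed
    then obtain c where c: "c \<noteq> 0" "vf_bracket n (top_vf n) (const_vf n) = vf_scale c (mon (n - 1))" by metis
    have "X - vf_scale c (mon (n - 1)) = vf_bracket n (top_vf n) (Y n - const_vf n)"
      by (simp add: X_def vf_bracket_diff_right c(2))
    moreover have "vf_bracket n (top_vf n) (Y n - const_vf n) \<in> EF n (int n - 1)"
      using VF_bracket[OF mon_EF[of n] R[of n]] n by (simp add: tn)
    ultimately have "X - vf_scale c (mon (n - 1)) \<in> EF n (int (n - 1))" using n by (simp add: of_nat_diff)
    with c(1) have "\<exists>c. c \<noteq> 0 \<and> X - vf_scale c (mon (n - 1)) \<in> EF n (int (n - 1))" by (intro exI[of _ c] conjI)
    then have "\<exists>X\<in>K. \<exists>c. c \<noteq> 0 \<and> X - vf_scale c (mon (n - 1)) \<in> EF n (int (n - 1))"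
      by (rule bexI[OF _ XK])
    then show "\<exists>X\<in>K. \<exists>c. c \<noteq> 0 \<and> X - vf_scale c (mon (n - 1 - 0)) \<in> EF n (int (n - 1 - 0))" by (simp only: diff_zero)
  next
    case (Suc d)
    define m where "m = n - 1 - d"
    have m: "1 \<le> m" "m \<le> n" "n - 1 - Suc d = m - 1" "int (m - 1) = int m - 1" using Suc.prems by (auto simp: m_def)
    have d: "d \<le> n - 1" using Suc.prems by simp
    have "\<exists>X\<in>K. \<exists>c. c \<noteq> 0 \<and> X - vf_scale c (mon m) \<in> EF n (int m)"
      unfolding m_def by (rule Suc.IH[OF d])
    then obtain X where X1: "X \<in> K" and XX: "\<exists>c. c \<noteq> 0 \<and> X - vf_scale c (mon m) \<in> EF n (int m)" ..
    from XX obtain c where Xc: "c \<noteq> 0 \<and> X - vf_scale c (mon m) \<in> EF n (int m)" ..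
    note X = X1 conjunct1[OF Xc] conjunct2[OF Xc]
    define s where "s = fps_nth (shuffle_sign {m} {1..m - 1}) 0"
    define X' where "X' = vf_bracket n (Y m) X"
    have YK: "Y m \<in> K" using Y m by simp
    have "X' \<in> K" unfolding X'_def by (rule kk(4)[OF YK X(1)])
    moreover have "c * s \<noteq> 0" using X(2) shuffle_sign_nz by (simp add: s_def)
    moreover have "X' - vf_scale (c * s) (mon (m - 1)) \<in> EF n (int m - 1)"
    proof -
      define R1 where "R1 = Y m - const_vf m"
      define R2 where "R2 = X - vf_scale c (mon m)"
      have b: "vf_bracket n (const_vf m) (mon m) = vf_scale s (mon (m - 1))"
        unfolding mon_def s_def by (rule bracket_const_monom[OF m(1,2)])
      have "X' = vf_bracket n (const_vf m) (vf_scale c (mon m)) + vf_bracket n (const_vf m) R2 + vf_bracket n R1 X"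
        by (simp add: X'_def R1_def R2_def vf_bracket_linear)
      then have e: "X' - vf_scale (c * s) (mon (m - 1)) = vf_bracket n (const_vf m) R2 + vf_bracket n R1 X"
        by (simp add: vf_bracket_scale_right b)
      have "vf_bracket n (const_vf m) R2 \<in> EF n (int m - 1)"
        using VF_bracket[OF W_EF[OF const_vf_W[OF m(2)]] X(3)] by (simp add: R2_def)
      moreover have "X \<in> EF n (int m - 1)"
      proof -
        have "R2 \<in> EF n (int m - 1)" unfolding R2_def by (rule VF_mono[OF _ X(3)]) simp
        moreover have "vf_scale c (mon m) \<in> EF n (int m - 1)" by (rule vf.subspace_scale[OF VF_subspace mon_EF[OF m(2)]])
        ultimately have "R2 + vf_scale c (mon m) \<in> EF n (int m - 1)" by (rule vf.subspace_add[OF VF_subspace])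
        then show ?thesis by (simp add: R2_def)
      qed
      then have "vf_bracket n R1 X \<in> EF n (int m - 1)"
        using VF_bracket[OF R[of m], of X "int m - 1"] m by (simp add: R1_def)
      ultimately show ?thesis unfolding e by (rule vf.subspace_add[OF VF_subspace])
    qed
    ultimately show "\<exists>X\<in>K. \<exists>c. c \<noteq> 0 \<and> X - vf_scale c (mon (n - 1 - Suc d)) \<in> EF n (int (n - 1 - Suc d))"
      unfolding m(3,4) by (intro bexI[of _ X'] exI[of _ "c * s"] conjI)
  qed
  have "\<exists>X\<in>K. \<exists>c. c \<noteq> 0 \<and> X - vf_scale c (mon (n - 1 - (n - 1))) \<in> EF n (int (n - 1 - (n - 1)))"
    by (rule step) simp
  then have "\<exists>X\<in>K. \<exists>c. c \<noteq> 0 \<and> X - vf_scale c (mon 0) \<in> EF n 0" by (simp only: diff_self_eq_0 of_nat_0)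
  then obtain X c where X: "X \<in> K" "c \<noteq> 0" "X - vf_scale c (mon 0) \<in> EF n 0" by metis
  have "cf (X - vf_scale c (mon 0)) 0 = 0" using X(3) by (simp add: EF_0_iff)
  then have "cf X 0 = c" by (simp add: cf_diff cf_scale) (simp add: cf_def mon_def vf_monom_def)
  then show False using open_inv_no_dx[OF n K X(1)] X(2) by simp
qed

section \<open>Closed forms in the odd variables and conjugation by their primitives\<close>

section \<open>Straightening by a Poincare lemma\<close>

abbreviation sg :: "nat set \<Rightarrow> nat set \<Rightarrow> complex" where
  "sg A B \<equiv> fps_nth (shuffle_sign A B) 0"

lemma sg_square: "sg A B * sg A B = 1"
  using shuffle_sign_square[of A B] by (metis fps_mult_nth_0 fps_one_nth)

lemma sg_insert:
  assumes "l \<notin> A" "finite A"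
  shows "sg {j} (insert l A) = sg {j} {l} * sg {j} A"
  using shuffle_sign_Un_right[of "{j}" "{l}" A] assms by simp

lemma sg_flip:
  assumes "j \<noteq> l"
  shows "sg {j} {l} * sg {l} {j} = - 1"
proof -
  have "shuffle_sign {j} {l} * shuffle_sign {l} {j} = - 1"
    using shuffle_sign_flip[of "{j}" "{l}"] assms by simp
  then have "fps_nth (shuffle_sign {j} {l} * shuffle_sign {l} {j}) 0 = fps_nth (- 1) 0" by simp
  then show ?thesis by simp
qed

text \<open>
  The primitive chosen takes the coefficient at \<open>\<xi>\<^sub>A\<close> from the component of the closed form in the smallest
  direction \<open>Min A\<close>; closedness makes any other element of \<open>A\<close> give the same value.
\<close>

definition potential :: "nat \<Rightarrow> nat \<Rightarrow> nat \<Rightarrow> (nat \<Rightarrow> vfield) \<Rightarrow> vfield" where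
  "potential n k e Y = (\<lambda>i A. if i \<le> n - k \<and> A \<subseteq> {n - k<..n} \<and> card A = Suc e
     then fps_const (- (sg {Min A} (A - {Min A}) * fps_nth (Y (Min A) i (A - {Min A})) 0)) else 0)"

lemma potential_nonzero:
  assumes "fps_nth (potential n k e Y i A) m \<noteq> 0"
  shows "i \<le> n - k" "A \<subseteq> {n - k<..n}" "card A = Suc e" "m = 0"
    "fps_nth (Y (Min A) i (A - {Min A})) 0 \<noteq> 0" "Min A \<in> A"
proof -
  show *: "i \<le> n - k" "A \<subseteq> {n - k<..n}" "card A = Suc e" "m = 0"
    "fps_nth (Y (Min A) i (A - {Min A})) 0 \<noteq> 0"
    using assms by (auto simp: potential_def split: if_splits)
  then have "finite A" "A \<noteq> {}" using finite_subset by fastforce+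
  then show "Min A \<in> A" by simp
qed

lemma potential_W: "potential n k e Y \<in> W n"
  by (auto simp: W_def Lam_def potential_def fun_eq_iff)

text \<open>The first grading gives nilpotency and commutation with the top field; the second
  controls the effect of Z on terms of size e.\<close>

lemma potential_VF:
  "potential n k e Y \<in> VF n 0 (\<lambda>j. if j \<in> {n - k<..n} then 1 else 0) 1"
  "potential n k e Y \<in> VF n (int e) (bw n k e) 1"
proof -
  show "potential n k e Y \<in> VF n 0 (\<lambda>j. if j \<in> {n - k<..n} then 1 else 0) 1"
    unfolding VF_def
  proof safe
    fix i A m assume "fps_nth (potential n k e Y i A) m \<noteq> 0"
    note h = potential_nonzero[OF this]
    have "(\<Sum>j\<in>A. if j \<in> {n - k<..n} then 1 else 0 :: int) = (\<Sum>j\<in>A. 1)"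
      using h(2) by (intro sum.cong) auto
    then have "(\<Sum>j\<in>A. if j \<in> {n - k<..n} then 1 else 0) = int (card A)" by simp
    then show "1 \<le> vf_deg 0 (\<lambda>j. if j \<in> {n - k<..n} then 1 else 0) m A i"
      using h(1,3) by (simp add: vf_deg_def)
  qed (rule potential_W)
  show "potential n k e Y \<in> VF n (int e) (bw n k e) 1"
    unfolding VF_def
  proof safe
    fix i A m assume "fps_nth (potential n k e Y i A) m \<noteq> 0"
    note h = potential_nonzero[OF this]
    then show "1 \<le> vf_deg (int e) (bw n k e) m A i" by (simp add: bw_deg_low)
  qed (rule potential_W)
qed

text \<open>The directions i are low and the variables in A high, so the divergence vanishes. For k
  = n the primitive could contain the top field, which k < n excludes. Z is even because it has one
  odd variable more than the odd Y_j.\<close>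

lemma adm_potential:
  assumes k: "k < n" and Y: "\<And>j. n - k < j \<Longrightarrow> j \<le> n \<Longrightarrow> vf_odd (Y j) = Y j"
  shows "adm n (potential n k e Y)"
proof -
  define Z where "Z = potential n k e Y"
  have n: "n \<ge> 1" using k by simp
  have "Z j (insert j A) = 0" for j A
    by (auto simp: Z_def potential_def)
  moreover have "fps_deriv (Z i A) = 0" for i A by (simp add: Z_def potential_def)
  ultimately have "vf_div n Z = 0" by (simp add: fun_eq_iff vf_div_apply)
  moreover have "Z 0 {1..n} = 0" using k by (auto simp: Z_def potential_def)
  ultimately have S: "Z \<in> S n" using potential_W by (simp add: S_S0[OF n] Z_def)
  have "vf_even Z i A = Z i A" for i A
  proof (cases "Z i A = 0")
    case False
    then obtain m where "fps_nth (Z i A) m \<noteq> 0" by (auto simp: fps_eq_iff)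
    note h = potential_nonzero[OF this[unfolded Z_def]]
    define l where "l = Min A"
    have l: "n - k < l" "l \<le> n" using h(2,6) by (auto simp: l_def)
    have "vf_odd (Y l) i (A - {l}) \<noteq> 0" using h(5) Y[OF l] by (auto simp: l_def)
    then have "odd (card (A - {l}) + (if i = 0 then 0 else 1))"
      by (auto simp: vf_odd_def vf_even_def split: if_splits)
    moreover have "card (A - {l}) = e" using h(3,6) by (simp add: l_def)
    ultimately show ?thesis using h(3) by (auto simp: vf_even_def)
  qed (simp add: vf_even_def)
  then have "vf_odd Z = 0" by (simp add: vf_odd_def fun_eq_iff)
  then show ?thesis
    using S potential_VF(1) k unfolding adm_def Z_def by (intro conjI exI[of _ "{n - k<..n}"]) auto
qed

text \<open>For anticommuting variables closedness has a plus sign and says something for l = j too: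
  at this order Y_j does not involve \<xi>_j. This settles j in A. Otherwise closedness for j and
  the minimum l compares the chosen coefficient of Z with the one obtained from j.\<close>

lemma pd_potential:
  assumes j: "n - k < j" "j \<le> n" and i: "i \<le> n - k" and A: "A \<subseteq> {n - k<..n}" "card A = e"
    and closed: "\<And>j l D. n - k < j \<Longrightarrow> j \<le> n \<Longrightarrow> n - k < l \<Longrightarrow> l \<le> n \<Longrightarrow> D \<subseteq> {n - k<..n} \<Longrightarrow> card D < e \<Longrightarrow>
      fps_nth (pd j (Y l i) D) 0 + fps_nth (pd l (Y j i) D) 0 = 0"
    and e: "e \<ge> 1"
  shows "fps_nth (pd j (potential n k e Y i) A) 0 = - fps_nth (Y j i A) 0"
proof (cases "j \<in> A")
  have fin: "finite A" using A(1) finite_subset by blast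
  case True
  have "card (A - {j}) < e" using True A fin e by simp
  then have "2 * fps_nth (pd j (Y j i) (A - {j})) 0 = 0"
    using closed[OF j j, of "A - {j}"] A(1) by auto
  moreover have "fps_nth (pd j (Y j i) (A - {j})) 0 = sg {j} (A - {j}) * fps_nth (Y j i A) 0"
    using True j by (simp add: pd_def d_xi_apply insert_absorb)
  ultimately have "fps_nth (Y j i A) 0 = 0" using shuffle_sign_nz by simp
  then show ?thesis using True j by (simp add: pd_def d_xi_apply)
next
  have fin: "finite A" using A(1) finite_subset by blast
  case False
  define C where "C = insert j A"
  define l where "l = Min C"
  have C: "C \<subseteq> {n - k<..n}" "card C = Suc e" "finite C" "C \<noteq> {}"
    using A j False fin by (auto simp: C_def)
  have lC: "l \<in> C" using C by (simp add: l_def)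
  then have l: "n - k < l" "l \<le> n" using C(1) by auto
  have "fps_nth (pd j (potential n k e Y i) A) 0 = - (sg {j} A * sg {l} (C - {l}) * fps_nth (Y l i (C - {l})) 0)"
    using False j i C by (simp add: pd_def d_xi_apply potential_def flip: C_def l_def)
  also have "sg {j} A * sg {l} (C - {l}) * fps_nth (Y l i (C - {l})) 0 = fps_nth (Y j i A) 0"
  proof (cases "l = j")
    case True
    then have "C - {l} = A" using False by (simp add: C_def)
    then show ?thesis using True sg_square by simp
  next
    case lj: False
    define D where "D = A - {l}"
    have lA: "l \<in> A" using lC lj by (simp add: C_def)
    have D: "A = insert l D" "C - {l} = insert j D" "l \<notin> D" "j \<notin> D" "finite D" "D \<subseteq> {n - k<..n}"
      using lA lj False fin A(1) by (auto simp: D_def C_def)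
    have "card D < e" using D fin A(2) by auto
    then have "fps_nth (pd j (Y l i) D) 0 + fps_nth (pd l (Y j i) D) 0 = 0"
      by (intro closed j l D)
    then have cl: "sg {j} D * fps_nth (Y l i (insert j D)) 0 + sg {l} D * fps_nth (Y j i (insert l D)) 0 = 0"
      using D j l by (simp add: pd_def d_xi_apply)
    define a b c d y z where "a = sg {j} D" and "b = sg {l} D" and "c = sg {j} {l}" and "d = sg {l} {j}"
      and "y = fps_nth (Y l i (insert j D)) 0" and "z = fps_nth (Y j i (insert l D)) 0"
    have *: "a * a = 1" "b * b = 1" "c * d = - 1" "a * y + b * z = 0"
      using sg_square sg_flip lj cl by (simp_all add: a_def b_def c_def d_def y_def z_def)
    have "c * a * (d * b) * y = (c * d) * (b * (a * y))" by (simp add: ac_simps)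
    also have "a * y = - (b * z)" using *(4) by (simp add: eq_neg_iff_add_eq_0)
    also have "(c * d) * (b * - (b * z)) = (b * b) * z" using *(3) by simp
    finally have "c * a * (d * b) * y = z" using *(2) by simp
    then show ?thesis
      unfolding D(2) unfolding D(1) sg_insert[OF D(3,5)] sg_insert[OF D(4,5)]
      by (simp add: a_def b_def c_def d_def y_def z_def)
  qed
  finally show ?thesis .
qed

lemma ad_pow_VF:
  assumes "Z \<in> VF n a b 1" "X \<in> VF n a b d"
  shows "(vf_bracket n Z ^^ k) X \<in> VF n a b (d + int k)"
proof (induction k)
  case 0
  show "(vf_bracket n Z ^^ 0) X \<in> VF n a b (d + int 0)" using assms(2) by simp
next
  case (Suc k)
  have "vf_bracket n Z ((vf_bracket n Z ^^ k) X) \<in> VF n a b (1 + (d + int k))"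
    by (rule VF_bracket[OF assms(1) Suc.IH])
  then show "(vf_bracket n Z ^^ Suc k) X \<in> VF n a b (d + int (Suc k))" by (simp add: ac_simps)
qed

lemma exv_VF:
  assumes "Z \<in> VF n a b 1" "X \<in> VF n a b d"
  shows "exv n Z t X \<in> VF n a b d"
  unfolding exv_def
proof (intro vf.subspace_sum[OF VF_subspace] vf.subspace_scale[OF VF_subspace])
  fix k show "(vf_bracket n Z ^^ k) X \<in> VF n a b d"
    by (rule VF_mono[OF _ ad_pow_VF[OF assms]]) simp
qed

lemma exv_zero: "exv n Z t 0 = 0"
  unfolding exv_def ad_pow_zero by simp

text \<open>Each ad Z raises degrees by 1, so from degree -1 the terms of order two and more land in
  degree 1. Splitting off two of the \<open>nilp n\<close> terms leaves n.\<close>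

lemma exv_first_order:
  assumes "Z \<in> VF n a b 1" "X \<in> VF n a b (- 1)"
  shows "exv n Z (- 1) X - (X - vf_bracket n Z X) \<in> VF n a b 1"
proof -
  have "exv n Z (- 1) X = X + (- vf_bracket n Z X +
      (\<Sum>k<n. vf_scale ((- 1) ^ Suc (Suc k) / fact (Suc (Suc k))) ((vf_bracket n Z ^^ Suc (Suc k)) X)))"
  proof -
    have "vf_scale (- 1) V = - V" for V :: vfield by (simp add: vf_scale_def fun_eq_iff flip: fps_const_neg)
    then show ?thesis by (simp add: exv_def nilp_def numeral_2_eq_2 sum.lessThan_Suc_shift del: sum.lessThan_Suc)
  qed
  then have "exv n Z (- 1) X - (X - vf_bracket n Z X) =
      (\<Sum>k<n. vf_scale ((- 1) ^ Suc (Suc k) / fact (Suc (Suc k))) ((vf_bracket n Z ^^ Suc (Suc k)) X))"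
    by (simp only: diff_conv_add_uminus) (simp add: algebra_simps)
  also have "\<dots> \<in> VF n a b 1"
  proof (intro vf.subspace_sum[OF VF_subspace] vf.subspace_scale[OF VF_subspace])
    fix k show "(vf_bracket n Z ^^ Suc (Suc k)) X \<in> VF n a b 1"
      by (rule VF_mono[OF _ ad_pow_VF[OF assms]]) simp
  qed
  finally show ?thesis .
qed

lemma PF_cf: "e \<ge> 1 \<Longrightarrow> X \<in> PF n k e \<Longrightarrow> cf X i = 0"
  using VF_bw_iff(1)[of e 0 X n k] lowfreeD[of n k e X i "{}"] by (cases "i \<le> n - k") (auto simp: cf_def)

lemma cf_odd: "cf (vf_odd X) i = (if i = 0 then 0 else cf X i)"
  by (simp add: cf_def vf_odd_def vf_even_def)

text \<open>Z has degree 1 for weight e, so conjugation leaves the terms of Y_j of size below e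
  alone and changes those of size e only by [\<partial>_j, Z]. Once the Y_j are straightened,
  \<open>lowfree_step\<close> extends the gain to the whole moved subalgebra.\<close>

lemma straighten_step:
  assumes B: "B \<subseteq> {top_vf n}" and k: "k < n" and K: "open_inv n B K" and e: "e \<ge> 1"
    and low: "\<And>X. X \<in> K \<Longrightarrow> lowfree n k e X" and ld: "leads n k K"
  shows "\<exists>K'. moved n B K K' \<and> leads n k K' \<and> (\<forall>X\<in>K'. lowfree n k (Suc e) X)"
proof -
  have n: "n \<ge> 1" using k by simp
  note kk = open_invD[OF K]
  have W: "V \<in> W n" if "V \<in> K" for V using that kk(1) S_W[OF n] by blast
  obtain Y0 where Y0: "\<And>j. n - k < j \<Longrightarrow> j \<le> n \<Longrightarrow> Y0 j \<in> K \<and> (\<forall>i\<le>n. cf (Y0 j) i = (if i = j then 1 else 0))"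
    using ld unfolding leads_def by metis
  \<comment> \<open>Odd parts keep the leads \<partial>/\<partial>\<xi>_j; their brackets are
    symmetric, and the primitive built from them is even.\<close>
  define Y where "Y j = vf_odd (Y0 j)" for j
  have odd: "vf_odd (Y j) = Y j" for j by (simp add: Y_def)
  have YK: "Y j \<in> K" if "n - k < j" "j \<le> n" for j
    unfolding Y_def vf_odd_def using Y0[OF that] by (intro vf.subspace_diff[OF kk(2)] kk(3)) auto
  have Yc: "cf (Y j) i = (if i = j then 1 else 0)" if "n - k < j" "j \<le> n" "i \<le> n" for i j
    using Y0[OF that(1,2)] that by (auto simp: Y_def cf_odd)
  define R where "R j = Y j - const_vf j" for j
  have R: "R j \<in> PF n k e" if j: "n - k < j" "j \<le> n" for j
  proof (rule VF_bw_iff(2)[OF e])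
    show "R j \<in> W n" unfolding R_def using W[OF YK[OF j]] const_vf_W[OF j(2)] by (rule vf.subspace_diff[OF W_subspace])
    show "lowfree n k e (R j)" unfolding R_def by (intro lowfree_diff low YK j lowfree_const)
    show "cf (R j) i = 0" if "n - k < i" "i \<le> n" for i using Yc[OF j that(2)] by (simp add: R_def cf_diff cf_const)
  qed auto
  have odd_c: "vf_odd (const_vf j) = const_vf j" if "n - k < j" for j using that by (simp add: vf_odd_const)
  have const_const: "vf_bracket n (const_vf l) (const_vf j) = 0" if "j \<le> n" "l \<le> n" for j l
    unfolding bracket_const_vf[OF that(2) const_vf_W[OF that(1)]]
    by (auto simp: const_vf_apply pd_sfun_one fun_eq_iff)
  \<comment> \<open>[Y_j, Y_l] equals \<partial>_j Y_l + \<partial>_l Y_j + [R_j, R_l]. The left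
    side lies in K and the last bracket in \<open>PF n k e\<close>; neither has terms of size below
    e.\<close>
  have closed: "fps_nth (pd j (Y l i) D) 0 + fps_nth (pd l (Y j i) D) 0 = 0"
    if j: "n - k < j" "j \<le> n" and l: "n - k < l" "l \<le> n" and D: "D \<subseteq> {n - k<..n}" "card D < e" and i: "i \<le> n - k"
    for j l D i
  proof -
    have oR: "vf_odd (R j) = R j" using odd odd_c[OF j(1)] by (simp add: R_def vf_odd_diff)
    have Rl: "Y l = const_vf l + R l" by (simp add: R_def)
    have Rj: "Y j = const_vf j + R j" by (simp add: R_def)
    have "vf_bracket n (Y j) (Y l) = vf_bracket n (const_vf j) (Y l) + vf_bracket n (R j) (Y l)"
      by (subst Rj) (simp only: vf_bracket_add_left)
    also have "vf_bracket n (R j) (Y l) = vf_bracket n (R j) (const_vf l) + vf_bracket n (R j) (R l)"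
      by (subst Rl) (simp only: vf_bracket_add_right)
    also have "vf_bracket n (R j) (const_vf l) = vf_bracket n (const_vf l) (R j)"
      by (rule vf_bracket_odd_sym[OF oR odd_c[OF l(1)]])
    also have "\<dots> = vf_bracket n (const_vf l) (Y j)"
      unfolding R_def vf_bracket_diff_right const_const[OF j(2) l(2)] by simp
    finally have br: "vf_bracket n (Y j) (Y l) i D = pd j (Y l i) D + (pd l (Y j i) D + vf_bracket n (R j) (R l) i D)"
      by (simp add: bracket_const_vf[OF j(2) W[OF YK[OF l]]] bracket_const_vf[OF l(2) W[OF YK[OF j]]])
    have "vf_bracket n (R j) (R l) \<in> PF n k e" using VF_bracket[OF R[OF j] R[OF l]] by simp
    then have "lowfree n k e (vf_bracket n (R j) (R l))" using VF_bw_iff(1)[OF e, of 0] by simp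
    then have "fps_nth (vf_bracket n (R j) (R l) i D) 0 = 0" using lowfreeD i D by metis
    moreover have "fps_nth (vf_bracket n (Y j) (Y l) i D) 0 = 0"
      using lowfreeD[OF low[OF kk(4)[OF YK[OF j] YK[OF l]]] i D] .
    ultimately show ?thesis unfolding br by simp
  qed
  define Z where "Z = potential n k e Y"
  have aZ: "adm n Z" unfolding Z_def by (rule adm_potential[OF k odd])
  have ZV: "Z \<in> VF n (int e) (bw n k e) 1" unfolding Z_def by (rule potential_VF)
  have ZW: "Z \<in> W n" unfolding Z_def by (rule potential_W)
  define v where "v = exv n Z (- 1)"
  define K' where "K' = v ` K"
  have "vf_bracket n Z T = 0" if "T \<in> B" for T
  proof -
    have "T = top_vf n" using that B by blast
    moreover have "{n - k<..n} \<subseteq> {1..n}" by auto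
    ultimately show ?thesis using top_commute potential_VF(1) by (simp add: Z_def)
  qed
  then have m: "moved n B K K'" unfolding K'_def v_def by (intro moved_exv n aZ)
  have O': "open_inv n B K'" by (rule moved_open_inv[OF n m K])
  have vY: "v (Y j) - const_vf j \<in> PF n k (Suc e)" if j: "n - k < j" "j \<le> n" for j
  proof -
    \<comment> \<open>This is Y_j - \<partial>_j - [Z, \<partial>_j], the part of the conjugated
      field that decides the terms of size e. There the Poincare lemma makes R_j and
      [\<partial>_j, Z] cancel; [Z, R_j] has degree at least 1.\<close>
    define P where "P = R j + vf_bracket n (const_vf j) Z"
    have bc: "vf_bracket n (const_vf j) Z i = pd j (Z i)" for i by (simp add: bracket_const_vf[OF j(2) ZW])
    have Zhigh: "Z i = 0" if "n - k < i" for i using that by (auto simp: Z_def potential_def)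
    have "P \<in> PF n k (Suc e)"
    proof (rule VF_bw_iff(2))
      show "P \<in> W n"
        unfolding P_def by (intro vf.subspace_add[OF W_subspace] VF_W[OF R[OF j]] W_bracket const_vf_W j ZW)
      show "cf P i = 0" if "n - k < i" for i
        using PF_cf[OF e R[OF j], of i] Zhigh[OF that] by (simp add: P_def cf_add) (simp add: cf_def bc)
      show "lowfree n k (Suc e) P"
        unfolding lowfree_def
      proof (intro allI impI)
        fix i A assume i: "i \<le> n - k" and A: "A \<subseteq> {n - k<..n}" "card A < Suc e"
        have P: "fps_nth (P i A) 0 = fps_nth (R j i A) 0 + fps_nth (pd j (Z i) A) 0" by (simp add: P_def bc)
        show "fps_nth (P i A) 0 = 0"
        proof (cases "card A = e")
          case True
          have "R j i A = Y j i A" using i j by (simp add: R_def const_vf_apply)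
          moreover have "fps_nth (pd j (Z i) A) 0 = - fps_nth (Y j i A) 0"
            unfolding Z_def by (rule pd_potential[OF j i A(1) True _ e]) (rule closed[OF _ _ _ _ _ _ i])
          ultimately have pd: "fps_nth (pd j (Z i) A) 0 = - fps_nth (R j i A) 0" by simp
          then show ?thesis
            using P pd by simp
        next
          case False
          then have A': "card A < e" using A(2) by simp
          have "finite A" using A(1) finite_subset by blast
          then have "card (insert j A) < Suc e" using A' by (metis Suc_mono card_insert_le_m1 card_insert_disjoint insert_absorb less_SucI)
          then have "pd j (Z i) A = 0" using j by (auto simp: pd_def d_xi_apply Z_def potential_def)
          moreover have "lowfree n k e (R j)" using VF_bw_iff(1)[OF e, of 0] R[OF j] by simp
          ultimately show ?thesis using P lowfreeD[OF _ i A(1) A'] by simp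
        qed
      qed
    qed auto
    then have "P - vf_bracket n Z (R j) \<in> PF n k (Suc e)"
    proof (rule vf.subspace_diff[OF VF_subspace])
      show "vf_bracket n Z (R j) \<in> PF n k (Suc e)"
        by (rule VF_bw_1[OF e]) (use VF_bracket[OF ZV R[OF j]] in simp)
    qed
    moreover have "v (Y j) - (Y j - vf_bracket n Z (Y j)) \<in> PF n k (Suc e)"
    proof (rule VF_bw_1[OF e])
      have "const_vf j \<in> VF n (int e) (bw n k e) (- 1)"
      proof -
        have "- 1 \<le> vf_deg (int e) (bw n k e) m A i" if "fps_nth (const_vf j i A) m \<noteq> 0" for i A m
        proof -
          have "i = j" "A = {}" "m = 0"
            using that by (auto simp: const_vf_apply sfun_one_def split: if_splits)
          then show ?thesis using j by (simp add: bw_deg_low)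
        qed
        then show ?thesis using const_vf_W[OF j(2)] by (simp add: VF_def)
      qed
      moreover have "R j \<in> VF n (int e) (bw n k e) (- 1)" by (rule VF_mono[OF _ R[OF j]]) simp
      ultimately have "const_vf j + R j \<in> VF n (int e) (bw n k e) (- 1)" by (rule vf.subspace_add[OF VF_subspace])
      then have "Y j \<in> VF n (int e) (bw n k e) (- 1)" by (simp add: R_def)
      from exv_first_order[OF ZV this]
      show "v (Y j) - (Y j - vf_bracket n Z (Y j)) \<in> VF n (int e) (bw n k e) 1" by (simp only: v_def)
    qed
    ultimately have "P - vf_bracket n Z (R j) + (v (Y j) - (Y j - vf_bracket n Z (Y j))) \<in> PF n k (Suc e)"
      by (rule vf.subspace_add[OF VF_subspace])
    moreover have "vf_bracket n Z (const_vf j) = - vf_bracket n (const_vf j) Z"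
      using vf_bracket_skew aZ by (simp add: adm_def)
    then have "vf_bracket n Z (R j) = vf_bracket n Z (Y j) + vf_bracket n (const_vf j) Z"
      by (simp add: R_def vf_bracket_diff_right)
    ultimately show ?thesis by (simp add: P_def R_def)
  qed
  have cv: "cf (v (Y j)) i = (if i = j then 1 else 0)" if "n - k < j" "j \<le> n" for i j
    using PF_cf[OF _ vY[OF that], of i] by (simp add: cf_diff cf_const)
  have "leads n k K'"
    unfolding leads_def K'_def using cv YK by blast
  \<comment> \<open>\<open>exv\<close> preserves \<open>PF n k e\<close>, but not obviously
    \<open>lowfree\<close>; so X is split into its leads and a rest in \<open>PF n k e\<close>, and
    the leads are handled through v (Y_j).\<close>
  moreover have low': "lowfree n k e X'" if X': "X' \<in> K'" for X'
  proof -
    obtain X where X: "X \<in> K" "X' = v X" using X' unfolding K'_def by blast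
    define X0 where "X0 = X - (\<Sum>j\<in>{n - k<..n}. vf_scale (cf X j) (Y j))"
    have "X0 \<in> PF n k e" unfolding X0_def
      by (rule remove_leads[OF W[OF X(1)] e _ low[OF X(1)]]) (use R in \<open>simp add: R_def\<close>)
    then have "v X0 \<in> PF n k e" unfolding v_def by (rule exv_VF[OF ZV])
    then have l0: "lowfree n k e (v X0)" using VF_bw_iff(1)[OF e, of 0] by simp
    have lY: "lowfree n k e (v (Y j))" if j: "n - k < j" "j \<le> n" for j
    proof -
      have "v (Y j) - const_vf j \<in> PF n k e" by (rule PF_Suc[OF e vY[OF j]])
      then have "lowfree n k e (v (Y j) - const_vf j)" using VF_bw_iff(1)[OF e, of 0] by simp
      from lowfree_add[OF this lowfree_const[OF j(1)]] show ?thesis by simp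
    qed
    have vsum: "v (\<Sum>j\<in>I. f j) = (\<Sum>j\<in>I. v (f j))" for I :: "nat set" and f
      using sum_comp_morphism[of v f I] by (simp add: v_def exv_add o_def exv_zero)
    have "X = X0 + (\<Sum>j\<in>{n - k<..n}. vf_scale (cf X j) (Y j))" by (simp add: X0_def)
    then have "v X = v X0 + (\<Sum>j\<in>{n - k<..n}. vf_scale (cf X j) (v (Y j)))"
      using vsum by (metis (no_types, lifting) v_def exv_add exv_scale sum.cong)
    moreover have "lowfree n k e (\<Sum>j\<in>{n - k<..n}. vf_scale (cf X j) (v (Y j)))"
      by (rule lowfree_sum, rule lowfree_scale, rule lY) auto
    ultimately show ?thesis using lowfree_add[OF l0] X(2) by simp
  qed
  moreover have "lowfree n k (Suc e) X" if "X \<in> K'" for X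
  proof (rule lowfree_step[OF n O' e low' _ that])
    show "v (Y j) \<in> K' \<and> v (Y j) - const_vf j \<in> PF n k (Suc e)" if "n - k < j" "j \<le> n" for j
      using vY[OF that] YK[OF that] by (simp add: K'_def)
  qed
  ultimately show ?thesis using m by metis
qed

lemma straighten:
  assumes B: "B \<subseteq> {top_vf n}" and k: "k < n" and K: "open_inv n B K"
    and low: "\<And>X. X \<in> K \<Longrightarrow> lowfree n k 1 X" and ld: "leads n k K"
  shows "\<exists>K'. moved n B K K' \<and> K' \<subseteq> GS n k"
proof -
  have n: "n \<ge> 1" using k by simp
  have B': "B \<subseteq> {euler n, top_vf n}" using B by blast
  have "\<exists>K'. moved n B K K' \<and> leads n k K' \<and> (\<forall>X\<in>K'. lowfree n k (Suc e) X)" for e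
  proof (induction e)
    case 0
    show "\<exists>K'. moved n B K K' \<and> leads n k K' \<and> (\<forall>X\<in>K'. lowfree n k (Suc 0) X)"
      using moved_refl[OF n] low ld by (intro exI[of _ K]) simp
  next
    case (Suc e)
    then obtain K' where K': "moved n B K K'" "leads n k K'" "\<And>X. X \<in> K' \<Longrightarrow> lowfree n k (Suc e) X" by metis
    have "open_inv n B K'" by (rule moved_open_inv[OF n K'(1) K])
    then obtain K'' where K'': "moved n B K' K''" "leads n k K''" "\<forall>X\<in>K''. lowfree n k (Suc (Suc e)) X"
      using straighten_step[OF B k _ _ K'(3,2)] by auto
    have "moved n B K K''" by (rule moved_trans[OF n B' K'(1) K''(1)])
    then show "\<exists>K'. moved n B K K' \<and> leads n k K' \<and> (\<forall>X\<in>K'. lowfree n k (Suc (Suc e)) X)"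
      using K''(2,3) by metis
  qed
  then obtain K' where K': "moved n B K K'" "\<And>X. X \<in> K' \<Longrightarrow> lowfree n k (Suc n) X" by metis
  have "K' \<subseteq> S n" by (rule open_invD(1)[OF moved_open_inv[OF n K'(1) K]])
  then have "K' \<subseteq> GS n k" using lowfree_GS[OF n _ K'(2)] by blast
  then show ?thesis using K'(1) by metis
qed

section \<open>From normal forms to maximal subalgebras\<close>

section \<open>Classification\<close>

text \<open>If E acts, the linear normal form already suffices, and the top field, if present, only
  bounds k. Otherwise B consists of the top field, whose action gives the k < n that
  \<open>straighten\<close> relies on.\<close>

lemma maximal_conjugate_GS:
  assumes n: "n \<ge> 1" and B: "B \<subseteq> {euler n, top_vf n}" and K: "maximal_open_inv n (S n) (vf.span B) K"
    and ne: "B \<noteq> {}"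
  obtains k where "k \<le> n" "top_vf n \<in> B \<Longrightarrow> k < n" "conjugate_in n (S n) (GS n k) K"
proof -
  have KO: "open_inv n B K" using K open_inv_iff[OF n] by (simp add: maximal_open_inv_def)
  obtain k K' where K': "k \<le> n" "moved n B K K'" "leads n k K'" "\<And>X. X \<in> K' \<Longrightarrow> lowfree n k 1 X"
    using linear_normal_form[OF n B KO] by metis
  have O': "open_inv n B K'" by (rule moved_open_inv[OF n K'(2) KO])
  have k: "k < n" if "top_vf n \<in> B" by (rule top_invariant_lt[OF n O' that K'(3,1)])
  have "\<exists>K''. moved n B K' K'' \<and> K'' \<subseteq> GS n k"
  proof (cases "euler n \<in> B")
    case True
    have "K' \<subseteq> GS n k" by (rule euler_invariant_GS[OF n O' True K'(3,4)])
    then show ?thesis using moved_refl[OF n] by metis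
  next
    case False
    then have B': "B \<subseteq> {top_vf n}" "top_vf n \<in> B" using B ne by auto
    show ?thesis by (rule straighten[OF B'(1) k[OF B'(2)] O' K'(4,3)])
  qed
  then obtain K'' where K'': "moved n B K' K''" "K'' \<subseteq> GS n k" by metis
  have "moved n B K K''" by (rule moved_trans[OF n B K'(2) K''(1)])
  then obtain u v where g: "inner_pair n B u v" "K'' = v ` K" unfolding moved_def by metis
  have "v ` K \<subseteq> GS n k" using g(2) K''(2) by simp
  then have "conjugate_in n (S n) (GS n k) K"
    by (rule maximal_conjugate[OF n K g(1) _ open_inv_GS[OF n B k]])
  then show thesis using that K'(1) k by metis
qed

lemma maximal_GS:
  assumes n: "n \<ge> 2" and B: "B \<subseteq> {euler n, top_vf n}" and k: "top_vf n \<in> B \<Longrightarrow> k < n"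
  shows "maximal_open_inv n (S n) (vf.span B) (GS n k)"
proof -
  have n1: "n \<ge> 1" using n by simp
  show ?thesis
    unfolding maximal_open_inv_def open_inv_iff[OF n1]
    using open_inv_GS[OF n1 B k] GS_maximal[OF n] open_inv_iff[OF n1, of _ B] by auto
qed

theorem theorem2p17:
  fixes n :: nat
  assumes "n \<ge> 3"
  shows
    "((\<forall>K. maximal_open_inv n (S n) (vf.span {euler n}) K \<longrightarrow>
         (\<exists>k\<le>n. conjugate_in n (S n) (graded_subalgebra n (S n) 1 (ones_zeros n k)) K)) \<and>
      (\<forall>k\<le>n. maximal_open_inv n (S n) (vf.span {euler n})
         (graded_subalgebra n (S n) 1 (ones_zeros n k))))
     \<and>
     (\<forall>\<aa>. \<aa> = vf.span {top_vf n} \<or> \<aa> = vf.span {euler n, top_vf n} \<longrightarrow>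
        (\<forall>K. maximal_open_inv n (S n) \<aa> K \<longrightarrow>
           (\<exists>k\<le>n - 1. conjugate_in n (S n) (graded_subalgebra n (S n) 1 (ones_zeros n k)) K)) \<and>
        (\<forall>k\<le>n - 1. maximal_open_inv n (S n) \<aa>
           (graded_subalgebra n (S n) 1 (ones_zeros n k))))"
proof -
  have n: "n \<ge> 1" "n \<ge> 2" using assms by simp_all
  have "top_vf n 0 {1..n} \<noteq> euler n 0 {1..n}"
    using assms by (auto simp: top_vf_def vf_monom_def euler_0)
  then have et: "top_vf n \<noteq> euler n" by metis
  have top: "(\<forall>K. maximal_open_inv n (S n) (vf.span B) K \<longrightarrow>
           (\<exists>k\<le>n - 1. conjugate_in n (S n) (GS n k) K)) \<and>
        (\<forall>k\<le>n - 1. maximal_open_inv n (S n) (vf.span B) (GS n k))"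
    if B: "B \<subseteq> {euler n, top_vf n}" "top_vf n \<in> B" for B
  proof (intro conjI allI impI)
    fix K assume K: "maximal_open_inv n (S n) (vf.span B) K"
    have "B \<noteq> {}" using B(2) by blast
    then obtain k where "k \<le> n" "top_vf n \<in> B \<Longrightarrow> k < n" "conjugate_in n (S n) (GS n k) K"
      using maximal_conjugate_GS[OF n(1) B(1) K] by metis
    moreover have "k \<le> n - 1" using calculation(2)[OF B(2)] by simp
    ultimately show "\<exists>k\<le>n - 1. conjugate_in n (S n) (GS n k) K" by metis
  next
    fix k assume "k \<le> n - 1"
    then show "maximal_open_inv n (S n) (vf.span B) (GS n k)"
      using n by (intro maximal_GS[OF n(2) B(1)]) simp
  qed
  have "\<exists>k\<le>n. conjugate_in n (S n) (GS n k) K" if K: "maximal_open_inv n (S n) (vf.span {euler n}) K" for K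
    using maximal_conjugate_GS[OF n(1) _ K] by (metis empty_not_insert insertI1 singletonD subsetI insertCI)
  moreover have "maximal_open_inv n (S n) (vf.span {euler n}) (GS n k)" for k
    using et by (intro maximal_GS[OF n(2)]) auto
  moreover note top[of "{top_vf n}"] top[of "{euler n, top_vf n}"]
  ultimately show ?thesis
    unfolding graded_subalgebra_eq[OF n(1)] by auto
qed

end
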